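(* Let $\mathcal D=U(-1,1)$ and let $(N,u)\sim H(n,\mathcal D)$ be a random additively separable hedonic game with $n$ agents. Then the probability that Algorithm 1 (described in the context), run on $(N,u)$, outputs an individually stable partition tends to $1$ as $n\to\infty$.
   Context: Additively separable hedonic game (ASHG): a finite agent set $N$ and utilities $u_a(b)\in\mathbb R$ for ordered pairs $a\neq b$. For a coalition $C\ni a$, $u_a(C)=\sum_{b\in C\setminus\{a\}}u_a(b)$ (empty sum $=0$); for $a\notin C$ we also write $u_a(C)=\sum_{b\in C}u_a(b)$. For a partition $\pi$ of $N$, $\pi(a)$ is the coalition containing $a$ and $u_a(\pi)=u_a(\pi(a))$. Random model $H(n,\mathcal D)$: $|N|=n$ and all $u_a(b)$, $a\ne b$, are i.i.d. samples from $\mathcal D$. A single-agent deviation by $a$ moves $a$ from $\pi(a)$ to another coalition of $\pi$ or to a new singleton coalition, all else unchanged; it is a Nash deviation if $a$'s new coalition $C'$ satisfies $u_a(C')>u_a(\pi(a))$. For a coalition $C$ and agent $a$, $\mathrm{FavorOut}(C,a)=\{b\in C\setminus\{a\}: u_b(C\setminus\{a\})>u_b(C\cup\{a\})\}$ (equivalently $u_b(a)<0$). An individual deviation is a Nash deviation such that $\mathrm{FavorOut}(C',a)=\emptyset$ for the joined coalition $C'$ (vacuous for the new singleton). A partition is individually stable if no individual deviation exists. Algorithm 1 (input $(N,u)$, $n=|N|$, $s=\lceil \frac{\log_{16} n}{2}\rceil$); all "select" steps may be arbitrary. Stage 1: Partition $N$ into $N^1,\dots,N^{20}$ with $|N^i|\in\{\lfloor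 n/20\rfloor,\lceil n/20\rceil\}$. For each $i$ run the greedy clique procedure on the subgame induced by $N^i$: set $\pi_i=\emptyset$, $R=N^i$; while $R\neq\emptyset$: select $v\in R$, $C=\{v\}$, $L=R\setminus\{v\}$; while $L\ne\emptyset$ and $|C|<s$: select $w\in L$; if $u_w(z)\ge\frac12$ and $u_z(w)\ge \frac12$ for all $z\in C$ (checked pair by pair, stopping at the first failed check), add $w$ to $C$; remove $w$ from $L$. If $|C|<s$, stop and output $(\pi_i,R^i_1)$ with $R^i_1=R$; otherwise set $R\leftarrow R\setminus C$, $\pi_i\leftarrow \pi_i\cup\{C\}$. (If $R$ becomes empty output $(\pi_i,\emptyset)$.) Let $R_1=\bigcup_i R_1^i$. Stage 2: For $k\in[20]$, a coalition $C\in\pi_k$ is compatible with a set $M$ of agents if for all $a\in M$, $b\in C$: $u_a(C)\ge -\frac{1}{80}s$ and $u_b(M)\ge -\frac{k-1}{80}s$. Set $\pi=\emptyset$. While $\pi_1\ne\emptyset$: for $k=1,\dots,20$, let $C_k$ be the first (in some order) $C\in\pi_k$ compatible with $C_1\cup\dots\cup C_{k-1}$ (or $C_k=\emptyset$ if none); the utilities between the two sides are read in each such check. If some $C_k=\emptyset$, stop; else remove each $C_k$ from $\pi_k$ and add $C_1\cup\dots\cup C_{20}$ to $\pi$. Let $R_2$ be the set of agents remaining in $\pi_1,\dots,\pi_{20}$. Stage 3: For each $x\in R=R_1\cup R_2$ in turn, select a coalition $C\in\pi$ that has not yet received an extra agent, such that $u_x(C)>0$ and no Stage-2 compatibility check involved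 $x$ on one side and an agent of $C$ on the other side; replace $C$ by $C\cup\{x\}$ (each coalition receives at most one extra agent). If no such $C$ exists, the algorithm fails (counted as not producing the desired partition). Output the resulting partition of $N$. *)

theory Defs
  imports "HOL-Probability.Probability"
begin

text \<open>Agents are natural numbers, the agent set is {0..<n}; u a b is u_a(b).\<close>

type_synonym utility = "nat \<Rightarrow> nat \<Rightarrow> real"

text \<open>u_a(C) = sum over C minus a (covers both a in C and a not in C).\<close>
definition util :: "utility \<Rightarrow> nat \<Rightarrow> nat set \<Rightarrow> real" where
  "util u a C = (\<Sum>b\<in>C - {a}. u a b)"

definition favor_out :: "utility \<Rightarrow> nat set \<Rightarrow> nat \<Rightarrow> nat set" where
  "favor_out u C a = {b \<in> C - {a}. util u b (C - {a}) > util u b (C \<union> {a})}"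

text \<open>An individual deviation of agent a: a joins a coalition T of the partition
  not containing a, or T = {} (a new singleton); the new coalition is insert a T.\<close>
definition individually_stable :: "utility \<Rightarrow> nat set \<Rightarrow> nat set set \<Rightarrow> bool" where
  "individually_stable u N \<pi> \<longleftrightarrow>
     \<not> (\<exists>a\<in>N. \<exists>A\<in>\<pi>. a \<in> A \<and> (\<exists>T \<in> insert {} \<pi>. a \<notin> T \<and>
          util u a (insert a T) > util u a A \<and> favor_out u (insert a T) a = {}))"

definition s_param :: "nat \<Rightarrow> nat" where
  "s_param n = nat \<lceil>log 16 (real n) / 2\<rceil>"

text \<open>A selection strategy: resolves every "select" step of the algorithm as a function
  of the current algorithm state (it does not see the utilities directly).\<close>
record strat =
  part :: "nat \<Rightarrow> nat set"
  selV :: "nat \<Rightarrow> nat set set \<Rightarrow> nat set \<Rightarrow> nat"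
  selW :: "nat \<Rightarrow> nat set set \<Rightarrow> nat set \<Rightarrow> nat set \<Rightarrow> nat set \<Rightarrow> nat"
  ord2 :: "nat \<Rightarrow> nat set set \<Rightarrow> nat set set \<Rightarrow> nat set \<Rightarrow> nat set list"
  selX :: "nat set set \<Rightarrow> nat set set \<Rightarrow> nat set \<Rightarrow> nat"
  selC :: "nat \<Rightarrow> nat set set \<Rightarrow> nat set set \<Rightarrow> nat set set \<Rightarrow> nat set"

definition valid_strat :: "nat \<Rightarrow> strat \<Rightarrow> bool" where
  "valid_strat n \<sigma> \<longleftrightarrow>
     (\<forall>i\<in>{1..20}. part \<sigma> i \<subseteq> {0..<n} \<and> card (part \<sigma> i) \<in> {n div 20, (n + 19) div 20}) \<and>
     (\<forall>i\<in>{1..20}. \<forall>j\<in>{1..20}. i \<noteq> j \<longrightarrow> part \<sigma> i \<inter> part \<sigma> j = {}) \<and>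
     (\<Union>i\<in>{1..20}. part \<sigma> i) = {0..<n} \<and>
     (\<forall>i P R. finite R \<and> R \<noteq> {} \<longrightarrow> selV \<sigma> i P R \<in> R) \<and>
     (\<forall>i P R C L. finite L \<and> L \<noteq> {} \<longrightarrow> selW \<sigma> i P R C L \<in> L) \<and>
     (\<forall>k Pi P M. finite P \<longrightarrow> distinct (ord2 \<sigma> k Pi P M) \<and> set (ord2 \<sigma> k Pi P M) = P) \<and>
     (\<forall>U D R. finite R \<and> R \<noteq> {} \<longrightarrow> selX \<sigma> U D R \<in> R) \<and>
     (\<forall>x U D Cs. finite Cs \<and> Cs \<noteq> {} \<longrightarrow> selC \<sigma> x U D Cs \<in> Cs)"

definition clique_ok :: "utility \<Rightarrow> nat set \<Rightarrow> nat \<Rightarrow> bool" where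
  "clique_ok u C w \<longleftrightarrow> (\<forall>z\<in>C. u w z \<ge> 1/2 \<and> u z w \<ge> 1/2)"

text \<open>Inner loop (fuel argument = card L suffices).\<close>
fun grow :: "strat \<Rightarrow> utility \<Rightarrow> nat \<Rightarrow> nat \<Rightarrow> nat set set \<Rightarrow> nat set \<Rightarrow> nat
             \<Rightarrow> nat set \<Rightarrow> nat set \<Rightarrow> nat set" where
  "grow \<sigma> u s i P R 0 C L = C"
| "grow \<sigma> u s i P R (Suc f) C L =
     (if L = {} \<or> card C \<ge> s then C
      else let w = selW \<sigma> i P R C L
           in grow \<sigma> u s i P R f (if clique_ok u C w then insert w C else C) (L - {w}))"

text \<open>Outer loop (fuel argument = card R + 1 suffices).\<close>
fun greedy :: "strat \<Rightarrow> utility \<Rightarrow> nat \<Rightarrow> nat \<Rightarrow> nat \<Rightarrow> nat set set \<Rightarrow> nat set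
               \<Rightarrow> nat set set \<times> nat set" where
  "greedy \<sigma> u s i 0 P R = (P, R)"
| "greedy \<sigma> u s i (Suc f) P R =
     (if R = {} then (P, {})
      else let v = selV \<sigma> i P R;
               C = grow \<sigma> u s i P R (card R) {v} (R - {v})
           in if card C < s then (P, R) else greedy \<sigma> u s i f (insert C P) (R - C))"

definition stage1 :: "strat \<Rightarrow> utility \<Rightarrow> nat \<Rightarrow> nat \<Rightarrow> nat set set \<times> nat set" where
  "stage1 \<sigma> u n i = greedy \<sigma> u (s_param n) i (Suc (card (part \<sigma> i))) {} (part \<sigma> i)"

definition compatible :: "utility \<Rightarrow> nat \<Rightarrow> nat \<Rightarrow> nat set \<Rightarrow> nat set \<Rightarrow> bool" where
  "compatible u s k M C \<longleftrightarrow>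
     (\<forall>a\<in>M. \<forall>b\<in>C. util u a C \<ge> - (real s / 80) \<and> util u b M \<ge> - (real (k - 1) * real s / 80))"

text \<open>Scan candidates in the given order; returns the first compatible one (if any)
  and the set of read pairs (a,b), a in M, b in a checked candidate.\<close>
fun scan :: "utility \<Rightarrow> nat \<Rightarrow> nat \<Rightarrow> nat set \<Rightarrow> nat set list \<Rightarrow> nat set option \<times> (nat \<times> nat) set" where
  "scan u s k M [] = (None, {})"
| "scan u s k M (C # Cs) =
     (if compatible u s k M C then (Some C, M \<times> C)
      else (let r = scan u s k M Cs in (fst r, M \<times> C \<union> snd r)))"

fun pick_round :: "strat \<Rightarrow> utility \<Rightarrow> nat \<Rightarrow> (nat \<Rightarrow> nat set set) \<Rightarrow> nat set set \<Rightarrow> nat list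
                   \<Rightarrow> nat set \<Rightarrow> (nat \<Rightarrow> nat set) \<Rightarrow> (nat \<times> nat) set
                   \<Rightarrow> (nat \<Rightarrow> nat set) option \<times> (nat \<times> nat) set" where
  "pick_round \<sigma> u s pis P [] M acc chk = (Some acc, chk)"
| "pick_round \<sigma> u s pis P (k # ks) M acc chk =
     (let r = scan u s k M (ord2 \<sigma> k P (pis k) M) in
      case fst r of
        None \<Rightarrow> (None, chk \<union> snd r)
      | Some C \<Rightarrow> pick_round \<sigma> u s pis P ks (M \<union> C) (acc(k := C)) (chk \<union> snd r))"

fun stage2_loop :: "strat \<Rightarrow> utility \<Rightarrow> nat \<Rightarrow> nat \<Rightarrow> (nat \<Rightarrow> nat set set) \<Rightarrow> nat set set
                    \<Rightarrow> (nat \<times> nat) set \<Rightarrow> (nat \<Rightarrow> nat set set) \<times> nat set set \<times> (nat \<times> nat) set" where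
  "stage2_loop \<sigma> u s 0 pis P chk = (pis, P, chk)"
| "stage2_loop \<sigma> u s (Suc f) pis P chk =
     (if pis 1 = {} then (pis, P, chk)
      else let r = pick_round \<sigma> u s pis P [1..<21] {} (\<lambda>_. {}) chk in
           case fst r of
             None \<Rightarrow> (pis, P, snd r)
           | Some cs \<Rightarrow> stage2_loop \<sigma> u s f (\<lambda>k. pis k - {cs k})
                          (insert (\<Union>k\<in>{1..20}. cs k) P) (snd r))"

text \<open>U: coalitions of pi not yet extended, D: already extended coalitions, Rem: agents still
  to be placed.  None means failure.\<close>
fun stage3 :: "strat \<Rightarrow> utility \<Rightarrow> (nat \<times> nat) set \<Rightarrow> nat \<Rightarrow> nat set set \<Rightarrow> nat set set
               \<Rightarrow> nat set \<Rightarrow> nat set set option" where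
  "stage3 \<sigma> u chk 0 U D Rem = (if Rem = {} then Some (U \<union> D) else None)"
| "stage3 \<sigma> u chk (Suc f) U D Rem =
     (if Rem = {} then Some (U \<union> D)
      else let x = selX \<sigma> U D Rem;
               cands = {C \<in> U. util u x C > 0 \<and> (\<forall>b\<in>C. (x, b) \<notin> chk \<and> (b, x) \<notin> chk)}
           in if cands = {} then None
              else let C = selC \<sigma> x U D cands
                   in stage3 \<sigma> u chk f (U - {C}) (insert (insert x C) D) (Rem - {x}))"

definition run_alg :: "nat \<Rightarrow> strat \<Rightarrow> utility \<Rightarrow> nat set set option" where
  "run_alg n \<sigma> u =
     (let s = s_param n;
          pis0 = (\<lambda>k. fst (stage1 \<sigma> u n k));
          R1 = (\<Union>i\<in>{1..20}. snd (stage1 \<sigma> u n i));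
          r2 = stage2_loop \<sigma> u s (Suc (card (pis0 1))) pis0 {} {};
          pisF = fst r2; P = fst (snd r2); chk = snd (snd r2);
          R2 = (\<Union>k\<in>{1..20}. \<Union> (pisF k));
          R = R1 \<union> R2
      in stage3 \<sigma> u chk (card R) P {} R)"

definition outputs_IS :: "nat \<Rightarrow> strat \<Rightarrow> utility \<Rightarrow> bool" where
  "outputs_IS n \<sigma> u \<longleftrightarrow>
     (\<exists>\<pi>. run_alg n \<sigma> u = Some \<pi> \<and> partition_on {0..<n} \<pi> \<and> individually_stable u {0..<n} \<pi>)"

definition utility_space :: "nat \<Rightarrow> (nat \<times> nat \<Rightarrow> real) measure" where
  "utility_space n = PiM {(a, b). a < n \<and> b < n \<and> a \<noteq> b}
                         (\<lambda>_. uniform_measure lborel {-1<..<(1::real)})"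

end

theory Submission
  imports Defs "HOL-Real_Asymp.Real_Asymp"
begin

text \<open>Stage 1 reads only utilities inside the classes \<open>N\<^sup>i\<close>, so one may condition on its outcome; from any
  set of \<open>n powr (3/5)\<close> remaining agents it finds a further clique, except with negligible probability.

  In Stage 2 the run so far depends on the very utilities whose randomness is needed next. Let \<open>D\<close>
  be a set of agents disjoint from all coalitions formed so far and replace every utility touching
  \<open>D\<close> by \<open>-1\<close>, the lowest possible value. Lowering utilities preserves every rejection, so these
  ghost utilities produce the same run. Hence the run lies in an event that is independent of the
  utilities touching \<open>D\<close>. For \<open>D = C\<^sub>1 \<union> \<dots> \<union> C\<^bsub>k-1\<^esub>\<close> this shows that
  each remaining clique of class \<open>k\<close> is incompatible with conditional probability at most \<open>1/2\<close>,
  independently of the others, so a round fails only when a class is almost exhausted. For the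
  clique \<open>D\<close> of an unmerged agent \<open>x\<close> it shows that the number of merged coalitions that can take
  \<open>x\<close> in Stage 3 dominates a binomial variable whose mean far exceeds the number of remaining agents.

  A merged coalition gives each member at least \<open>(s - 1) / 2 - 19 s / 80\<close>, which is at least \<open>1\<close>, so adding one
  more agent leaves everybody individually rational. For an agent \<open>a\<close> of class \<open>i\<close> outside a merged
  coalition \<open>T\<close>, lowering a utility \<open>u b a\<close> with \<open>b\<close> in \<open>T - N\<^sup>i\<close> cannot undo the formation of \<open>T\<close>. Flipping the
  signs of these \<open>19 s\<close> utilities one by one bounds the probability that \<open>T\<close> is formed and none of
  them is negative by \<open>2 powr (- 19 s)\<close>, which is at most \<open>n powr (-19/8)\<close> and survives a union bound.\<close>

text \<open>The constants balance competing exponents. A pair of agents passes the mutual test with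
  probability 1/16, so an incomplete clique accepts a further agent with probability at least
  \<open>n powr (-1/2)\<close>; the exponent 3/5 only has to exceed 1/2. A merged coalition accepts
  a leftover agent with probability of order at least \<open>n powr (-1/4)\<close>: utilities
  towards 2 s of its members are asked to add up to s, which outweighs the s members of the agent's
  own class, whose utilities Stage 1 may already have read. About n / (20 s) coalitions then give a
  mean of \<open>n powr (3/4)\<close> up to a logarithm, against roughly \<open>n powr (3/5)\<close>
  leftover agents. With twenty classes 19/8 exceeds 2, the exponent of the union bound over an
  outsider and a member of a coalition. The losses 19 s / 80 stay below the gain s / 2 inside a
  clique. The set \<open>D\<close> must not be random. In a failing round the prefix is itself a
  product of the run, so it is fixed in advance and a union bound over its at most 19 parts is paid;
  the resulting power of n is harmless against the exponentially small probability that more than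
  \<open>n powr (1/4)\<close> cliques are all rejected.\<close>

abbreviation unif :: "real measure" where
  "unif \<equiv> uniform_measure lborel {-1<..<(1::real)}"

section \<open>The uniform distribution on (-1,1) and its symmetries\<close>

lemma prob_space_unif: "prob_space unif"
  by (rule prob_space_uniform_measure) auto

lemma measure_unif:
  assumes "A \<in> sets borel"
  shows "measure unif A = measure lborel ({-1<..<1} \<inter> A) / 2"
  using assms by simp

lemma measure_unif_ge_half: "measure unif {x. 1/2 \<le> x} = 1/4"
proof -
  have "{-1<..<1} \<inter> {x. 1/2 \<le> x} = {1/2..<(1::real)}" by auto
  moreover have "{x::real. 1/2 \<le> x} \<in> sets borel" by measurable
  ultimately show ?thesis by (simp only: measure_unif) simp
qed

lemma AE_unif_abs_less: "AE x in unif. \<bar>x\<bar> < 1"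
  by (rule AE_uniform_measureI) auto

lemma AE_unif_nonzero: "AE x in unif. x \<noteq> 0"
  by (rule AE_uniform_measureI) (auto intro: AE_I[of _ _ "{0}"])

lemma emeasure_unif:
  assumes "A \<in> sets borel"
  shows "emeasure unif A = emeasure lborel ({-1<..<1} \<inter> A) / 2"
  using assms by simp

text \<open>A reflection is affine with slope -1. The case \<open>c = 0\<close> yields the sign
  symmetry of the uniform law, the case \<open>c = 1\<close> the mirror image of (0,1).\<close>

lemma emeasure_lborel_reflect:
  assumes [measurable]: "A \<in> sets borel"
  shows "emeasure lborel ((\<lambda>x. c - x) -` A) = emeasure lborel (A :: real set)"
proof -
  have "emeasure lborel A = emeasure (distr lborel borel (\<lambda>x. c + (-1) * x)) A"
    using lborel_real_affine[of "-1" c] by (simp add: density_1)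
  also have "\<dots> = emeasure lborel ((\<lambda>x. c + (-1) * x) -` A \<inter> space lborel)"
    by (rule emeasure_distr) auto
  finally show ?thesis by simp
qed

lemma distr_unif_uminus: "distr unif unif uminus = unif"
proof (rule measure_eqI)
  fix A :: "real set" assume "A \<in> sets (distr unif unif uminus)"
  then have A[measurable]: "A \<in> sets borel" by simp
  have "emeasure (distr unif unif uminus) A = emeasure unif (uminus -` A)"
    by (subst emeasure_distr) auto
  also have "\<dots> = emeasure lborel ({-1<..<1} \<inter> uminus -` A) / 2"
    by (rule emeasure_unif) (use measurable_sets_borel[of uminus borel A] A in auto)
  also have "{-1<..<1} \<inter> uminus -` A = (\<lambda>x. 0 - x) -` ({-1<..<1} \<inter> A)" by auto
  also have "emeasure lborel \<dots> = emeasure lborel ({-1<..<1} \<inter> A)"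
    by (rule emeasure_lborel_reflect) auto
  finally show "emeasure (distr unif unif uminus) A = emeasure unif A"
    by (simp add: emeasure_unif)
qed simp

text \<open>Mirrors (0,1) at 1/2 and fixes every other real, so the uniform law is preserved. On a
  block of entries from (0,1) it turns the sum S into the number of entries minus S, which makes
  half that number a median of S.\<close>

definition reflect :: "real \<Rightarrow> real" where
  "reflect x = (if 0 < x \<and> x < 1 then 1 - x else x)"

lemma measurable_reflect[measurable]: "reflect \<in> borel \<rightarrow>\<^sub>M borel"
  unfolding reflect_def[abs_def] by measurable

lemma distr_unif_reflect: "distr unif unif reflect = unif"
proof (rule measure_eqI)
  fix A :: "real set" assume "A \<in> sets (distr unif unif reflect)"
  then have A[measurable]: "A \<in> sets borel" by simp
  have [measurable]: "reflect -` A \<in> sets borel"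
    using measurable_sets_borel[OF measurable_reflect A] by simp
  have [measurable]: "(\<lambda>x. 1 - x) -` ({0<..<1} \<inter> A) \<in> sets borel"
    by (rule measurable_sets_borel[of _ borel]) auto
  have "emeasure (distr unif unif reflect) A = emeasure unif (reflect -` A)"
    by (subst emeasure_distr) auto
  also have "\<dots> = emeasure lborel ({-1<..<1} \<inter> reflect -` A) / 2"
    by (rule emeasure_unif) auto
  also have "{-1<..<1} \<inter> reflect -` A
      = ({-1<..0} \<inter> A) \<union> (\<lambda>x. 1 - x) -` ({0<..<1} \<inter> A)"
    by (auto simp: reflect_def split: if_splits)
  also have "emeasure lborel \<dots> = emeasure lborel ({-1<..0} \<inter> A)
      + emeasure lborel ((\<lambda>x. 1 - x) -` ({0<..<1} \<inter> A))"
    by (rule plus_emeasure[symmetric]) auto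
  also have "emeasure lborel ((\<lambda>x. 1 - x) -` ({0<..<1} \<inter> A)) = emeasure lborel ({0<..<1} \<inter> A)"
    by (rule emeasure_lborel_reflect) auto
  also have "emeasure lborel ({-1<..0} \<inter> A) + emeasure lborel ({0<..<1} \<inter> A)
      = emeasure lborel (({-1<..0} \<inter> A) \<union> ({0<..<1} \<inter> A))"
    by (rule plus_emeasure) auto
  also have "({-1<..0} \<inter> A) \<union> ({0<..<1} \<inter> A) = {-1<..<1} \<inter> A" by auto
  finally show "emeasure (distr unif unif reflect) A = emeasure unif A"
    by (simp add: emeasure_unif)
qed simp

section \<open>Finite products of the uniform law: independence, tail bounds, conditioning and sign
  flips\<close>

locale uniform_product =
  fixes I :: "'i set"
  assumes fin: "finite I"
begin

definition M :: "('i \<Rightarrow> real) measure" where "M = PiM I (\<lambda>_. unif)"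

sublocale fp: finite_product_prob_space "\<lambda>_. unif" I
  by (intro finite_product_prob_space.intro product_prob_space.intro
      finite_product_sigma_finite.intro product_sigma_finite.intro
      product_prob_space_axioms.intro finite_product_sigma_finite_axioms.intro fin
      prob_space_unif prob_space_imp_sigma_finite)

sublocale prob_space M
  unfolding M_def by (rule fp.prob_space_axioms)

lemma space_M: "space M = PiE I (\<lambda>_. UNIV)"
  by (simp add: M_def space_PiM)

lemma measurable_coord[measurable]: "i \<in> I \<Longrightarrow> (\<lambda>f. f i) \<in> borel_measurable M"
  unfolding M_def using measurable_component_singleton[of i I "\<lambda>_. unif"]
  by (simp add: measurable_def)

lemma measurable_into_M:
  assumes "\<And>i. i \<in> I \<Longrightarrow> (\<lambda>x. g x i) \<in> borel_measurable N"
    and "\<And>x i. x \<in> space N \<Longrightarrow> i \<notin> I \<Longrightarrow> g x i = undefined"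
  shows "g \<in> N \<rightarrow>\<^sub>M M"
  unfolding M_def
  by (rule measurable_PiM_single') (use assms in \<open>auto simp: measurable_def PiE_iff extensional_def\<close>)

lemma distr_coord:
  assumes "i \<in> I" shows "distr M unif (\<lambda>f. f i) = unif"
  unfolding M_def by (rule distr_PiM_component) (use assms prob_space_unif in auto)

lemma prob_coord:
  assumes i: "i \<in> I" and A: "{x. Q x} \<in> sets borel"
  shows "\<P>(f in M. Q (f i)) = measure unif {x. Q x}"
proof -
  have "measure unif {x. Q x} = measure (distr M unif (\<lambda>f. f i)) {x. Q x}"
    by (simp only: distr_coord[OF i])
  also have "\<dots> = measure M ((\<lambda>f. f i) -` {x. Q x} \<inter> space M)"
    by (rule measure_distr) (use A measurable_coord[OF i] in \<open>auto simp: measurable_def\<close>)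
  also have "(\<lambda>f. f i) -` {x. Q x} \<inter> space M = {f\<in>space M. Q (f i)}" by auto
  finally show ?thesis by simp
qed

lemma AE_coord:
  assumes "i \<in> I" "AE x in unif. Q x" shows "AE f in M. Q (f i)"
  unfolding M_def by (rule AE_PiM_component) (use assms prob_space_unif in auto)

lemma AE_abs_less: "AE f in M. \<forall>i\<in>I. \<bar>f i\<bar> < 1"
  by (rule AE_finite_allI[OF fin]) (rule AE_coord[OF _ AE_unif_abs_less])

text \<open>The finitely many predicates \<open>E q\<close> cut the space into finitely many
  measurable atoms, and \<open>Q\<close> is a union of atoms. This spares measurability arguments
  for the intermediate states of the algorithm.\<close>

lemma pred_finite_determined:
  assumes S: "finite S" and E: "\<And>q. q \<in> S \<Longrightarrow> Measurable.pred M (E q)"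
    and det: "\<And>f g. f \<in> space M \<Longrightarrow> g \<in> space M \<Longrightarrow> (\<forall>q\<in>S. E q f = E q g) \<Longrightarrow> Q f = Q g"
  shows "Measurable.pred M Q"
proof -
  let ?ty = "\<lambda>f. {q\<in>S. E q f}"
  let ?T = "?ty ` {f\<in>space M. Q f}"
  have *: "{f\<in>space M. Q f} = (\<Union>T\<in>?T. {f\<in>space M. \<forall>q\<in>S. E q f = (q \<in> T)})"
  proof (intro subset_antisym subsetI)
    fix g assume "g \<in> (\<Union>T\<in>?T. {f\<in>space M. \<forall>q\<in>S. E q f = (q \<in> T)})"
    then obtain f where f: "f \<in> space M" "Q f" "g \<in> space M" "\<forall>q\<in>S. E q g = (q \<in> ?ty f)" by auto
    then have "Q g = Q f" by (intro det) auto
    with f show "g \<in> {f\<in>space M. Q f}" by auto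
  qed auto
  have "finite ?T" by (rule finite_subset[of _ "Pow S"]) (auto simp: S)
  moreover have "{f\<in>space M. \<forall>q\<in>S. E q f = (q \<in> T)} \<in> sets M" for T
  proof -
    have "Measurable.pred M (\<lambda>f. \<forall>q\<in>S. E q f = (q \<in> T))"
      by (rule pred_intros_finite(3)[OF S]) (use E in measurable)
    then show ?thesis by (simp add: pred_def)
  qed
  ultimately have "(\<Union>T\<in>?T. {f\<in>space M. \<forall>q\<in>S. E q f = (q \<in> T)}) \<in> sets M"
    by (rule sets.finite_UN)
  then show ?thesis unfolding pred_def by (subst *)
qed

text \<open>Equality of measures is checked on boxes, where the transformed coordinates contribute
  the same factors because \<open>\<phi>\<close> preserves the one-dimensional law. Restricting to
  \<open>I\<close> keeps the image inside the product space.\<close>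

lemma distr_coordinatewise:
  assumes \<phi>: "\<phi> \<in> borel_measurable borel" "distr unif unif \<phi> = unif"
  shows "distr M M (\<lambda>f. \<lambda>i\<in>I. if i \<in> J then \<phi> (f i) else f i) = M"
  unfolding M_def
proof (rule fp.PiM_eqI[OF fin])
  let ?\<Phi> = "\<lambda>f. \<lambda>i\<in>I. if i \<in> J then \<phi> (f i) else f i"
  let ?P = "PiM I (\<lambda>_. unif)"
  have meas: "?\<Phi> \<in> ?P \<rightarrow>\<^sub>M ?P"
    unfolding M_def[symmetric]
  proof (rule measurable_into_M)
    fix i assume i: "i \<in> I"
    show "(\<lambda>x. (\<lambda>i\<in>I. if i \<in> J then \<phi> (x i) else x i) i) \<in> borel_measurable M"
      using i measurable_coord[OF i] measurable_compose[OF measurable_coord[OF i] \<phi>(1)]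
      by (cases "i \<in> J") simp_all
  qed auto
  fix A :: "'i \<Rightarrow> real set" assume A: "\<And>i. i \<in> I \<Longrightarrow> A i \<in> sets unif"
  have AJ: "i \<in> I \<Longrightarrow> \<phi> -` A i \<in> sets borel" for i
    using measurable_sets_borel[OF \<phi>(1), of "A i"] A[of i] by simp
  have "emeasure (distr ?P ?P ?\<Phi>) (Pi\<^sub>E I A) = emeasure ?P (?\<Phi> -` Pi\<^sub>E I A \<inter> space ?P)"
    by (rule emeasure_distr[OF meas]) (use A fin in auto)
  also have "?\<Phi> -` Pi\<^sub>E I A \<inter> space ?P = Pi\<^sub>E I (\<lambda>i. if i \<in> J then \<phi> -` A i else A i)"
    by (auto simp: space_PiM PiE_iff extensional_def split: if_splits)
  also have "emeasure ?P \<dots> = (\<Prod>i\<in>I. emeasure unif (if i \<in> J then \<phi> -` A i else A i))"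
    by (rule fp.measure_times) (use A AJ in \<open>auto split: if_splits\<close>)
  also have "\<dots> = (\<Prod>i\<in>I. emeasure unif (A i))"
  proof (rule prod.cong[OF refl])
    fix i assume i: "i \<in> I"
    have "emeasure unif (A i) = emeasure (distr unif unif \<phi>) (A i)" by (simp only: \<phi>(2))
    also have "\<dots> = emeasure unif (\<phi> -` A i \<inter> space unif)"
      by (rule emeasure_distr) (use \<phi>(1) A[OF i] in \<open>auto simp: measurable_def\<close>)
    finally show "emeasure unif (if i \<in> J then \<phi> -` A i else A i) = emeasure unif (A i)" by auto
  qed
  finally show "emeasure (distr ?P ?P ?\<Phi>) (Pi\<^sub>E I A) = (\<Prod>i\<in>I. emeasure unif (A i))" .
qed simp

lemma prob_coordinatewise:
  assumes \<phi>: "\<phi> \<in> borel_measurable borel" "distr unif unif \<phi> = unif" and Q: "Measurable.pred M Q"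
  shows "\<P>(f in M. Q (\<lambda>i\<in>I. if i \<in> J then \<phi> (f i) else f i)) = \<P>(f in M. Q f)"
proof -
  let ?\<Phi> = "\<lambda>f. \<lambda>i\<in>I. if i \<in> J then \<phi> (f i) else f i"
  have meas: "?\<Phi> \<in> M \<rightarrow>\<^sub>M M"
  proof (rule measurable_into_M)
    fix i assume i: "i \<in> I"
    show "(\<lambda>x. (\<lambda>i\<in>I. if i \<in> J then \<phi> (x i) else x i) i) \<in> borel_measurable M"
      using i measurable_coord[OF i] measurable_compose[OF measurable_coord[OF i] \<phi>(1)]
      by (cases "i \<in> J") simp_all
  qed auto
  have "\<P>(f in M. Q f) = measure (distr M M ?\<Phi>) {f\<in>space M. Q f}"
    by (simp only: distr_coordinatewise[OF \<phi>])
  also have "\<dots> = measure M (?\<Phi> -` {f\<in>space M. Q f} \<inter> space M)"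
    by (rule measure_distr[OF meas]) (use Q in \<open>simp add: pred_def\<close>)
  also have "?\<Phi> -` {f\<in>space M. Q f} \<inter> space M = {f\<in>space M. Q (?\<Phi> f)}"
    using measurable_space[OF meas] by auto
  finally show ?thesis by simp
qed

text \<open>\<open>J\<close> may reach outside \<open>I\<close>, since all points of the space agree
  there. Index sets can thus be described by the agents involved, without intersecting them with the
  set of genuine pairs.\<close>

definition dep :: "'i set \<Rightarrow> (('i \<Rightarrow> real) \<Rightarrow> bool) \<Rightarrow> bool" where
  "dep J Q \<longleftrightarrow> (\<forall>f\<in>space M. \<forall>g\<in>space M. (\<forall>j\<in>J. f j = g j) \<longrightarrow> Q f = Q g)"

text \<open>Points of the space are undefined outside \<open>I\<close>, so agreement at those
  indices comes for free. In the applications this covers the diagonal and all pairs with a number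
  that is not an agent.\<close>

lemma depI:
  assumes "\<And>f g. f \<in> space M \<Longrightarrow> g \<in> space M \<Longrightarrow> (\<And>j. j \<in> J \<or> j \<notin> I \<Longrightarrow> f j = g j) \<Longrightarrow> Q f = Q g"
  shows "dep J Q"
  unfolding dep_def
proof (intro ballI impI)
  fix f g assume fg: "f \<in> space M" "g \<in> space M" "\<forall>j\<in>J. f j = g j"
  show "Q f = Q g"
    by (rule assms) (use fg in \<open>auto simp: space_M PiE_iff extensional_def\<close>)
qed

lemma dep_not: "dep J Q \<Longrightarrow> dep J (\<lambda>f. \<not> Q f)"
  unfolding dep_def by blast

lemma dep_conj:
  assumes "dep J Q" "dep K R" shows "dep (J \<union> K) (\<lambda>f. Q f \<and> R f)"
proof (rule depI)
  fix f g assume fg: "f \<in> space M" "g \<in> space M" "\<And>j. j \<in> J \<union> K \<or> j \<notin> I \<Longrightarrow> f j = g j"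
  have "Q f = Q g" by (rule assms(1)[unfolded dep_def, rule_format]) (use fg in auto)
  moreover have "R f = R g" by (rule assms(2)[unfolded dep_def, rule_format]) (use fg in auto)
  ultimately show "(Q f \<and> R f) = (Q g \<and> R g)" by simp
qed

lemma indep_coords: "indep_vars (\<lambda>_. unif) (\<lambda>i f. f i) I"
proof (cases "I = {}")
  case True
  then show ?thesis unfolding indep_vars_def2 indep_sets_def by blast
next
  case False
  have m: "(\<lambda>f. f i) \<in> M \<rightarrow>\<^sub>M unif" if "i \<in> I" for i
    using measurable_coord[OF that] by (simp add: measurable_def)
  have "distr M (PiM I (\<lambda>_. unif)) (\<lambda>x. restrict x I) = distr M M (\<lambda>x. x)"
    by (rule distr_cong) (auto simp: M_def space_PiM PiE_def extensional_restrict)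
  also have "\<dots> = M" by (rule distr_id)
  also have "M = PiM I (\<lambda>i. distr M unif (\<lambda>f. f i))"
    by (subst M_def, rule PiM_cong) (auto simp: distr_coord)
  finally show ?thesis
    by (subst indep_vars_iff_distr_eq_PiM'[OF False m])
qed

text \<open>A predicate depending only on \<open>L\<close> factors through restriction to
  \<open>L\<close>: filling the missing coordinates with 0 does not change its value. Both events
  become preimages under restrictions to complementary blocks of coordinates, so their independence
  is that of the coordinates. The second block is all of \<open>I - J\<close>, which contains every
  relevant index of \<open>K\<close>.\<close>

lemma prob_indep:
  assumes Q: "Measurable.pred M Q" "dep J Q" and R: "Measurable.pred M R" "dep K R" and JK: "J \<inter> K = {}"
  shows "\<P>(f in M. Q f \<and> R f) = \<P>(f in M. Q f) * \<P>(f in M. R f)"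
proof -
  let ?J = "I \<inter> J" and ?K = "I - J"
  let ?ext = "\<lambda>L g. \<lambda>i\<in>I. if i \<in> L then g i else (0::real)"
  have ext: "?ext L \<in> PiM L (\<lambda>_. unif) \<rightarrow>\<^sub>M M" if "L \<subseteq> I" for L
  proof (rule measurable_into_M)
    fix i assume i: "i \<in> I"
    have "i \<in> L \<Longrightarrow> (\<lambda>f. f i) \<in> borel_measurable (PiM L (\<lambda>_. unif))"
      using measurable_component_singleton[of i L "\<lambda>_. unif"] by (simp add: measurable_def)
    then show "(\<lambda>x. ?ext L x i) \<in> borel_measurable (PiM L (\<lambda>_. unif))"
      using i by (cases "i \<in> L") simp_all
  qed auto
  let ?A = "\<lambda>L Q. {g \<in> space (PiM L (\<lambda>_. unif)). Q (?ext L g)}"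
  have A: "?A L Q \<in> sets (PiM L (\<lambda>_. unif))" if "L \<subseteq> I" "Measurable.pred M Q" for L Q
    using measurable_sets[OF ext[OF that(1)], of "{f\<in>space M. Q f}"] that(2)
      measurable_space[OF ext[OF that(1)]]
    by (auto simp: pred_def vimage_def Int_def conj_commute cong: rev_conj_cong)
  have eq: "(\<lambda>f. restrict (\<lambda>i. f i) L) -` ?A L Q \<inter> space M = {f\<in>space M. Q f}"
    if "L \<subseteq> I" "dep L Q" for L Q
  proof -
    have "Q (?ext L (restrict f L)) = Q f" if f: "f \<in> space M" for f
    proof -
      have r: "restrict f L \<in> space (PiM L (\<lambda>_. unif))" by (simp add: space_PiM)
      show ?thesis
        by (rule \<open>dep L Q\<close>[unfolded dep_def, rule_format])
           (use f measurable_space[OF ext[OF \<open>L \<subseteq> I\<close>] r] \<open>L \<subseteq> I\<close> in auto)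
    qed
    then show ?thesis by (auto simp: space_PiM)
  qed
  have "indep_var (PiM ?J (\<lambda>_. unif)) (\<lambda>f. restrict (\<lambda>i. f i) ?J) (PiM ?K (\<lambda>_. unif)) (\<lambda>f. restrict (\<lambda>i. f i) ?K)"
    by (rule indep_var_restrict[OF indep_coords]) auto
  from indep_varD[OF this A[of ?J Q] A[of ?K R]] Q(1) R(1)
  have "prob ((\<lambda>x. (restrict x ?J, restrict x ?K)) -` (?A ?J Q \<times> ?A ?K R) \<inter> space M)
    = prob ((\<lambda>f. restrict (\<lambda>i. f i) ?J) -` ?A ?J Q \<inter> space M) * prob ((\<lambda>f. restrict (\<lambda>i. f i) ?K) -` ?A ?K R \<inter> space M)"
    by auto
  also have "(\<lambda>x. (restrict x ?J, restrict x ?K)) -` (?A ?J Q \<times> ?A ?K R) \<inter> space M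
     = ((\<lambda>f. restrict (\<lambda>i. f i) ?J) -` ?A ?J Q \<inter> space M) \<inter> ((\<lambda>f. restrict (\<lambda>i. f i) ?K) -` ?A ?K R \<inter> space M)"
    by auto
  also have "(\<lambda>f. restrict (\<lambda>i. f i) ?J) -` ?A ?J Q \<inter> space M = {f\<in>space M. Q f}"
  proof (rule eq)
    show "dep ?J Q"
      by (rule depI, rule Q(2)[unfolded dep_def, rule_format]) auto
  qed auto
  also have "(\<lambda>f. restrict (\<lambda>i. f i) ?K) -` ?A ?K R \<inter> space M = {f\<in>space M. R f}"
  proof (rule eq)
    show "dep ?K R"
      by (rule depI, rule R(2)[unfolded dep_def, rule_format]) (use JK in auto)
  qed auto
  also have "{f\<in>space M. Q f} \<inter> {f\<in>space M. R f} = {f\<in>space M. Q f \<and> R f}" by auto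
  finally show ?thesis .
qed

lemma dep_Ball:
  assumes "\<And>t. t \<in> T \<Longrightarrow> dep (K t) (E t)"
  shows "dep (\<Union>t\<in>T. K t) (\<lambda>f. \<forall>t\<in>T. E t f)"
  unfolding dep_def
proof (intro ballI impI)
  fix f g assume fg: "f \<in> space M" "g \<in> space M" "\<forall>j\<in>\<Union> (K ` T). f j = g j"
  have "E t f = E t g" if "t \<in> T" for t
    using assms[OF that] fg that unfolding dep_def by blast
  then show "(\<forall>t\<in>T. E t f) = (\<forall>t\<in>T. E t g)" by auto
qed

lemma prob_Ball:
  assumes "finite T" and E: "\<And>t. t \<in> T \<Longrightarrow> Measurable.pred M (E t)" "\<And>t. t \<in> T \<Longrightarrow> dep (K t) (E t)"
    and K: "disjoint_family_on K T"
  shows "\<P>(f in M. \<forall>t\<in>T. E t f) = (\<Prod>t\<in>T. \<P>(f in M. E t f))"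
  using assms
proof (induction T rule: finite_induct)
  case empty
  then show ?case by (simp add: prob_space)
next
  case (insert t T)
  have IH: "\<P>(f in M. \<forall>t\<in>T. E t f) = (\<Prod>t\<in>T. \<P>(f in M. E t f))"
    by (rule insert.IH) (use insert.prems in \<open>auto simp: disjoint_family_on_def\<close>)
  have "\<P>(f in M. \<forall>t\<in>insert t T. E t f) = \<P>(f in M. E t f \<and> (\<forall>t\<in>T. E t f))" by simp
  also have "\<dots> = \<P>(f in M. E t f) * \<P>(f in M. \<forall>t\<in>T. E t f)"
  proof (rule prob_indep)
    show "Measurable.pred M (E t)" "dep (K t) (E t)" using insert.prems by auto
    show "Measurable.pred M (\<lambda>f. \<forall>t\<in>T. E t f)"
      by (rule pred_intros_finite(3)) (use insert in auto)
    show "dep (\<Union>t\<in>T. K t) (\<lambda>f. \<forall>t\<in>T. E t f)" by (rule dep_Ball) (use insert in auto)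
    show "K t \<inter> (\<Union>t\<in>T. K t) = {}"
      using insert.prems(3) insert.hyps unfolding disjoint_family_on_def by fastforce
  qed
  finally show ?case using insert.hyps IH by simp
qed

lemma dep_coord: "dep {i} (\<lambda>f. Q (f i))"
  unfolding dep_def by auto

lemma prob_all_coords:
  assumes "J \<subseteq> I" and A: "{x. Q x} \<in> sets borel"
  shows "\<P>(f in M. \<forall>j\<in>J. Q (f j)) = measure unif {x. Q x} ^ card J"
proof -
  have J: "finite J" using assms fin finite_subset by blast
  have "\<P>(f in M. \<forall>j\<in>J. Q (f j)) = (\<Prod>j\<in>J. \<P>(f in M. Q (f j)))"
  proof (rule prob_Ball[OF J])
    fix j assume "j \<in> J"
    with assms have "j \<in> I" by auto
    then have "(\<lambda>f. f j) -` {x. Q x} \<inter> space M \<in> sets M"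
      using A measurable_coord measurable_sets by blast
    then show "Measurable.pred M (\<lambda>f. Q (f j))"
      by (simp add: pred_def vimage_def Int_def conj_commute)
    show "dep {j} (\<lambda>f. Q (f j))" by (rule dep_coord)
  qed (auto simp: disjoint_family_on_def)
  also have "\<dots> = (\<Prod>j\<in>J. measure unif {x. Q x})"
    by (rule prod.cong) (use assms prob_coord in auto)
  finally show ?thesis by simp
qed

lemma pred_card_less:
  assumes "finite T" "\<And>t. t \<in> T \<Longrightarrow> Measurable.pred M (E t)"
  shows "Measurable.pred M (\<lambda>f. card {t\<in>T. E t f} < r)"
proof (rule pred_finite_determined[OF assms(1), of E])
  fix f g assume "\<forall>q\<in>T. E q f = E q g"
  then have "{t\<in>T. E t f} = {t\<in>T. E t g}" by auto
  then show "(card {t\<in>T. E t f} < r) = (card {t\<in>T. E t g} < r)" by simp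
qed (use assms in auto)

lemma dep_card_less:
  assumes "\<And>t. t \<in> T \<Longrightarrow> dep (K t) (E t)"
  shows "dep (\<Union>t\<in>T. K t) (\<lambda>f. card {t\<in>T. E t f} < r)"
  unfolding dep_def
proof (intro ballI impI)
  fix f g assume fg: "f \<in> space M" "g \<in> space M" "\<forall>j\<in>\<Union> (K ` T). f j = g j"
  have "E t f = E t g" if "t \<in> T" for t
    using assms[OF that] fg that unfolding dep_def by blast
  then have "{t\<in>T. E t f} = {t\<in>T. E t g}" by auto
  then show "(card {t\<in>T. E t f} < r) = (card {t\<in>T. E t g} < r)" by simp
qed

text \<open>A lower-tail Chernoff bound with base 2: the right-hand side is
  \<open>2 ^ r\<close> times the expectation of \<open>2\<close> to the minus number of successes.\<close>

lemma prob_few_successes: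
  assumes "finite T" and E: "\<And>t. t \<in> T \<Longrightarrow> Measurable.pred M (E t)" "\<And>t. t \<in> T \<Longrightarrow> dep (K t) (E t)"
    and K: "disjoint_family_on K T"
    and p: "\<And>t. t \<in> T \<Longrightarrow> p \<le> \<P>(f in M. E t f)" "p \<le> 1"
  shows "\<P>(f in M. card {t\<in>T. E t f} < r) \<le> 2 ^ r * (1 - p / 2) ^ card T"
  using assms(1-4) p(1)
proof (induction T arbitrary: r rule: finite_induct)
  case empty
  have "(1::real) \<le> 2 ^ r" by simp
  then show ?case using order_trans[OF prob_le_1] by simp
next
  case (insert t T)
  let ?c = "\<lambda>T f. card {t\<in>T. E t f}"
  have dj: "disjoint_family_on K T" using insert.prems by (auto simp: disjoint_family_on_def)
  have IH: "\<P>(f in M. ?c T f < r) \<le> 2 ^ r * (1 - p / 2) ^ card T" for r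
    by (rule insert.IH) (use insert.prems dj in auto)
  have cs: "?c (insert t T) f = (if E t f then Suc (?c T f) else ?c T f)" for f
  proof -
    have "{s\<in>insert t T. E s f} = (if E t f then insert t {s\<in>T. E s f} else {s\<in>T. E s f})" by auto
    then show ?thesis using insert.hyps by auto
  qed
  show ?case
  proof (cases r)
    case 0
    have "0 \<le> (1 - p / 2) ^ card (insert t T)" by (rule zero_le_power) (use p(2) in auto)
    then show ?thesis using 0 by simp
  next
    case (Suc r')
    let ?e = "\<P>(f in M. E t f)"
    note mt[measurable] = insert.prems(1)[of t, simplified]
    have mc[measurable]: "Measurable.pred M (\<lambda>f. ?c T f < r)" for r
      by (rule pred_card_less) (use insert in auto)
    have dpt: "dep (K t) (E t)" using insert.prems by auto
    have dpc: "dep (\<Union>t\<in>T. K t) (\<lambda>f. ?c T f < r)" for r by (rule dep_card_less) (use insert in auto)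
    have dis: "K t \<inter> (\<Union>t\<in>T. K t) = {}"
      using insert.prems(3) insert.hyps unfolding disjoint_family_on_def by fastforce
    have "{f\<in>space M. ?c (insert t T) f < r} =
       {f\<in>space M. E t f \<and> ?c T f < r'} \<union> {f\<in>space M. \<not> E t f \<and> ?c T f < r}"
      unfolding cs by (auto simp: Suc)
    then have "\<P>(f in M. ?c (insert t T) f < r) =
        \<P>(f in M. E t f \<and> ?c T f < r') + \<P>(f in M. \<not> E t f \<and> ?c T f < r)"
      by (simp only:, subst finite_measure_Union) (measurable, auto)
    also have "\<P>(f in M. E t f \<and> ?c T f < r') = ?e * \<P>(f in M. ?c T f < r')"
      by (rule prob_indep[OF _ dpt _ dpc dis]) measurable
    also have "\<P>(f in M. \<not> E t f \<and> ?c T f < r) = \<P>(f in M. \<not> E t f) * \<P>(f in M. ?c T f < r)"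
      by (rule prob_indep[OF _ dep_not[OF dpt] _ dpc dis]) measurable
    also have "\<P>(f in M. \<not> E t f) = 1 - ?e" by (rule prob_neg) measurable
    also have "?e * \<P>(f in M. ?c T f < r') + (1 - ?e) * \<P>(f in M. ?c T f < r)
       \<le> ?e * (2 ^ r' * (1 - p / 2) ^ card T) + (1 - ?e) * (2 ^ r * (1 - p / 2) ^ card T)"
      by (intro add_mono mult_left_mono IH) auto
    \<comment> \<open>A success at \<open>t\<close> lowers the threshold by one and thereby halves
      the factor \<open>2 ^ r\<close>, hence the new factor e / 2 + (1 - e).\<close>
    also have "\<dots> = 2 ^ r * (1 - p / 2) ^ card T * (1 - ?e / 2)"
      by (simp add: Suc algebra_simps)
    also have "\<dots> \<le> 2 ^ r * (1 - p / 2) ^ card T * (1 - p / 2)"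
      by (intro mult_left_mono mult_nonneg_nonneg zero_le_power) (use p(2) insert.prems in auto)
    finally show ?thesis using insert.hyps by (simp add: mult_ac)
  qed
qed

text \<open>The law of total probability over a random value \<open>c\<close>. The events
  \<open>G c\<close> need not exhaust the space: they are disjoint, so their probabilities add up to
  at most 1, and a conditional bound \<open>e\<close> survives the summation without a factor for
  the number of values. \<open>G c\<close> may also be larger than the event that the real run
  produces \<open>c\<close>, which leaves room for ghost utilities.\<close>

lemma prob_by_value:
  assumes "finite V" "0 \<le> e"
    and G: "\<And>c. c \<in> V \<Longrightarrow> Measurable.pred M (G c)" "\<And>c. c \<in> V \<Longrightarrow> Measurable.pred M (\<lambda>f. G c f \<and> B c f)"
    and uniq: "\<And>c c' f. f \<in> space M \<Longrightarrow> G c f \<Longrightarrow> G c' f \<Longrightarrow> c = c'"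
    and bound: "\<And>c. c \<in> V \<Longrightarrow> \<P>(f in M. G c f \<and> B c f) \<le> e * \<P>(f in M. G c f)"
    and Q: "\<And>f. f \<in> space M \<Longrightarrow> Q f \<Longrightarrow> \<exists>c\<in>V. G c f \<and> B c f"
  shows "\<P>(f in M. Q f) \<le> e"
proof -
  have "\<P>(f in M. Q f) \<le> prob (\<Union>c\<in>V. {f\<in>space M. G c f \<and> B c f})"
    by (rule finite_measure_mono) (use Q G(2) assms(1) in \<open>auto simp: pred_def\<close>)
  also have "\<dots> \<le> (\<Sum>c\<in>V. \<P>(f in M. G c f \<and> B c f))"
    by (rule measure_UNION_le) (use assms(1) G(2) in \<open>auto simp: pred_def\<close>)
  also have "\<dots> \<le> (\<Sum>c\<in>V. e * \<P>(f in M. G c f))"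
    by (rule sum_mono) (use bound in auto)
  also have "\<dots> = e * (\<Sum>c\<in>V. \<P>(f in M. G c f))" by (simp add: sum_distrib_left)
  also have "(\<Sum>c\<in>V. \<P>(f in M. G c f)) = prob (\<Union>c\<in>V. {f\<in>space M. G c f})"
    by (rule finite_measure_finite_Union[symmetric])
      (use assms(1) G(1) uniq in \<open>auto simp: disjoint_family_on_def pred_def\<close>)
  also have "e * \<dots> \<le> e * 1" by (intro mult_left_mono) (use assms in auto)
  finally show ?thesis by simp
qed

text \<open>The index sets \<open>J c\<close> and \<open>K c\<close> may vary with \<open>c\<close>:
  what an adaptive procedure has read depends on its outcome, but for a fixed outcome the pairs read
  and the fresh pairs are fixed and disjoint.\<close>

lemma prob_by_indep_value:
  assumes "finite V" "0 \<le> e"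
    and G: "\<And>c. c \<in> V \<Longrightarrow> Measurable.pred M (G c)" "\<And>c. c \<in> V \<Longrightarrow> dep (J c) (G c)"
    and B: "\<And>c. c \<in> V \<Longrightarrow> Measurable.pred M (B c)" "\<And>c. c \<in> V \<Longrightarrow> dep (K c) (B c)"
    and JK: "\<And>c. c \<in> V \<Longrightarrow> J c \<inter> K c = {}"
    and uniq: "\<And>c c' f. f \<in> space M \<Longrightarrow> G c f \<Longrightarrow> G c' f \<Longrightarrow> c = c'"
    and bound: "\<And>c. c \<in> V \<Longrightarrow> \<P>(f in M. B c f) \<le> e"
    and Q: "\<And>f. f \<in> space M \<Longrightarrow> Q f \<Longrightarrow> \<exists>c\<in>V. G c f \<and> B c f"
  shows "\<P>(f in M. Q f) \<le> e"
proof (rule prob_by_value[OF assms(1,2) G(1) _ uniq _ Q])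
  fix c assume c: "c \<in> V"
  show "Measurable.pred M (\<lambda>f. G c f \<and> B c f)" using G(1)[OF c] B(1)[OF c] by measurable
  have "\<P>(f in M. G c f \<and> B c f) = \<P>(f in M. G c f) * \<P>(f in M. B c f)"
    by (rule prob_indep[OF G(1)[OF c] G(2)[OF c] B(1)[OF c] B(2)[OF c] JK[OF c]])
  also have "\<dots> \<le> \<P>(f in M. G c f) * e" by (rule mult_left_mono[OF bound[OF c]]) simp
  finally show "\<P>(f in M. G c f \<and> B c f) \<le> e * \<P>(f in M. G c f)" by (simp add: mult.commute)
qed

lemma prob_union_bound:
  fixes e :: real
  assumes "finite V" "\<And>c. c \<in> V \<Longrightarrow> \<P>(f in M. B c f) \<le> e" "\<And>c. c \<in> V \<Longrightarrow> Measurable.pred M (B c)"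
    and Q: "\<And>f. f \<in> space M \<Longrightarrow> Q f \<Longrightarrow> \<exists>c\<in>V. B c f"
  shows "\<P>(f in M. Q f) \<le> card V * e"
proof -
  have "\<P>(f in M. Q f) \<le> prob (\<Union>c\<in>V. {f\<in>space M. B c f})"
    by (rule finite_measure_mono) (use Q assms in \<open>auto simp: pred_def\<close>)
  also have "\<dots> \<le> (\<Sum>c\<in>V. \<P>(f in M. B c f))"
    by (rule measure_UNION_le) (use assms in \<open>auto simp: pred_def\<close>)
  also have "\<dots> \<le> (\<Sum>c\<in>V. e)" by (rule sum_mono) (use assms in auto)
  finally show ?thesis by simp
qed

text \<open>Flipping the sign of one coordinate at a time injects the event into its complement
  inside \<open>Y\<close>; this replaces a correlation inequality.\<close>

lemma prob_flip_closed:
  assumes Y: "Measurable.pred M Y" and "J \<subseteq> I"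
    and flip: "\<And>f j. f \<in> space M \<Longrightarrow> Y f \<Longrightarrow> j \<in> J \<Longrightarrow> 0 \<le> f j \<Longrightarrow> Y (f(j := - f j))"
  shows "\<P>(f in M. Y f \<and> (\<forall>j\<in>J. 0 \<le> f j)) \<le> (1/2) ^ card J * \<P>(f in M. Y f)"
proof -
  have "finite J" using assms fin finite_subset by blast
  then show ?thesis using assms(2) flip
  proof (induction J rule: finite_induct)
    case empty
    then show ?case by simp
  next
    case (insert j J)
    note [measurable] = Y
    have j[measurable]: "j \<in> I" using insert by auto
    let ?R = "\<lambda>f. Y f \<and> (\<forall>j\<in>J. 0 \<le> f j)"
    have mJ[measurable]: "Measurable.pred M (\<lambda>f. \<forall>j\<in>J. 0 \<le> f j)"
    proof (rule pred_intros_finite(3))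
      fix i assume "i \<in> J" then have [measurable]: "i \<in> I" using insert by auto
      show "Measurable.pred M (\<lambda>f. 0 \<le> f i)" by measurable
    qed (use insert in auto)
    have IH: "\<P>(f in M. ?R f) \<le> (1/2) ^ card J * \<P>(f in M. Y f)"
      by (rule insert.IH) (use insert.prems in auto)
    \<comment> \<open>The value 0 has probability zero. With the strict inequality, the event and
      its image under the sign flip are disjoint.\<close>
    have z: "\<P>(f in M. ?R f \<and> 0 \<le> f j) = \<P>(f in M. ?R f \<and> 0 < f j)"
    proof (rule finite_measure_eq_AE)
      show "AE x in M. (x \<in> {f \<in> space M. ?R f \<and> 0 \<le> f j}) = (x \<in> {f \<in> space M. ?R f \<and> 0 < f j})"
        using AE_coord[OF j AE_unif_nonzero] by eventually_elim auto
    qed measurable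
    have "\<P>(f in M. ?R f \<and> 0 < f j) \<le> \<P>(f in M. ?R f \<and> f j < 0)"
    proof -
      let ?\<Phi> = "\<lambda>f. \<lambda>i\<in>I. if i \<in> {j} then - f i else (f i :: real)"
      have "\<P>(f in M. ?R f \<and> f j < 0) = \<P>(f in M. ?R (?\<Phi> f) \<and> ?\<Phi> f j < 0)"
        by (rule prob_coordinatewise[symmetric, where \<phi>=uminus and J="{j}" and Q="\<lambda>f. ?R f \<and> f j < 0"])
           (auto simp: distr_unif_uminus)
      also have "\<dots> \<ge> \<P>(f in M. ?R f \<and> 0 < f j)"
      proof (rule finite_measure_mono)
        show "{f \<in> space M. ?R f \<and> 0 < f j} \<subseteq> {f \<in> space M. ?R (?\<Phi> f) \<and> ?\<Phi> f j < 0}"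
        proof safe
          fix f assume f: "f \<in> space M" "Y f" "\<forall>j\<in>J. 0 \<le> f j" "0 < f j"
          have "?\<Phi> f = f(j := - f j)" using f(1) j by (auto simp: space_M PiE_iff extensional_def)
          moreover have "Y (f(j := - f j))" by (rule insert.prems(2)) (use f in auto)
          ultimately show "Y (?\<Phi> f)" by simp
          fix i assume "i \<in> J" then show "0 \<le> ?\<Phi> f i" using f insert by auto
        next
          fix f :: "'i \<Rightarrow> real" assume "0 < f j" then show "?\<Phi> f j < 0" using j by simp
        qed
        have [measurable]: "?\<Phi> \<in> M \<rightarrow>\<^sub>M M"
        proof (rule measurable_into_M)
          fix i assume [measurable]: "i \<in> I"
          show "(\<lambda>x. ?\<Phi> x i) \<in> borel_measurable M"
            by (cases "i = j") (auto)
        qed auto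
        have "Measurable.pred M (\<lambda>f. ?R f \<and> f j < 0)" by measurable
        from measurable_compose[OF \<open>?\<Phi> \<in> M \<rightarrow>\<^sub>M M\<close> this]
        show "{f \<in> space M. ?R (?\<Phi> f) \<and> ?\<Phi> f j < 0} \<in> sets M" by (simp add: pred_def)
      qed
      finally show ?thesis .
    qed
    moreover have "\<P>(f in M. ?R f \<and> 0 < f j) + \<P>(f in M. ?R f \<and> f j < 0) \<le> \<P>(f in M. ?R f)"
      by (subst finite_measure_Union[symmetric]) (auto intro!: finite_measure_mono)
    ultimately have "\<P>(f in M. ?R f \<and> 0 \<le> f j) \<le> (1/2) * \<P>(f in M. ?R f)" using z by simp
    also have "\<dots> \<le> (1/2) * ((1/2) ^ card J * \<P>(f in M. Y f))" using IH by simp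
    finally show ?case using insert.hyps by (simp add: conj_ac cong: conj_cong)
  qed
qed

lemma pred_sum_ge[measurable]:
  assumes "K \<subseteq> I" shows "Measurable.pred M (\<lambda>f. c \<le> (\<Sum>j\<in>K. f j))"
proof -
  have [measurable]: "(\<lambda>f. \<Sum>j\<in>K. f j) \<in> borel_measurable M"
    by (rule borel_measurable_sum) (use assms in auto)
  show ?thesis by measurable
qed

lemma pred_sum_le[measurable]:
  assumes "K \<subseteq> I" shows "Measurable.pred M (\<lambda>f. (\<Sum>j\<in>K. f j) \<le> c)"
proof -
  have [measurable]: "(\<lambda>f. \<Sum>j\<in>K. f j) \<in> borel_measurable M"
    by (rule borel_measurable_sum) (use assms in auto)
  show ?thesis by measurable
qed

lemma dep_sum: "dep K (\<lambda>f. Q (\<Sum>j\<in>K. f j))"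
  unfolding dep_def by (metis (no_types, lifting) sum.cong)

text \<open>Changing all signs in \<open>K\<close> preserves the measure, so the sum is nonnegative
  and nonpositive with equal probability, and the two events cover the space.\<close>

lemma prob_sum_nonneg:
  assumes "K \<subseteq> I" shows "1/2 \<le> \<P>(f in M. 0 \<le> (\<Sum>j\<in>K. f j))"
proof -
  note [measurable] = pred_sum_ge[OF assms] pred_sum_le[OF assms]
  have "\<P>(f in M. 0 \<le> (\<Sum>j\<in>K. f j)) = \<P>(f in M. 0 \<le> (\<Sum>j\<in>K. (\<lambda>i\<in>I. if i \<in> K then - f i else f i) j))"
    by (rule prob_coordinatewise[symmetric]) (auto simp: distr_unif_uminus)
  also have "(\<lambda>f. \<Sum>j\<in>K. (\<lambda>i\<in>I. if i \<in> K then - f i else (f i::real)) j) = (\<lambda>f. - (\<Sum>j\<in>K. f j))"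
    using assms by (auto simp: sum_negf[symmetric] intro!: sum.cong ext)
  then have "\<P>(f in M. 0 \<le> (\<Sum>j\<in>K. (\<lambda>i\<in>I. if i \<in> K then - f i else f i) j)) = \<P>(f in M. (\<Sum>j\<in>K. f j) \<le> 0)"
    by (simp add: fun_eq_iff)
  finally have "\<P>(f in M. 0 \<le> (\<Sum>j\<in>K. f j)) = \<P>(f in M. (\<Sum>j\<in>K. f j) \<le> 0)" .
  moreover have "1 \<le> \<P>(f in M. 0 \<le> (\<Sum>j\<in>K. f j)) + \<P>(f in M. (\<Sum>j\<in>K. f j) \<le> 0)"
  proof -
    have "1 = prob (space M)" by (simp add: prob_space)
    also have "\<dots> \<le> prob ({f\<in>space M. 0 \<le> (\<Sum>j\<in>K. f j)} \<union> {f\<in>space M. (\<Sum>j\<in>K. f j) \<le> 0})"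
      by (rule finite_measure_mono) auto
    also have "\<dots> \<le> \<P>(f in M. 0 \<le> (\<Sum>j\<in>K. f j)) + \<P>(f in M. (\<Sum>j\<in>K. f j) \<le> 0)"
      by (rule measure_Un_le) auto
    finally show ?thesis .
  qed
  ultimately show ?thesis by simp
qed

text \<open>All entries of the block are positive with probability \<open>(1/2) ^ card J\<close>;
  within that event \<open>reflect\<close> exchanges sums above and below half the block size, so
  one half of it remains. This crude bound is exponentially small in the block size, but the blocks
  used are logarithmic in n, which leaves a polynomial probability.\<close>

lemma prob_sum_ge_half_card:
  assumes "J \<subseteq> I"
  shows "(1/2) ^ card J / 2 \<le> \<P>(f in M. card J / 2 \<le> (\<Sum>j\<in>J. f j))"
proof -
  have J: "finite J" using assms fin finite_subset by blast
  note [measurable] = pred_sum_ge[OF assms] pred_sum_le[OF assms]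
  let ?B = "\<lambda>f::'i\<Rightarrow>real. \<forall>j\<in>J. 0 < f j \<and> f j < 1"
  have mB[measurable]: "Measurable.pred M ?B"
  proof (rule pred_intros_finite(3)[OF J])
    fix i assume "i \<in> J" then have [measurable]: "i \<in> I" using assms by auto
    show "Measurable.pred M (\<lambda>f. 0 < f i \<and> f i < 1)" by measurable
  qed
  have s1[measurable]: "Measurable.pred M (\<lambda>f. ?B f \<and> card J / 2 \<le> (\<Sum>j\<in>J. f j))"
    using sets.sets_Collect_conj[OF pred_sum_ge[OF assms, of "card J / 2", unfolded pred_def] mB[unfolded pred_def]]
    unfolding pred_def .
  have s2[measurable]: "Measurable.pred M (\<lambda>f. ?B f \<and> (\<Sum>j\<in>J. f j) \<le> card J / 2)"
    using sets.sets_Collect_conj[OF pred_sum_le[OF assms, of "card J / 2", unfolded pred_def] mB[unfolded pred_def]]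
    unfolding pred_def .
  note s = s1 s2
  let ?\<Phi> = "\<lambda>f. \<lambda>i\<in>I. if i \<in> J then reflect (f i) else f i"
  have "(1/2) ^ card J = \<P>(f in M. ?B f)"
  proof -
    have "{-1<..<1} \<inter> {x. 0 < x \<and> x < 1} = {0<..<(1::real)}" by auto
    then show ?thesis
      by (subst prob_all_coords[OF assms, where Q="\<lambda>x. 0 < x \<and> x < 1"])
         (auto simp: measure_unif)
  qed
  also have "\<dots> \<le> prob ({f\<in>space M. ?B f \<and> card J / 2 \<le> (\<Sum>j\<in>J. f j)} \<union> {f\<in>space M. ?B f \<and> (\<Sum>j\<in>J. f j) \<le> card J / 2})"
    by (rule finite_measure_mono) (force, use s in \<open>simp only: pred_def sets.Un\<close>)
  also have "\<dots> \<le> \<P>(f in M. ?B f \<and> card J / 2 \<le> (\<Sum>j\<in>J. f j)) + \<P>(f in M. ?B f \<and> (\<Sum>j\<in>J. f j) \<le> card J / 2)"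
    by (rule measure_Un_le) (use s in \<open>simp_all only: pred_def\<close>)
  also have "\<P>(f in M. ?B f \<and> (\<Sum>j\<in>J. f j) \<le> card J / 2)
     = \<P>(f in M. ?B (?\<Phi> f) \<and> (\<Sum>j\<in>J. ?\<Phi> f j) \<le> card J / 2)"
    by (rule prob_coordinatewise[OF measurable_reflect distr_unif_reflect s2, symmetric])
  also have "{f\<in>space M. ?B (?\<Phi> f) \<and> (\<Sum>j\<in>J. ?\<Phi> f j) \<le> card J / 2} = {f\<in>space M. ?B f \<and> card J / 2 \<le> (\<Sum>j\<in>J. f j)}"
  proof -
    have b: "?B (?\<Phi> f) = ?B f" for f :: "'i \<Rightarrow> real"
      using assms by (auto simp: reflect_def subset_iff split: if_splits)
    have "(\<Sum>j\<in>J. ?\<Phi> f j) = card J - (\<Sum>j\<in>J. f j)" if "?B f" for f :: "'i \<Rightarrow> real"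
    proof -
      have "(\<Sum>j\<in>J. ?\<Phi> f j) = (\<Sum>j\<in>J. 1 - f j)"
        by (rule sum.cong) (use that assms in \<open>auto simp: reflect_def subset_iff\<close>)
      then show ?thesis by (simp add: sum_subtractf)
    qed
    then show ?thesis unfolding b by auto
  qed
  finally have "(1/2) ^ card J / 2 \<le> \<P>(f in M. ?B f \<and> card J / 2 \<le> (\<Sum>j\<in>J. f j))" by simp
  also have "\<dots> \<le> \<P>(f in M. card J / 2 \<le> (\<Sum>j\<in>J. f j))"
    by (rule finite_measure_mono) (blast, rule pred_sum_ge[OF assms, unfolded pred_def])
  finally show ?thesis .
qed

text \<open>Hoeffding's inequality for entries in [-1,1], whose squared range is 4. The expectations
  vanish by the sign symmetry of the product measure.\<close>

lemma prob_sum_less: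
  fixes c :: real
  assumes K: "K \<subseteq> I" "K \<noteq> {}" and c: "0 \<le> c"
  shows "\<P>(f in M. (\<Sum>j\<in>K. f j) < - (c * card K)) \<le> exp (- (c\<^sup>2 * card K / 2))"
proof -
  have fK: "finite K" using K fin finite_subset by blast
  have e0: "expectation (\<lambda>f. f j) = 0" if j[measurable]: "j \<in> K" for j
  proof -
    have [measurable]: "j \<in> I" using K j by auto
    let ?\<Phi> = "\<lambda>f. \<lambda>i\<in>I. if i \<in> I then - f i else f i"
    have [measurable]: "?\<Phi> \<in> M \<rightarrow>\<^sub>M M"
      by (rule measurable_into_M) auto
    have "expectation (\<lambda>f. f j) = integral\<^sup>L (distr M M ?\<Phi>) (\<lambda>f. f j)"
      by (subst distr_coordinatewise) (auto simp: distr_unif_uminus)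
    also have "\<dots> = expectation (\<lambda>f. ?\<Phi> f j)" by (rule integral_distr) measurable
    also have "\<dots> = - expectation (\<lambda>f. f j)" using \<open>j \<in> I\<close> by simp
    finally show ?thesis by simp
  qed
  interpret H: Hoeffding_ineq M K "\<lambda>j f. f j" "\<lambda>_. -1" "\<lambda>_. 1" 0
  proof unfold_locales
    show "indep_vars (\<lambda>_. borel) (\<lambda>j f. f j) K"
      using indep_vars_subset[OF indep_coords K(1)]
      by (simp add: indep_vars_def measurable_def)
    show "AE x in M. x i \<in> {-1..1}" if "i \<in> K" for i
      using AE_abs_less by eventually_elim (use that K in force)
    show "0 \<equiv> \<Sum>i\<in>K. expectation (\<lambda>f. f i)" using e0 by (auto intro!: eq_reflection)
  qed (use fK in auto)
  have "\<P>(f in M. (\<Sum>j\<in>K. f j) < - (c * card K)) \<le> \<P>(f in M. (\<Sum>j\<in>K. f j) \<le> 0 - c * card K)"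
    by (rule finite_measure_mono) (use pred_sum_le[OF K(1), of "0 - c * card K"] in \<open>auto simp: pred_def\<close>)
  also have "\<dots> \<le> exp (- 2 * (c * card K)\<^sup>2 / (\<Sum>i\<in>K. (1 - (-1))\<^sup>2))"
    by (rule H.Hoeffding_ineq_le) (use c fK K in \<open>auto simp: card_gt_0_iff\<close>)
  also have "- 2 * (c * card K)\<^sup>2 / (\<Sum>i\<in>K. (1 - (-1))\<^sup>2) = - (c\<^sup>2 * card K / 2)"
    using fK K by (simp add: power2_eq_square field_simps)
  finally show ?thesis .
qed

end

section \<open>Rounds of Stage 2\<close>

text \<open>Otherwise the simplifier unrolls the twenty steps of a round.\<close>

declare upt_rec_numeral [simp del]

lemma scan_SomeI:
  assumes "compatible u s k M C" "\<forall>D\<in>set pre. \<not> compatible u s k M D"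
  shows "fst (scan u s k M (pre @ C # post)) = Some C"
  using assms by (induction pre) (auto simp: Let_def)

lemma scan_SomeD:
  assumes "fst (scan u s k M xs) = Some C"
  shows "\<exists>pre post. xs = pre @ C # post \<and> compatible u s k M C \<and> (\<forall>D\<in>set pre. \<not> compatible u s k M D)"
  using assms
proof (induction xs)
  case (Cons D xs)
  show ?case
  proof (cases "compatible u s k M D")
    case True
    then show ?thesis using Cons.prems by (intro exI[of _ "[]"] exI[of _ xs]) auto
  next
    case False
    with Cons obtain pre post where "xs = pre @ C # post" "compatible u s k M C"
      "\<forall>D\<in>set pre. \<not> compatible u s k M D" by (auto simp: Let_def)
    with False show ?thesis by (intro exI[of _ "D # pre"] exI[of _ post]) auto
  qed
qed simp

lemma scan_None: "fst (scan u s k M xs) = None \<Longrightarrow> D \<in> set xs \<Longrightarrow> \<not> compatible u s k M D"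
  by (induction xs) (auto simp: Let_def split: if_splits)

lemma scan_read:
  assumes "(a, b) \<in> snd (scan u s k M xs)"
  shows "a \<in> M \<and> (\<exists>D\<in>set xs. b \<in> D \<and> (fst (scan u s k M xs) = Some D \<or> \<not> compatible u s k M D))"
  using assms by (induction xs) (auto simp: Let_def split: if_splits)

lemma scan_cong:
  assumes "\<And>C. C \<in> set xs \<Longrightarrow> compatible u s k M C = compatible u' s k M C"
  shows "scan u s k M xs = scan u' s k M xs"
  using assms by (induction xs) auto

definition earlier :: "(nat \<Rightarrow> nat set) \<Rightarrow> nat \<Rightarrow> nat set" where
  "earlier cs k = (\<Union>j\<in>{1..<k}. cs j)"

lemma earlier_1[simp]: "earlier cs (Suc 0) = {}" by (simp add: earlier_def)

lemma earlier_Suc: "1 \<le> k \<Longrightarrow> earlier cs (Suc k) = earlier cs k \<union> cs k"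
  by (auto simp: earlier_def less_Suc_eq)

lemma earlier_cong: "(\<And>j. j < k \<Longrightarrow> cs j = cs' j) \<Longrightarrow> earlier cs k = earlier cs' k"
  by (auto simp: earlier_def)

text \<open>A description of a scan without recursion. It separates the one acceptance, which
  involves only utilities inside the coalition being formed, from the rejections, which survive any
  lowering of utilities.\<close>

definition selected :: "strat \<Rightarrow> utility \<Rightarrow> nat \<Rightarrow> (nat \<Rightarrow> nat set set) \<Rightarrow> nat set set
    \<Rightarrow> (nat \<Rightarrow> nat set) \<Rightarrow> nat \<Rightarrow> bool" where
  "selected \<sigma> u s pis P cs k \<longleftrightarrow> (\<exists>pre post. ord2 \<sigma> k P (pis k) (earlier cs k) = pre @ cs k # post
     \<and> compatible u s k (earlier cs k) (cs k) \<and> (\<forall>D\<in>set pre. \<not> compatible u s k (earlier cs k) D))"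

lemma selected_cong:
  assumes "\<And>j. j \<le> k \<Longrightarrow> cs j = cs' j"
  shows "selected \<sigma> u s pis P cs k = selected \<sigma> u s pis P cs' k"
proof -
  have "earlier cs k = earlier cs' k" "cs k = cs' k" using assms by (auto intro!: earlier_cong)
  then show ?thesis by (simp add: selected_def)
qed

text \<open>Starting at an arbitrary class \<open>k\<close> with an accumulator is the generality
  needed for induction. For a failing round, \<open>cs\<close> is the accumulator at the class
  \<open>j\<close> where the scan finds nothing, so \<open>earlier cs j\<close> is the prefix that
  all remaining cliques of class \<open>j\<close> reject. For a successful round every new read runs
  from a prefix to the chosen clique or to a rejected one.\<close>

lemma pick_round_cases:
  assumes "1 \<le> k" "k \<le> m"
    and r_eq: "r = pick_round \<sigma> u s pis P [k..<m] (earlier acc k) acc chk"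
  shows "case fst r of
      Some cs \<Rightarrow> (\<forall>j. j \<notin> {k..<m} \<longrightarrow> cs j = acc j) \<and> (\<forall>j\<in>{k..<m}. selected \<sigma> u s pis P cs j) \<and>
         (\<forall>a b. (a, b) \<in> snd r \<longrightarrow> (a, b) \<in> chk \<or> (\<exists>j\<in>{k..<m}. a \<in> earlier cs j \<and>
            (\<exists>D\<in>set (ord2 \<sigma> j P (pis j) (earlier cs j)). b \<in> D \<and>
              (D = cs j \<or> \<not> compatible u s j (earlier cs j) D))))
    | None \<Rightarrow> \<exists>cs. \<exists>j\<in>{k..<m}. (\<forall>i<k. cs i = acc i) \<and> (\<forall>i\<in>{k..<j}. selected \<sigma> u s pis P cs i) \<and>
         (\<forall>D\<in>set (ord2 \<sigma> j P (pis j) (earlier cs j)). \<not> compatible u s j (earlier cs j) D)"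
  using assms(1,2) unfolding r_eq
proof (induction "m - k" arbitrary: k acc chk)
  case 0
  then show ?case by auto
next
  case (Suc d)
  then have km: "k < m" by simp
  then have ks: "[k..<m] = k # [Suc k..<m]" by (rule upt_conv_Cons)
  let ?sc = "scan u s k (earlier acc k) (ord2 \<sigma> k P (pis k) (earlier acc k))"
  show ?case
  proof (cases "fst ?sc")
    case None
    have "\<forall>D\<in>set (ord2 \<sigma> k P (pis k) (earlier acc k)). \<not> compatible u s k (earlier acc k) D"
      using scan_None[OF None] by blast
    then have "\<exists>cs. \<exists>j\<in>{k..<m}. (\<forall>i<k. cs i = acc i) \<and> (\<forall>i\<in>{k..<j}. selected \<sigma> u s pis P cs i) \<and>
         (\<forall>D\<in>set (ord2 \<sigma> j P (pis j) (earlier cs j)). \<not> compatible u s j (earlier cs j) D)"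
      using km by (intro exI[of _ acc] bexI[of _ k]) auto
    then show ?thesis using None by (simp add: ks Let_def)
  next
    case (Some C)
    let ?acc = "acc(k := C)" and ?chk = "chk \<union> snd ?sc"
    let ?r = "pick_round \<sigma> u s pis P [Suc k..<m] (earlier ?acc (Suc k)) ?acc ?chk"
    have e: "earlier ?acc k = earlier acc k" by (rule earlier_cong) auto
    then have e': "earlier ?acc (Suc k) = earlier acc k \<union> C" using Suc.prems earlier_Suc[of k ?acc] by simp
    have r: "pick_round \<sigma> u s pis P [k..<m] (earlier acc k) acc chk = ?r"
      by (simp add: ks Let_def Some e')
    have sel: "selected \<sigma> u s pis P ?acc k"
      using scan_SomeD[OF Some] by (simp add: selected_def e)
    have d: "d = m - Suc k" "1 \<le> Suc k" "Suc k \<le> m" using Suc.hyps(2) km by auto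
    note IH = Suc.hyps(1)[OF d, of ?acc ?chk]
    show ?thesis
    proof (cases "fst ?r")
      case None
      with IH obtain cs j where j: "j \<in> {Suc k..<m}" "\<forall>i<Suc k. cs i = ?acc i"
        "\<forall>i\<in>{Suc k..<j}. selected \<sigma> u s pis P cs i"
        "\<forall>D\<in>set (ord2 \<sigma> j P (pis j) (earlier cs j)). \<not> compatible u s j (earlier cs j) D" by auto
      have "selected \<sigma> u s pis P cs k"
        using sel selected_cong[of k cs ?acc] j(2) by (simp add: less_Suc_eq_le)
      then have "\<forall>i\<in>{k..<j}. selected \<sigma> u s pis P cs i" using j(3)
        by (metis Suc_leI atLeastLessThan_iff le_neq_implies_less)
      moreover have "\<forall>i<k. cs i = acc i" using j(2) by simp
      moreover have "j \<in> {k..<m}" using j(1) by simp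
      ultimately show ?thesis
        unfolding r None option.case using j(4) by blast
    next
      case (Some cs)
      with IH have cs: "\<forall>j. j \<notin> {Suc k..<m} \<longrightarrow> cs j = ?acc j"
         "\<forall>j\<in>{Suc k..<m}. selected \<sigma> u s pis P cs j"
         "\<forall>a b. (a, b) \<in> snd ?r \<longrightarrow> (a, b) \<in> ?chk \<or> (\<exists>j\<in>{Suc k..<m}. a \<in> earlier cs j \<and>
            (\<exists>D\<in>set (ord2 \<sigma> j P (pis j) (earlier cs j)). b \<in> D \<and>
              (D = cs j \<or> \<not> compatible u s j (earlier cs j) D)))" by auto
      have le: "cs j = ?acc j" if "j \<le> k" for j using cs(1) that by auto
      have "selected \<sigma> u s pis P cs k"
        using sel selected_cong[of k cs ?acc] le by simp
      then have 2: "\<forall>j\<in>{k..<m}. selected \<sigma> u s pis P cs j" using cs(2)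
        by (metis Suc_leI atLeastLessThan_iff le_neq_implies_less)
      have 1: "\<forall>j. j \<notin> {k..<m} \<longrightarrow> cs j = acc j"
        using cs(1) by (metis Suc_leD atLeastLessThan_iff fun_upd_other km order_refl)
      have ek: "earlier cs k = earlier acc k" using le by (intro earlier_cong) auto
      have ck: "cs k = C" using le[of k] by simp
      have 3: "(a, b) \<in> chk \<or> (\<exists>j\<in>{k..<m}. a \<in> earlier cs j \<and>
            (\<exists>D\<in>set (ord2 \<sigma> j P (pis j) (earlier cs j)). b \<in> D \<and>
              (D = cs j \<or> \<not> compatible u s j (earlier cs j) D)))" if ab: "(a, b) \<in> snd ?r" for a b
      proof -
        from cs(3) ab consider "(a, b) \<in> chk" | "(a, b) \<in> snd ?sc" | "\<exists>j\<in>{Suc k..<m}. a \<in> earlier cs j \<and>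
            (\<exists>D\<in>set (ord2 \<sigma> j P (pis j) (earlier cs j)). b \<in> D \<and>
              (D = cs j \<or> \<not> compatible u s j (earlier cs j) D))" by blast
        then show ?thesis
        proof cases
          case 2
          from scan_read[OF this] obtain D where "a \<in> earlier acc k"
            "D \<in> set (ord2 \<sigma> k P (pis k) (earlier acc k))" "b \<in> D"
            "D = C \<or> \<not> compatible u s k (earlier acc k) D" using \<open>fst ?sc = Some C\<close> by auto
          then show ?thesis using km unfolding ek[symmetric] ck[symmetric] by auto
        next
          case 3
          then show ?thesis using Suc_leD by (meson atLeastLessThan_iff)
        qed simp
      qed
      show ?thesis unfolding r Some option.case using 1 2 3 by blast
    qed
  qed
qed

lemma pick_round_SomeI:
  assumes "1 \<le> k" "k \<le> m" "\<forall>j. j \<notin> {k..<m} \<longrightarrow> cs j = acc j" "\<forall>j\<in>{k..<m}. selected \<sigma> u s pis P cs j"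
  shows "fst (pick_round \<sigma> u s pis P [k..<m] (earlier acc k) acc chk) = Some cs"
  using assms
proof (induction "m - k" arbitrary: k acc chk)
  case 0
  then have "{k..<m} = {}" "[k..<m] = []" by simp_all
  moreover from this have "cs = acc" using 0(4) by (intro ext) blast
  ultimately show ?case by (simp only: pick_round.simps fst_conv)
next
  case (Suc d)
  then have km: "k < m" by linarith
  then have ks: "[k..<m] = k # [Suc k..<m]" by (rule upt_conv_Cons)
  let ?acc = "acc(k := cs k)"
  have e: "earlier cs k = earlier acc k"
  proof (rule earlier_cong)
    fix j assume "j < k"
    then have "j \<notin> {k..<m}" by simp
    then show "cs j = acc j" using Suc.prems(3) by blast
  qed
  have "earlier ?acc k = earlier acc k" by (rule earlier_cong) simp
  then have e': "earlier ?acc (Suc k) = earlier acc k \<union> cs k"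
    using earlier_Suc[OF Suc.prems(1), of ?acc] by simp
  have "k \<in> {k..<m}" using km by simp
  then have "selected \<sigma> u s pis P cs k" using Suc.prems(4) by blast
  then have sc: "fst (scan u s k (earlier acc k) (ord2 \<sigma> k P (pis k) (earlier acc k))) = Some (cs k)"
    unfolding selected_def e by (metis scan_SomeI)
  have "fst (pick_round \<sigma> u s pis P [Suc k..<m] (earlier ?acc (Suc k)) ?acc chk) = Some cs" for chk
  proof (rule Suc.hyps(1))
    show "d = m - Suc k" "1 \<le> Suc k" "Suc k \<le> m" using Suc.hyps(2) km by linarith+
    show "\<forall>j. j \<notin> {Suc k..<m} \<longrightarrow> cs j = ?acc j"
    proof (intro allI impI)
      fix j assume j: "j \<notin> {Suc k..<m}"
      show "cs j = ?acc j"
      proof (cases "j = k")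
        case False
        then have "j \<notin> {k..<m}" using j by simp
        then have "cs j = acc j" using Suc.prems(3) by blast
        then show ?thesis using False by simp
      qed simp
    qed
    show "\<forall>j\<in>{Suc k..<m}. selected \<sigma> u s pis P cs j"
    proof
      fix j assume "j \<in> {Suc k..<m}"
      then have "j \<in> {k..<m}" by simp
      then show "selected \<sigma> u s pis P cs j" using Suc.prems(4) by blast
    qed
  qed
  then show ?case by (simp only: ks pick_round.simps Let_def sc option.case e')
qed

text \<open>A coarse bound on the reads, meant for the failing round: its partial choices are
  discarded, and it is enough to know that all reads take place among agents that are still
  unmerged.\<close>

lemma pick_round_reads:
  assumes "(a, b) \<in> snd (pick_round \<sigma> u s pis P ks M acc chk)"
    and "\<And>k M. k \<in> set ks \<Longrightarrow> \<Union> (set (ord2 \<sigma> k P (pis k) M)) \<subseteq> A" "M \<subseteq> A"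
  shows "(a, b) \<in> chk \<or> a \<in> A \<and> b \<in> A"
  using assms
proof (induction ks arbitrary: M acc chk)
  case (Cons k ks)
  let ?sc = "scan u s k M (ord2 \<sigma> k P (pis k) M)"
  have sc: "a \<in> A \<and> b \<in> A" if "(a, b) \<in> snd ?sc"
    using scan_read[OF that] Cons.prems(2)[of k M] Cons.prems(3) by auto
  show ?case
  proof (cases "fst ?sc")
    case None
    then show ?thesis using Cons.prems sc by (auto simp: Let_def)
  next
    case (Some C)
    then have "C \<subseteq> A" using scan_SomeD[OF Some] Cons.prems(2)[of k M] by auto
    then have "M \<union> C \<subseteq> A" using Cons.prems(3) by blast
    moreover have "(a, b) \<in> snd (pick_round \<sigma> u s pis P ks (M \<union> C) (acc(k := C)) (chk \<union> snd ?sc))"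
      using Cons.prems(1) Some by (simp add: Let_def)
    ultimately have "(a, b) \<in> chk \<union> snd ?sc \<or> a \<in> A \<and> b \<in> A"
      using Cons.prems(2) by (intro Cons.IH) auto
    then show ?thesis using sc by blast
  qed
qed simp

abbreviation round where
  "round \<sigma> u s pis P chk \<equiv> pick_round \<sigma> u s pis P [1..<21] {} (\<lambda>_. {}) chk"

definition union20 :: "(nat \<Rightarrow> nat set) \<Rightarrow> nat set" where
  "union20 cs = (\<Union>k\<in>{1..20}. cs k)"

lemma earlier_subset_union20: "k \<in> {1..20} \<Longrightarrow> earlier cs k \<subseteq> union20 cs"
  unfolding earlier_def union20_def by (rule UN_mono) auto

lemmas round_cases = pick_round_cases[of 1 21 _ _ _ _ _ _ "\<lambda>_. {}", OF order_refl one_le_numeral refl, unfolded One_nat_def earlier_1,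
    folded One_nat_def]

lemma interval_1_21: "{1..<21} = {1..20::nat}" by auto

text \<open>The right-hand side does not mention \<open>chk\<close>: the record of reads has no
  influence on the choices. Being an equivalence, it reduces the transfer of a successful round
  between two utility functions to a check class by class.\<close>

lemma round_Some_iff:
  "fst (round \<sigma> u s pis P chk) = Some cs \<longleftrightarrow>
    (\<forall>j. j \<notin> {1..20} \<longrightarrow> cs j = {}) \<and> (\<forall>j\<in>{1..20}. selected \<sigma> u s pis P cs j)"
proof
  assume "fst (round \<sigma> u s pis P chk) = Some cs"
  with round_cases[of \<sigma> u s pis P chk]
  show "(\<forall>j. j \<notin> {1..20} \<longrightarrow> cs j = {}) \<and> (\<forall>j\<in>{1..20}. selected \<sigma> u s pis P cs j)"
    unfolding interval_1_21 by simp
next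
  assume *: "(\<forall>j. j \<notin> {1..20} \<longrightarrow> cs j = {}) \<and> (\<forall>j\<in>{1..20}. selected \<sigma> u s pis P cs j)"
  have "fst (pick_round \<sigma> u s pis P [1..<21] (earlier (\<lambda>_. {}) 1) (\<lambda>_. {}) chk) = Some cs"
  proof (rule pick_round_SomeI)
    show "\<forall>j. j \<notin> {1..<21} \<longrightarrow> cs j = {}" "\<forall>j\<in>{1..<21}. selected \<sigma> u s pis P cs j"
      unfolding interval_1_21 using * by blast+
  qed simp_all
  then show "fst (round \<sigma> u s pis P chk) = Some cs" by (simp only: One_nat_def earlier_1)
qed

lemma round_Some_reads:
  assumes "fst (round \<sigma> u s pis P chk) = Some cs" "(a, b) \<in> snd (round \<sigma> u s pis P chk)"
  shows "(a, b) \<in> chk \<or> (\<exists>j\<in>{1..20}. a \<in> earlier cs j \<and>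
            (\<exists>D\<in>set (ord2 \<sigma> j P (pis j) (earlier cs j)). b \<in> D \<and>
              (D = cs j \<or> \<not> compatible u s j (earlier cs j) D)))"
  using round_cases[of \<sigma> u s pis P chk] assms(2) unfolding interval_1_21 assms(1) option.case
  by (simp only: simp_thms)

lemma round_NoneD:
  assumes "fst (round \<sigma> u s pis P chk) = None"
  shows "\<exists>cs. \<exists>j\<in>{1..20}. (\<forall>i\<in>{1..<j}. selected \<sigma> u s pis P cs i) \<and>
         (\<forall>D\<in>set (ord2 \<sigma> j P (pis j) (earlier cs j)). \<not> compatible u s j (earlier cs j) D)"
  using round_cases[of \<sigma> u s pis P chk] unfolding interval_1_21 assms(1) option.case
  by blast

text \<open>The first \<open>t\<close> rounds of Stage 2, provided that all of them succeed. The recorded pairs are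
  dropped, since they do not influence the choices of Stage 2.\<close>

fun rounds :: "strat \<Rightarrow> utility \<Rightarrow> nat \<Rightarrow> nat \<Rightarrow> (nat \<Rightarrow> nat set set) \<Rightarrow> nat set set
    \<Rightarrow> ((nat \<Rightarrow> nat set set) \<times> nat set set) option" where
  "rounds \<sigma> u s 0 pis P = Some (pis, P)"
| "rounds \<sigma> u s (Suc t) pis P =
     (if pis 1 = {} then None
      else case fst (round \<sigma> u s pis P {}) of
             None \<Rightarrow> None
           | Some cs \<Rightarrow> rounds \<sigma> u s t (\<lambda>k. pis k - {cs k}) (insert (union20 cs) P))"

lemma fst_round_chk: "fst (round \<sigma> u s pis P chk) = fst (round \<sigma> u s pis P {})"
proof (cases "fst (round \<sigma> u s pis P {})")
  case None
  then show ?thesis using round_Some_iff[of \<sigma> u s pis P chk] round_Some_iff[of \<sigma> u s pis P "{}"]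
    by (metis not_None_eq)
next
  case (Some cs)
  then have "fst (round \<sigma> u s pis P chk) = Some cs" unfolding round_Some_iff .
  with Some show ?thesis by simp
qed

lemma rounds_add:
  assumes "rounds \<sigma> u s (t + t') pis P = Some st"
  obtains pis1 P1 where "rounds \<sigma> u s t pis P = Some (pis1, P1)" "rounds \<sigma> u s t' pis1 P1 = Some st"
  using assms
proof (induction t arbitrary: pis P thesis)
  case 0
  then show ?case by simp
next
  case (Suc t)
  from Suc.prems(2) obtain cs where cs: "pis 1 \<noteq> {}" "fst (round \<sigma> u s pis P {}) = Some cs"
    "rounds \<sigma> u s (t + t') (\<lambda>k. pis k - {cs k}) (insert (union20 cs) P) = Some st"
    unfolding add_Suc rounds.simps by (auto split: if_splits option.splits)
  from Suc.IH[OF _ cs(3)] obtain pis1 P1 where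
    "rounds \<sigma> u s t (\<lambda>k. pis k - {cs k}) (insert (union20 cs) P) = Some (pis1, P1)"
    "rounds \<sigma> u s t' pis1 P1 = Some st" by metis
  with cs show ?case by (intro Suc.prems(1)[of pis1 P1]) (simp_all only: rounds.simps option.case if_False)
qed

lemma compatible_mono:
  assumes "compatible u' s k M C" "\<And>a b. u' a b \<le> u a b"
  shows "compatible u s k M C"
proof -
  have "util u' a A \<le> util u a A" for a A
    unfolding util_def by (intro sum_mono assms)
  then show ?thesis using assms(1) unfolding compatible_def by (meson order_trans)
qed

section \<open>Cliques, utilities of unions, and enlarging a partition\<close>

definition clique :: "utility \<Rightarrow> nat set \<Rightarrow> bool" where
  "clique u C \<longleftrightarrow> (\<forall>a\<in>C. \<forall>b\<in>C. a \<noteq> b \<longrightarrow> 1/2 \<le> u a b)"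

lemma clique_insert: "clique u C \<Longrightarrow> clique_ok u C w \<Longrightarrow> clique u (insert w C)"
  unfolding clique_def clique_ok_def by blast

lemma grow_clique: "clique u C \<Longrightarrow> clique u (grow \<sigma> u s i P R f C L)"
  by (induction f arbitrary: C L) (simp_all add: Let_def clique_insert)

lemma grow_card: "finite C \<Longrightarrow> card C \<le> s \<Longrightarrow> card (grow \<sigma> u s i P R f C L) \<le> s"
  by (induction f arbitrary: C L) (auto simp: Let_def card_insert_if)

lemma util_union:
  assumes "finite A" "finite B" "A \<inter> B = {}"
  shows "util u a (A \<union> B) = util u a A + util u a B"
proof -
  have "A \<union> B - {a} = (A - {a}) \<union> (B - {a})" by blast
  moreover have "(A - {a}) \<inter> (B - {a}) = {}" using assms(3) by blast
  ultimately show ?thesis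
    unfolding util_def using sum.union_disjoint[of "A - {a}" "B - {a}" "u a"] assms(1,2) by simp
qed

lemma util_UNION:
  assumes "finite J" "\<And>j. j \<in> J \<Longrightarrow> finite (F j)" "\<And>i j. i \<in> J \<Longrightarrow> j \<in> J \<Longrightarrow> i \<noteq> j \<Longrightarrow> F i \<inter> F j = {}"
  shows "util u a (\<Union>j\<in>J. F j) = (\<Sum>j\<in>J. util u a (F j))"
proof -
  have *: "(\<Union>j\<in>J. F j) - {a} = (\<Union>j\<in>J. F j - {a})" by blast
  show ?thesis unfolding util_def *
  proof (rule sum.UNION_disjoint[OF assms(1)]; intro ballI impI)
    show "finite (F j - {a})" if "j \<in> J" for j using assms(2)[OF that] by simp
    show "(F i - {a}) \<inter> (F j - {a}) = {}" if "i \<in> J" "j \<in> J" "i \<noteq> j" for i j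
      using assms(3)[OF that] by blast
  qed
qed

lemma util_bounds:
  fixes c :: real
  assumes "finite A" "\<And>b. b \<in> A \<Longrightarrow> b \<noteq> a \<Longrightarrow> c \<le> u a b"
  shows "card (A - {a}) * c \<le> util u a A"
  unfolding util_def using sum_bounded_below[of "A - {a}" c "u a"] assms by auto

lemma partition_on_extend:
  assumes "partition_on A Q" "C \<in> Q" "x \<notin> A"
  shows "partition_on (insert x A) (insert (insert x C) (Q - {C}))"
proof (rule partition_onI)
  have U: "\<Union>Q = A" "disjoint Q" "{} \<notin> Q" using assms(1) by (auto simp: partition_on_def)
  show "\<Union> (insert (insert x C) (Q - {C})) = insert x A" using U(1) assms(2) by blast
  have d: "B \<inter> C = {}" if "B \<in> Q" "B \<noteq> C" for B using disjointD[OF U(2) that(1) assms(2) that(2)] .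
  have x: "x \<notin> B" if "B \<in> Q" for B using U(1) assms(3) that by blast
  have "disjnt (insert x C) B \<and> disjnt B (insert x C)" if "B \<in> Q - {C}" for B
    using d[of B] x[of B] that by (auto simp: disjnt_def)
  then have "disjoint (insert (insert x C) (Q - {C}))"
    using pairwise_subset[OF U(2), of "Q - {C}"] by (simp add: pairwise_insert)
  then show "disjnt p q" if "p \<in> insert (insert x C) (Q - {C})" "q \<in> insert (insert x C) (Q - {C})" "p \<noteq> q" for p q
    by (rule pairwiseD[OF _ that])
  show "{} \<notin> insert (insert x C) (Q - {C})" using U(3) by auto
qed

definition pairs :: "nat \<Rightarrow> (nat \<times> nat) set" where
  "pairs n = {(a, b). a < n \<and> b < n \<and> a \<noteq> b}"

lemma finite_pairs: "finite (pairs n)"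
  by (rule finite_subset[of _ "{..<n} \<times> {..<n}"]) (auto simp: pairs_def)

lemma util_row:
  assumes "a \<notin> C"
  shows "util (curry f) a C = (\<Sum>j\<in>Pair a ` C. f j)"
proof -
  have "C - {a} = C" using assms by blast
  then show ?thesis by (simp add: util_def sum.reindex inj_on_def)
qed

section \<open>The state of a run and the utilities that determine it\<close>

locale ashg_run =
  fixes n :: nat and \<sigma> :: strat
  assumes valid: "valid_strat n \<sigma>" and s_pos: "0 < s_param n"
begin

abbreviation "s \<equiv> s_param n"
abbreviation "N \<equiv> part \<sigma>"

lemma N_subset: "k \<in> {1..20} \<Longrightarrow> N k \<subseteq> {0..<n}"
  and N_union: "(\<Union>k\<in>{1..20}. N k) = {0..<n}"
  and N_card: "k \<in> {1..20} \<Longrightarrow> card (N k) \<in> {n div 20, (n + 19) div 20}"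
  and selV: "finite R \<Longrightarrow> R \<noteq> {} \<Longrightarrow> selV \<sigma> i P R \<in> R"
  and selW: "finite L \<Longrightarrow> L \<noteq> {} \<Longrightarrow> selW \<sigma> i P R C L \<in> L"
  and ord2: "finite P \<Longrightarrow> set (ord2 \<sigma> k Q P M) = P"
  and selX: "finite R \<Longrightarrow> R \<noteq> {} \<Longrightarrow> selX \<sigma> U D R \<in> R"
  and selC: "finite Cs \<Longrightarrow> Cs \<noteq> {} \<Longrightarrow> selC \<sigma> x U D Cs \<in> Cs"
  using valid[unfolded valid_strat_def] by (simp_all only: simp_thms)

lemma N_disjoint: "j \<in> {1..20} \<Longrightarrow> k \<in> {1..20} \<Longrightarrow> j \<noteq> k \<Longrightarrow> N j \<inter> N k = {}"
  using valid[unfolded valid_strat_def, THEN conjunct2, THEN conjunct1] by blast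

lemma N_finite: "k \<in> {1..20} \<Longrightarrow> finite (N k)"
  using N_subset finite_subset by blast

text \<open>The combinatorial shape of an outcome of Stage 1, without the clique property. Stage 2
  can thus be studied for a fixed family while all utilities are still random.\<close>

definition families :: "(nat \<Rightarrow> nat set set) \<Rightarrow> bool" where
  "families pis \<longleftrightarrow> (\<forall>k\<in>{1..20}. disjoint (pis k) \<and> (\<forall>C\<in>pis k. C \<subseteq> N k \<and> card C = s))"

text \<open>A merged coalition is stored as the union \<open>T\<close> of \<open>C\<^sub>1, \<dots>, C\<^sub>2\<^sub>0\<close>. Since the classes are disjoint, its
  parts can be recovered: \<open>C\<^sub>k\<close> is \<open>T \<inter> N k\<close>, and \<open>prefix T k\<close> is \<open>C\<^sub>1 \<union> \<dots> \<union> C\<^bsub>k-1\<^esub>\<close>.\<close>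

definition prefix :: "nat set \<Rightarrow> nat \<Rightarrow> nat set" where
  "prefix T k = T \<inter> (\<Union>j\<in>{1..<k}. N j)"

definition state :: "(nat \<Rightarrow> nat set set) \<Rightarrow> (nat \<Rightarrow> nat set set) \<Rightarrow> nat set set \<Rightarrow> bool" where
  "state pis0 pis P \<longleftrightarrow> families pis0 \<and> finite P \<and> disjoint P \<and> (\<forall>T\<in>P. T \<subseteq> {0..<n}) \<and>
     (\<forall>k\<in>{1..20}. pis k \<inter> (\<lambda>T. T \<inter> N k) ` P = {} \<and> pis k \<union> (\<lambda>T. T \<inter> N k) ` P = pis0 k)"

lemma state_init: "families pis \<Longrightarrow> state pis pis {}"
  by (auto simp: state_def)

lemma state_sub: "state pis0 pis P \<Longrightarrow> k \<in> {1..20} \<Longrightarrow> pis k \<subseteq> pis0 k"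
  unfolding state_def by blast

lemma familiesD:
  assumes "families pis" "k \<in> {1..20}"
  shows "disjoint (pis k)" "\<And>C. C \<in> pis k \<Longrightarrow> C \<subseteq> N k" "\<And>C. C \<in> pis k \<Longrightarrow> card C = s"
  using assms unfolding families_def by blast+

lemma families_finite:
  assumes "families pis" "k \<in> {1..20}" shows "finite (pis k)"
proof (rule finite_subset)
  show "pis k \<subseteq> Pow (N k)" using familiesD(2)[OF assms] by blast
  show "finite (Pow (N k))" using N_finite[OF assms(2)] by simp
qed

lemma families_subset:
  assumes "families pis0" "\<And>k. k \<in> {1..20} \<Longrightarrow> pis k \<subseteq> pis0 k"
  shows "families pis"
  unfolding families_def
proof (intro ballI conjI)
  fix k assume k: "k \<in> {1..20::nat}"
  show "disjoint (pis k)"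
    by (rule pairwise_subset[OF familiesD(1)[OF assms(1) k] assms(2)[OF k]])
  fix C assume "C \<in> pis k"
  then have "C \<in> pis0 k" using assms(2)[OF k] by blast
  then show "C \<subseteq> N k" "card C = s" using familiesD(2,3)[OF assms(1) k] by blast+
qed

lemma stateD:
  assumes "state pis0 pis P"
  shows "families pis0" "finite P" "disjoint P" "\<And>T. T \<in> P \<Longrightarrow> T \<subseteq> {0..<n}"
    "\<And>k. k \<in> {1..20} \<Longrightarrow> pis k \<inter> (\<lambda>T. T \<inter> N k) ` P = {}"
    "\<And>k. k \<in> {1..20} \<Longrightarrow> pis k \<union> (\<lambda>T. T \<inter> N k) ` P = pis0 k"
  using assms unfolding state_def by blast+

lemma state_families:
  assumes "state pis0 pis P" shows "families pis"
  by (rule families_subset[OF stateD(1)[OF assms]]) (rule state_sub[OF assms])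

lemma state_part: "state pis0 pis P \<Longrightarrow> T \<in> P \<Longrightarrow> k \<in> {1..20} \<Longrightarrow> T \<inter> N k \<in> pis0 k - pis k"
  unfolding state_def by blast

lemma state_part_card:
  assumes "state pis0 pis P" "T \<in> P" "k \<in> {1..20}" shows "card (T \<inter> N k) = s"
  using state_part[OF assms] familiesD(3)[OF stateD(1)[OF assms(1)] assms(3)] by blast

text \<open>The map taking \<open>T\<close> to \<open>T \<inter> N k\<close> is injective on
  \<open>P\<close>: distinct merged coalitions are disjoint and their traces are nonempty. Every
  class therefore loses exactly one clique per merged coalition.\<close>

lemma state_card:
  assumes "state pis0 pis P" "k \<in> {1..20}"
  shows "card (pis k) + card P = card (pis0 k)"
proof -
  have "inj_on (\<lambda>T. T \<inter> N k) P"
  proof (rule inj_onI, rule ccontr)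
    fix T T' assume T: "T \<in> P" "T' \<in> P" "T \<inter> N k = T' \<inter> N k" "T \<noteq> T'"
    from disjointD[OF stateD(3)[OF assms(1)] T(1,2,4)] have "T \<inter> T' = {}" .
    then have "T \<inter> N k = {}" using T(3) by blast
    then show False using state_part_card[OF assms(1) T(1) assms(2)] s_pos by simp
  qed
  then have "card P = card ((\<lambda>T. T \<inter> N k) ` P)" by (simp add: card_image)
  moreover have "finite P" "pis k \<inter> (\<lambda>T. T \<inter> N k) ` P = {}" "pis k \<union> (\<lambda>T. T \<inter> N k) ` P = pis0 k"
    using stateD(2,5,6)[OF assms(1)] assms(2) by blast+
  ultimately show ?thesis
    using families_finite[OF state_families[OF assms(1)] assms(2)]
      card_Un_disjoint[of "pis k" "(\<lambda>T. T \<inter> N k) ` P"] by simp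
qed

lemma state_disjoint_rest:
  assumes "state pis0 pis P" "k \<in> {1..20}" "C \<in> pis k" "T \<in> P"
  shows "C \<inter> T = {}"
proof -
  have "C \<in> pis0 k" "C \<subseteq> N k"
    using assms(3) familiesD(2)[OF state_families[OF assms(1)] assms(2)] state_sub[OF assms(1,2)] by blast+
  moreover have "T \<inter> N k \<in> pis0 k" "T \<inter> N k \<noteq> C" using state_part[OF assms(1,4,2)] assms by auto
  moreover have "disjoint (pis0 k)" by (rule familiesD(1)[OF stateD(1)[OF assms(1)] assms(2)])
  ultimately have "C \<inter> (T \<inter> N k) = {}" using disjointD[of "pis0 k" C "T \<inter> N k"] by blast
  with \<open>C \<subseteq> N k\<close> show ?thesis by blast
qed

lemma selected_mem:
  assumes "families pis" "k \<in> {1..20}" "selected \<sigma> u s' pis P cs k"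
  shows "cs k \<in> pis k"
  using assms ord2[OF families_finite[OF assms(1,2)]] unfolding selected_def
  by (metis in_set_conv_decomp)

lemma union20_Int:
  assumes "\<And>j. j \<in> {1..20} \<Longrightarrow> cs j \<subseteq> N j" "k \<in> {1..20}"
  shows "union20 cs \<inter> N k = cs k"
proof (intro subset_antisym subsetI)
  fix x assume "x \<in> union20 cs \<inter> N k"
  then obtain j where j: "j \<in> {1..20}" "x \<in> cs j" "x \<in> N k" unfolding union20_def by blast
  then have "x \<in> N j \<inter> N k" using assms(1) by blast
  then have "j = k" using N_disjoint[OF j(1) assms(2)] by blast
  then show "x \<in> cs k" using j by simp
qed (use assms in \<open>auto simp: union20_def\<close>)

lemma prefix_union20:
  assumes "\<And>j. j \<in> {1..20} \<Longrightarrow> cs j \<subseteq> N j" "k \<in> {1..20}"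
  shows "prefix (union20 cs) k = earlier cs k"
proof -
  have "prefix (union20 cs) k = (\<Union>j\<in>{1..<k}. union20 cs \<inter> N j)" unfolding prefix_def by blast
  also have "\<dots> = (\<Union>j\<in>{1..<k}. cs j)"
    by (rule SUP_cong[OF refl], rule union20_Int[OF assms(1)]) (use assms in auto)
  finally show ?thesis by (simp add: earlier_def)
qed

lemma state_step:
  assumes st: "state pis0 pis P" and cs: "\<And>j. j \<in> {1..20} \<Longrightarrow> cs j \<in> pis j"
  shows "state pis0 (\<lambda>k. pis k - {cs k}) (insert (union20 cs) P)" and "union20 cs \<notin> P"
proof -
  have csN: "cs j \<subseteq> N j" if "j \<in> {1..20}" for j
    by (rule familiesD(2)[OF state_families[OF st] that cs[OF that]])
  have T: "union20 cs \<inter> N k = cs k" if "k \<in> {1..20}" for k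
    by (rule union20_Int[OF csN that])
  show nin: "union20 cs \<notin> P"
    using state_part[OF st, of "union20 cs" 1] T[of 1] cs[of 1] by auto
  have disj: "union20 cs \<inter> T' = {}" if "T' \<in> P" for T'
    using state_disjoint_rest[OF st _ cs that] unfolding union20_def by blast
  have sub: "union20 cs \<subseteq> {0..<n}" using csN N_subset unfolding union20_def by blast
  have d: "disjoint (insert (union20 cs) P)"
    using stateD(3)[OF st] disj by (simp add: pairwise_insert disjnt_def Int_commute)
  have p: "(pis k - {cs k}) \<inter> (\<lambda>T. T \<inter> N k) ` insert (union20 cs) P = {} \<and>
     (pis k - {cs k}) \<union> (\<lambda>T. T \<inter> N k) ` insert (union20 cs) P = pis0 k" if k: "k \<in> {1..20}" for k
  proof -
    show ?thesis using stateD(5,6)[OF st k] T[OF k] cs[OF k] by auto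
  qed
  show "state pis0 (\<lambda>k. pis k - {cs k}) (insert (union20 cs) P)"
    unfolding state_def using stateD(4)[OF st] sub
    by (intro conjI ballI stateD(1)[OF st] d p finite.insertI stateD(2)[OF st]) (erule insertE; simp)
qed

lemma rounds_state:
  assumes "rounds \<sigma> u s t pis P = Some (pis', P')" "state pis0 pis P"
  shows "state pis0 pis' P' \<and> card P' = card P + t \<and> P \<subseteq> P' \<and> (\<forall>k\<in>{1..20}. pis' k \<subseteq> pis k)"
  using assms
proof (induction t arbitrary: pis P)
  case (Suc t)
  from Suc.prems obtain cs where cs: "fst (round \<sigma> u s pis P {}) = Some cs"
    "rounds \<sigma> u s t (\<lambda>k. pis k - {cs k}) (insert (union20 cs) P) = Some (pis', P')"
    by (auto split: if_splits option.splits)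
  have m: "cs j \<in> pis j" if "j \<in> {1..20}" for j
    using selected_mem[OF state_families[OF Suc.prems(2)] that] cs(1) that
    unfolding round_Some_iff by blast
  have "finite P" by (rule stateD(2)[OF Suc.prems(2)])
  then have c: "card (insert (union20 cs) P) = Suc (card P)" using state_step(2)[OF Suc.prems(2) m] by simp
  have r: "state pis0 pis' P' \<and> card P' = card (insert (union20 cs) P) + t \<and> insert (union20 cs) P \<subseteq> P'
      \<and> (\<forall>k\<in>{1..20}. pis' k \<subseteq> pis k - {cs k})"
    by (rule Suc.IH[OF cs(2) state_step(1)[OF Suc.prems(2) m]])
  show ?case
  proof (intro conjI ballI)
    show "state pis0 pis' P'" "P \<subseteq> P'" using r by simp_all
    show "card P' = card P + Suc t" using r c by simp
    fix k assume "k \<in> {1..20::nat}"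
    with r have "pis' k \<subseteq> pis k - {cs k}" by simp
    then show "pis' k \<subseteq> pis k" by blast
  qed
qed simp

text \<open>Lowering utilities keeps every rejection, so a successful history survives as long as
  the utilities inside the formed coalitions are untouched.\<close>

lemma rounds_mono:
  assumes "rounds \<sigma> u s t pis P = Some (pis', P')" "state pis0 pis P"
    and le: "\<And>a b. u' a b \<le> u a b"
    and eq: "\<And>T a b. T \<in> P' \<Longrightarrow> a \<in> T \<Longrightarrow> b \<in> T \<Longrightarrow> u' a b = u a b"
  shows "rounds \<sigma> u' s t pis P = Some (pis', P')"
  using assms(1,2)
proof (induction t arbitrary: pis P)
  case (Suc t)
  from Suc.prems obtain cs where cs: "pis 1 \<noteq> {}" "fst (round \<sigma> u s pis P {}) = Some cs"
    "rounds \<sigma> u s t (\<lambda>k. pis k - {cs k}) (insert (union20 cs) P) = Some (pis', P')"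
    by (auto split: if_splits option.splits)
  have m: "cs j \<in> pis j" if "j \<in> {1..20}" for j
    using selected_mem[OF state_families[OF Suc.prems(2)] that] cs(2) that
    unfolding round_Some_iff by blast
  note st = state_step(1)[OF Suc.prems(2) m]
  have T: "union20 cs \<in> P'" using rounds_state[OF cs(3) st] by blast
  \<comment> \<open>The accepted clique and its prefix lie inside \<open>union20 cs\<close>, which
    belongs to \<open>P'\<close>, so the acceptance is read from unchanged utilities; the rejections
    follow from monotonicity.\<close>
  have "selected \<sigma> u' s pis P cs j" if j: "j \<in> {1..20}" for j
  proof -
    have sub: "cs j \<subseteq> union20 cs" "earlier cs j \<subseteq> union20 cs"
      using j earlier_subset_union20[OF j] unfolding union20_def by auto
    have "util u a (cs j) = util u' a (cs j)" if "a \<in> earlier cs j" for a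
      unfolding util_def by (rule sum.cong[OF refl]) (use eq[OF T, symmetric] sub that in blast)
    moreover have "util u b (earlier cs j) = util u' b (earlier cs j)" if "b \<in> cs j" for b
      unfolding util_def by (rule sum.cong[OF refl]) (use eq[OF T, symmetric] sub that in blast)
    ultimately have "compatible u s j (earlier cs j) (cs j) = compatible u' s j (earlier cs j) (cs j)"
      unfolding compatible_def by simp
    moreover have "selected \<sigma> u s pis P cs j" using cs(2) j unfolding round_Some_iff by blast
    moreover have "\<not> compatible u' s j (earlier cs j) D" if "\<not> compatible u s j (earlier cs j) D" for D
      using that compatible_mono[of u' s j "earlier cs j" D u] le by blast
    ultimately show ?thesis unfolding selected_def by blast
  qed
  then have "fst (round \<sigma> u' s pis P {}) = Some cs" using cs(2) unfolding round_Some_iff by blast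
  then show ?case using Suc.IH[OF cs(3) st] cs(1) by simp
qed simp

text \<open>These are the only tests Stage 2 performs: a clique of class \<open>k\<close> against
  agents of smaller classes. Stage 2 is thus governed by utilities between different classes, none
  of which Stage 1 looks at.\<close>

definition same_compat :: "utility \<Rightarrow> utility \<Rightarrow> bool" where
  "same_compat u u' \<longleftrightarrow> (\<forall>k\<in>{1..20}. \<forall>C. \<forall>M. C \<subseteq> N k \<longrightarrow> M \<subseteq> (\<Union>j\<in>{1..<k}. N j) \<longrightarrow>
     compatible u s k M C = compatible u' s k M C)"

lemma pick_round_cong:
  assumes sc: "same_compat u u'" and fam: "families pis" and pis: "\<And>k. k \<in> {1..20} \<Longrightarrow> pis k = pis' k"
    and "1 \<le> k" "k \<le> 21" "M \<subseteq> (\<Union>j\<in>{1..<k}. N j)"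
  shows "pick_round \<sigma> u s pis P [k..<21] M acc chk = pick_round \<sigma> u' s pis' P [k..<21] M acc chk"
  using assms(4-)
proof (induction "21 - k" arbitrary: k M acc chk)
  case 0
  then have "[k..<21] = []" by simp
  then show ?case by (simp only: pick_round.simps)
next
  case (Suc d)
  then have km: "k < 21" by simp
  then have ks: "[k..<21] = k # [Suc k..<21]" by (rule upt_conv_Cons)
  have k: "k \<in> {1..20}" using Suc.prems km by auto
  let ?xs = "ord2 \<sigma> k P (pis k) M"
  have xs: "set ?xs = pis k" by (rule ord2[OF families_finite[OF fam k]])
  have sub: "C \<subseteq> N k" if "C \<in> pis k" for C by (rule familiesD(2)[OF fam k that])
  have eq: "scan u s k M ?xs = scan u' s k M ?xs"
    by (rule scan_cong) (use sc k xs sub Suc.prems in \<open>auto simp: same_compat_def\<close>)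
  have "pick_round \<sigma> u s pis P [Suc k..<21] (M \<union> C) acc chk = pick_round \<sigma> u' s pis' P [Suc k..<21] (M \<union> C) acc chk"
    if "fst (scan u s k M ?xs) = Some C" for C acc chk
  proof (rule Suc.hyps(1))
    have "C \<in> pis k" using scan_SomeD[OF that] xs by (metis in_set_conv_decomp)
    then have "C \<subseteq> N k" by (rule sub)
    then show "M \<union> C \<subseteq> (\<Union>j\<in>{1..<Suc k}. N j)" using Suc.prems k by fastforce
  qed (use Suc.hyps Suc.prems km in auto)
  then show ?case
    unfolding ks pick_round.simps Let_def eq[symmetric] pis[OF k, symmetric]
    by (cases "fst (scan u s k M ?xs)") simp_all
qed

lemma round_cong:
  assumes "same_compat u u'" "families pis" "\<And>k. k \<in> {1..20} \<Longrightarrow> pis k = pis' k"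
  shows "round \<sigma> u s pis P chk = round \<sigma> u' s pis' P chk"
proof (rule pick_round_cong[OF assms])
  show "1 \<le> (1::nat)" "1 \<le> (21::nat)" "{} \<subseteq> (\<Union>j\<in>{1..<1}. N j)" by simp_all
qed

lemma families_remove:
  assumes "families pis" shows "families (\<lambda>k. pis k - {cs k})"
  by (rule families_subset[OF assms]) (rule Diff_subset)

lemma rounds_cong:
  assumes "same_compat u u'" "families pis"
  shows "rounds \<sigma> u s t pis P = rounds \<sigma> u' s t pis P"
  using assms(2)
proof (induction t arbitrary: pis P)
  case (Suc t)
  have r: "round \<sigma> u s pis P {} = round \<sigma> u' s pis P {}"
    by (rule round_cong[OF assms(1) Suc.prems]) (rule refl)
  show ?case unfolding rounds.simps r Suc.IH[OF families_remove[OF Suc.prems]] by (rule refl)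
qed simp

text \<open>Agreement is assumed and concluded only on the classes 1 to 20. The two functions that
  will be compared, the families computed by the algorithm and their normalised version, may differ
  elsewhere.\<close>

lemma stage2_cong:
  assumes sc: "same_compat u u'" and "families pis" "\<And>k. k \<in> {1..20} \<Longrightarrow> pis k = pis' k"
  shows "snd (stage2_loop \<sigma> u s f pis P chk) = snd (stage2_loop \<sigma> u' s f pis' P chk) \<and>
    (\<forall>k\<in>{1..20}. fst (stage2_loop \<sigma> u s f pis P chk) k = fst (stage2_loop \<sigma> u' s f pis' P chk) k)"
  using assms(2,3)
proof (induction f arbitrary: pis pis' P chk)
  case (Suc f)
  have r: "round \<sigma> u s pis P chk = round \<sigma> u' s pis' P chk"
    by (rule round_cong[OF sc Suc.prems(1)]) (rule Suc.prems(2))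
  have 1: "pis 1 = pis' 1" by (rule Suc.prems(2)) simp
  show ?case
  proof (cases "pis' 1 = {} \<or> fst (round \<sigma> u' s pis' P chk) = None")
    case True
    then show ?thesis using Suc.prems(2) unfolding stage2_loop.simps Let_def r 1 by auto
  next
    case False
    then obtain cs where cs: "fst (round \<sigma> u' s pis' P chk) = Some cs" by auto
    show ?thesis
      using Suc.IH[OF families_remove[OF Suc.prems(1)], of cs "\<lambda>k. pis' k - {cs k}"] Suc.prems(2) False
      unfolding stage2_loop.simps Let_def r 1 cs by simp
  qed
qed simp

lemma stage2_increasing: "P \<subseteq> fst (snd (stage2_loop \<sigma> u s f pis P chk))"
proof (induction f arbitrary: pis P chk)
  case (Suc f)
  show ?case
  proof (cases "pis 1 = {} \<or> fst (round \<sigma> u s pis P chk) = None")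
    case True
    then show ?thesis unfolding stage2_loop.simps Let_def by auto
  next
    case False
    then obtain cs where cs: "fst (round \<sigma> u s pis P chk) = Some cs" by auto
    show ?thesis using Suc.IH[of "insert (\<Union>k\<in>{1..20}. cs k) P"] False
      unfolding stage2_loop.simps Let_def cs option.case by auto
  qed
qed simp

text \<open>The loop consists of \<open>t\<close> successful rounds and at most one failing round.
  \<open>Rd\<close> stands for any relation covering the reads: \<open>Rd1\<close> treats the
  successful rounds and \<open>Rd2\<close> the failing one, all of whose agents stay unmerged.
  Rejected cliques are sought in \<open>pis0 k\<close> rather than among the final remainders, since
  they may be merged in a later round.\<close>

lemma stage2_rounds:
  assumes "stage2_loop \<sigma> u s f pis P chk = (pisF, PF, chkF)" "state pis0 pis P"
    and "\<And>a b. (a, b) \<in> chk \<Longrightarrow> Rd a b"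
    and Rd1: "\<And>T k a b D. T \<in> PF \<Longrightarrow> k \<in> {1..20} \<Longrightarrow> a \<in> prefix T k \<Longrightarrow>
        b \<in> T \<or> (b \<in> D \<and> D \<in> pis0 k \<and> \<not> compatible u s k (prefix T k) D) \<Longrightarrow> Rd a b"
    and Rd2: "\<And>a b. a \<in> (\<Union>k\<in>{1..20}. \<Union>(pisF k)) \<Longrightarrow> b \<in> (\<Union>k\<in>{1..20}. \<Union>(pisF k)) \<Longrightarrow> Rd a b"
  shows "(\<exists>t\<le>f. rounds \<sigma> u s t pis P = Some (pisF, PF) \<and>
      (t = f \<or> pisF 1 = {} \<or> fst (round \<sigma> u s pisF PF {}) = None)) \<and> (\<forall>(a,b)\<in>chkF. Rd a b)"
  using assms(1-3)
proof (induction f arbitrary: pis P chk)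
  case 0
  then show ?case by auto
next
  case (Suc f)
  let ?r = "round \<sigma> u s pis P chk"
  show ?case
  proof (cases "pis 1 = {}")
    case True
    then show ?thesis using Suc.prems by (intro conjI exI[of _ 0]) auto
  next
    case False
    have fam: "families pis" by (rule state_families[OF Suc.prems(2)])
    have o: "set (ord2 \<sigma> k P (pis k) M) = pis k" if "k \<in> {1..20}" for k M
      by (rule ord2[OF families_finite[OF fam that]])
    show ?thesis
    proof (cases "fst ?r")
      case None
      then have F: "pisF = pis" "PF = P" "chkF = snd ?r" using Suc.prems(1) False by (auto simp: Let_def)
      have "Rd a b" if "(a, b) \<in> snd ?r" for a b
      proof -
        have i: "set [1..<21] = {1..20::nat}" by auto
        have "(a, b) \<in> chk \<or> a \<in> (\<Union>k\<in>{1..20}. \<Union>(pis k)) \<and> b \<in> (\<Union>k\<in>{1..20}. \<Union>(pis k))"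
        proof (rule pick_round_reads[OF that])
          fix k M assume "k \<in> set [1..<21::nat]"
          then have k: "k \<in> {1..20}" by (simp only: i)
          show "\<Union> (set (ord2 \<sigma> k P (pis k) M)) \<subseteq> (\<Union>k\<in>{1..20}. \<Union>(pis k))"
            unfolding o[OF k] using k by blast
        qed simp
        then show ?thesis using Suc.prems(3) Rd2 F by blast
      qed
      then show ?thesis using F None fst_round_chk[of \<sigma> u s pis P chk] by (intro conjI exI[of _ 0]) auto
    next
      case (Some cs)
      have m: "cs j \<in> pis j" if "j \<in> {1..20}" for j
        using selected_mem[OF fam that] Some that unfolding round_Some_iff by blast
      have csN: "cs j \<subseteq> N j" if "j \<in> {1..20}" for j
        by (rule familiesD(2)[OF fam that m[OF that]])
      note st = state_step(1)[OF Suc.prems(2) m]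
      have e: "stage2_loop \<sigma> u s f (\<lambda>k. pis k - {cs k}) (insert (union20 cs) P) (snd ?r) = (pisF, PF, chkF)"
        using Suc.prems(1) False Some by (simp add: Let_def union20_def)
      have PF: "union20 cs \<in> PF"
        using stage2_increasing[of "insert (union20 cs) P" u f "\<lambda>k. pis k - {cs k}" "snd ?r"] unfolding e by simp
      have "Rd a b" if ab: "(a, b) \<in> snd ?r" for a b
      proof -
        from round_Some_reads[OF Some ab] consider "(a, b) \<in> chk"
          | j D where "j \<in> {1..20}" "a \<in> earlier cs j" "D \<in> pis j" "b \<in> D"
              "D = cs j \<or> \<not> compatible u s j (earlier cs j) D" using o by auto
        then show ?thesis
        proof cases
          case 1
          then show ?thesis using Suc.prems(3) by blast
        next
          case 2
          have "D \<in> pis0 j" using 2 state_sub[OF Suc.prems(2)] by blast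
          moreover have "cs j \<subseteq> union20 cs" using 2(1) by (auto simp: union20_def)
          ultimately show ?thesis
            using Rd1[OF PF 2(1), of a b D] 2 prefix_union20[OF csN 2(1)] by auto
        qed
      qed
      from Suc.IH[OF e st this] obtain t where "t \<le> f"
        "rounds \<sigma> u s t (\<lambda>k. pis k - {cs k}) (insert (union20 cs) P) = Some (pisF, PF)"
        "t = f \<or> pisF 1 = {} \<or> fst (round \<sigma> u s pisF PF {}) = None" "\<forall>(a,b)\<in>chkF. Rd a b" by auto
      moreover have "fst (round \<sigma> u s pis P {}) = Some cs"
        by (rule trans[OF fst_round_chk[of \<sigma> u s pis P chk, symmetric] Some])
      ultimately have "rounds \<sigma> u s (Suc t) pis P = Some (pisF, PF)" "Suc t \<le> Suc f"
        "Suc t = Suc f \<or> pisF 1 = {} \<or> fst (round \<sigma> u s pisF PF {}) = None" "\<forall>(a,b)\<in>chkF. Rd a b"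
        using False by (simp_all del: pick_round.simps)
      then show ?thesis by blast
    qed
  qed
qed

section \<open>What Stage 1 reads and what it leaves behind\<close>

lemma grow_subset: "finite L \<Longrightarrow> C \<subseteq> grow \<sigma> u s' i P R f C L \<and> grow \<sigma> u s' i P R f C L \<subseteq> C \<union> L"
proof (induction f arbitrary: C L)
  case (Suc f)
  show ?case
  proof (cases "L = {} \<or> card C \<ge> s'")
    case False
    let ?w = "selW \<sigma> i P R C L" let ?C = "if clique_ok u C ?w then insert ?w C else C"
    have w: "?w \<in> L" by (rule selW) (use Suc.prems False in auto)
    have "?C \<subseteq> grow \<sigma> u s' i P R f ?C (L - {?w}) \<and> grow \<sigma> u s' i P R f ?C (L - {?w}) \<subseteq> ?C \<union> (L - {?w})"
      by (rule Suc.IH) (use Suc.prems in auto)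
    moreover have "grow \<sigma> u s' i P R (Suc f) C L = grow \<sigma> u s' i P R f ?C (L - {?w})"
      using False by (simp add: Let_def)
    moreover have "C \<subseteq> ?C" "?C \<subseteq> insert ?w C" by auto
    ultimately show ?thesis using w by blast
  qed auto
qed simp

text \<open>Each test compares some \<open>w\<close> in \<open>L\<close> with members of the current
  clique, and a clique only grows, so these members belong to the outcome. The outcome is therefore
  fixed by the pairs that touch it, and the utilities among all other agents stay fresh for the next
  clique.\<close>

lemma grow_dep:
  assumes "finite L" "\<And>w z. w \<in> L \<Longrightarrow> z \<in> grow \<sigma> u s' i P R f C L \<Longrightarrow> u w z = u' w z \<and> u z w = u' z w"
  shows "grow \<sigma> u' s' i P R f C L = grow \<sigma> u s' i P R f C L"
  using assms
proof (induction f arbitrary: C L)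
  case (Suc f)
  show ?case
  proof (cases "L = {} \<or> card C \<ge> s'")
    case False
    let ?w = "selW \<sigma> i P R C L" let ?C = "if clique_ok u C ?w then insert ?w C else C"
    have w: "?w \<in> L" by (rule selW) (use Suc.prems(1) False in auto)
    have g: "grow \<sigma> u s' i P R (Suc f) C L = grow \<sigma> u s' i P R f ?C (L - {?w})"
      using False by (simp add: Let_def)
    have "C \<subseteq> grow \<sigma> u s' i P R (Suc f) C L" using grow_subset[OF Suc.prems(1)] by blast
    then have "clique_ok u C ?w = clique_ok u' C ?w"
      using Suc.prems(2)[OF w] unfolding clique_ok_def by (metis subsetD)
    then have g': "grow \<sigma> u' s' i P R (Suc f) C L = grow \<sigma> u' s' i P R f ?C (L - {?w})"
      using False by (simp add: Let_def)
    show ?thesis unfolding g g'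
    proof (rule Suc.IH)
      show "finite (L - {?w})" using Suc.prems(1) by simp
      fix w z assume "w \<in> L - {?w}" "z \<in> grow \<sigma> u s' i P R f ?C (L - {?w})"
      then show "u w z = u' w z \<and> u z w = u' z w" using Suc.prems(2)[of w z] unfolding g by blast
    qed
  qed auto
qed simp

lemma greedy_cong:
  assumes "finite R" "\<And>a b. a \<in> R \<Longrightarrow> b \<in> R \<Longrightarrow> u a b = u' a b"
  shows "greedy \<sigma> u s' i f P R = greedy \<sigma> u' s' i f P R"
  using assms
proof (induction f arbitrary: P R)
  case (Suc f)
  show ?case
  proof (cases "R = {}")
    case False
    let ?v = "selV \<sigma> i P R"
    have v: "?v \<in> R" by (rule selV) (use Suc.prems(1) False in auto)
    let ?G = "grow \<sigma> u s' i P R (card R) {?v} (R - {?v})"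
    have f: "finite (R - {?v})" using Suc.prems(1) by simp
    have sub: "?G \<subseteq> R" using grow_subset[OF f] v by blast
    have G: "grow \<sigma> u' s' i P R (card R) {?v} (R - {?v}) = ?G"
    proof (rule grow_dep[OF f])
      fix w z assume "w \<in> R - {?v}" "z \<in> ?G"
      then have "w \<in> R" "z \<in> R" using sub by blast+
      then show "u w z = u' w z \<and> u z w = u' z w" using Suc.prems(2) by blast
    qed
    have "greedy \<sigma> u s' i f (insert ?G P) (R - ?G) = greedy \<sigma> u' s' i f (insert ?G P) (R - ?G)"
      by (rule Suc.IH) (use Suc.prems in auto)
    then show ?thesis using False G by (simp add: Let_def)
  qed simp
qed simp

lemma greedy_inv:
  assumes "finite R" "disjoint P" "\<And>C. C \<in> P \<Longrightarrow> card C = s \<and> clique u C" "\<Union>P \<inter> R = {}" "\<Union>P \<union> R = A"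
    and "greedy \<sigma> u s i f P R = (P', R')"
  shows "disjoint P' \<and> (\<forall>C\<in>P'. card C = s \<and> clique u C) \<and> \<Union>P' \<inter> R' = {} \<and> \<Union>P' \<union> R' = A"
  using assms
proof (induction f arbitrary: P R)
  case 0
  then show ?case by auto
next
  case (Suc f)
  let ?v = "selV \<sigma> i P R" let ?G = "grow \<sigma> u s i P R (card R) {?v} (R - {?v})"
  consider "R = {}" | "R \<noteq> {}" "card ?G < s" | "R \<noteq> {}" "\<not> card ?G < s" by blast
  then show ?case
  proof cases
    case 1
    then show ?thesis using Suc.prems by auto
  next
    case 2
    then have "P' = P" "R' = R" using Suc.prems(6) by (simp_all add: Let_def)
    then show ?thesis using Suc.prems by auto
  next
    case 3
    have v: "?v \<in> R" by (rule selV) (use Suc.prems(1) 3 in auto)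
    have f: "finite (R - {?v})" using Suc.prems(1) by simp
    have sub: "?G \<subseteq> R" using grow_subset[OF f] v by blast
    have "card ?G \<le> s" by (rule grow_card) (use s_pos in auto)
    then have card: "card ?G = s" using 3 by simp
    have cl: "clique u ?G" by (rule grow_clique) (simp add: clique_def)
    have e: "greedy \<sigma> u s i f (insert ?G P) (R - ?G) = (P', R')"
      using Suc.prems(6) 3 by (simp add: Let_def)
    show ?thesis
    proof (rule Suc.IH[OF _ _ _ _ _ e])
      show "finite (R - ?G)" using Suc.prems(1) by simp
      have "disjnt ?G B \<and> disjnt B ?G" if "B \<in> P" for B
        using Suc.prems(4) sub that unfolding disjnt_def by blast
      then show "disjoint (insert ?G P)" using Suc.prems(2) by (simp add: pairwise_insert)
      show "card C = s \<and> clique u C" if "C \<in> insert ?G P" for C using that Suc.prems(3) card cl by blast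
      show "\<Union> (insert ?G P) \<inter> (R - ?G) = {}" using Suc.prems(4) by blast
      show "\<Union> (insert ?G P) \<union> (R - ?G) = A" using Suc.prems(5) sub by blast
    qed
  qed
qed

section \<open>Deterministic conditions for success\<close>

text \<open>The value outside 1 to 20 is normalised to the empty family so that only finitely many
  outcomes are possible, as conditioning on the outcome requires.\<close>

definition pis0 :: "utility \<Rightarrow> nat \<Rightarrow> nat set set" where
  "pis0 u k = (if k \<in> {1..20} then fst (stage1 \<sigma> u n k) else {})"

lemma stage1_props:
  assumes k: "k \<in> {1..20}"
  shows "disjoint (pis0 u k)" "\<And>C. C \<in> pis0 u k \<Longrightarrow> C \<subseteq> N k" "\<And>C. C \<in> pis0 u k \<Longrightarrow> card C = s"
    "\<And>C. C \<in> pis0 u k \<Longrightarrow> clique u C" "snd (stage1 \<sigma> u n k) = N k - \<Union>(pis0 u k)"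
proof -
  obtain P R where PR: "stage1 \<sigma> u n k = (P, R)" by fastforce
  then have e: "greedy \<sigma> u s k (Suc (card (N k))) {} (N k) = (P, R)" unfolding stage1_def .
  have *: "disjoint P \<and> (\<forall>C\<in>P. card C = s \<and> clique u C) \<and> \<Union>P \<inter> R = {} \<and> \<Union>P \<union> R = N k"
    by (rule greedy_inv[OF N_finite[OF k] _ _ _ _ e]) simp_all
  have P: "pis0 u k = P" "snd (stage1 \<sigma> u n k) = R" using k PR by (simp_all add: pis0_def)
  show "disjoint (pis0 u k)" "\<And>C. C \<in> pis0 u k \<Longrightarrow> C \<subseteq> N k" "\<And>C. C \<in> pis0 u k \<Longrightarrow> card C = s"
    "\<And>C. C \<in> pis0 u k \<Longrightarrow> clique u C" "snd (stage1 \<sigma> u n k) = N k - \<Union>(pis0 u k)"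
    unfolding P using * by blast+
qed

lemma families_pis0: "families (pis0 u)"
  unfolding families_def by (intro ballI conjI; rule stage1_props)

lemma rounds_compatible:
  assumes "rounds \<sigma> u s t pis P = Some (pis', P')" "state ps pis P" "T \<in> P'"
  shows "T \<in> P \<or> (\<forall>k\<in>{1..20}. compatible u s k (prefix T k) (T \<inter> N k))"
  using assms(1,2)
proof (induction t arbitrary: pis P)
  case 0
  then show ?case using assms(3) by simp
next
  case (Suc t)
  from Suc.prems(1) obtain cs where cs: "fst (round \<sigma> u s pis P {}) = Some cs"
    "rounds \<sigma> u s t (\<lambda>k. pis k - {cs k}) (insert (union20 cs) P) = Some (pis', P')"
    by (auto split: if_splits option.splits)
  have sel: "selected \<sigma> u s pis P cs j" if "j \<in> {1..20}" for j
    using cs(1) that unfolding round_Some_iff by blast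
  have m: "cs j \<in> pis j" if "j \<in> {1..20}" for j
    by (rule selected_mem[OF state_families[OF Suc.prems(2)] that sel[OF that]])
  have csN: "cs j \<subseteq> N j" if "j \<in> {1..20}" for j
    by (rule familiesD(2)[OF state_families[OF Suc.prems(2)] that m[OF that]])
  have "compatible u s k (prefix (union20 cs) k) (union20 cs \<inter> N k)" if k: "k \<in> {1..20}" for k
  proof -
    have "prefix (union20 cs) k = earlier cs k" by (rule prefix_union20[OF csN k])
    moreover have "union20 cs \<inter> N k = cs k" by (rule union20_Int[OF csN k])
    ultimately show ?thesis using sel[OF k] unfolding selected_def by auto
  qed
  then show ?case using Suc.IH[OF cs(2) state_step(1)[OF Suc.prems(2) m]] by blast
qed

text \<open>For \<open>a\<close> in class k, its own clique contributes at least (s - 1) / 2. The k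
  - 1 earlier classes together cost at most (k - 1) s / 80, by the test made when class k was
  chosen; each of the 20 - k later classes costs at most s / 80, by the test made when that class
  was chosen. The losses add up to 19 s / 80 whatever k is.\<close>

lemma formed_utility:
  assumes st: "state ps pis P" and T: "T \<in> P" and comp: "\<And>k. k \<in> {1..20} \<Longrightarrow> compatible u s k (prefix T k) (T \<inter> N k)"
    and cl: "\<And>k C. k \<in> {1..20} \<Longrightarrow> C \<in> ps k \<Longrightarrow> clique u C" and a: "a \<in> T"
  shows "(real s - 1) / 2 - 19 * real s / 80 \<le> util u a T"
proof -
  have Tn: "T \<subseteq> {0..<n}" by (rule stateD(4)[OF st T])
  then have Tu: "T = (\<Union>j\<in>{1..20}. T \<inter> N j)" using N_union by blast
  then obtain k where k: "k \<in> {1..20}" "a \<in> N k" using a by blast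
  have fin: "finite (T \<inter> N j)" for j using Tn finite_subset[of T "{0..<n}"] by auto
  have dj: "(T \<inter> N i) \<inter> (T \<inter> N j) = {}" if "i \<in> {1..20}" "j \<in> {1..20}" "i \<noteq> j" for i j
    using N_disjoint[OF that] by blast
  let ?f = "\<lambda>j. util u a (T \<inter> N j)"
  have "util u a T = util u a (\<Union>j\<in>{1..20}. T \<inter> N j)" using Tu by (rule arg_cong)
  also have "\<dots> = (\<Sum>j\<in>{1..20}. ?f j)" by (rule util_UNION) (use fin dj in auto)
  also have "{1..20} = {1..<k} \<union> ({k} \<union> {k<..20})" using k(1) by auto
  also have "(\<Sum>j\<in>{1..<k} \<union> ({k} \<union> {k<..20}). ?f j) = (\<Sum>j\<in>{1..<k}. ?f j) + (?f k + (\<Sum>j\<in>{k<..20}. ?f j))"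
    by (subst sum.union_disjoint, simp, simp, force, subst sum.union_disjoint) auto
  finally have eq: "util u a T = (\<Sum>j\<in>{1..<k}. ?f j) + (?f k + (\<Sum>j\<in>{k<..20}. ?f j))" .
  have "(\<Sum>j\<in>{1..<k}. ?f j) = util u a (\<Union>j\<in>{1..<k}. T \<inter> N j)"
  proof (rule util_UNION[symmetric])
    fix i j assume "i \<in> {1..<k}" "j \<in> {1..<k}" "i \<noteq> j"
    then show "(T \<inter> N i) \<inter> (T \<inter> N j) = {}" using k(1) by (intro dj) auto
  qed (use fin in auto)
  also have "(\<Union>j\<in>{1..<k}. T \<inter> N j) = prefix T k" unfolding prefix_def by blast
  \<comment> \<open>Both clauses of \<open>compatible\<close> stand under a common quantifier over
    the prefix, so for an empty prefix they say nothing; the utility is then an empty sum.\<close>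
  also have "util u a (prefix T k) \<ge> - (real (k - 1) * real s / 80)"
  proof (cases "prefix T k = {}")
    case True
    then show ?thesis by (simp add: util_def)
  next
    case False
    have "a \<in> T \<inter> N k" using a k(2) by blast
    then show ?thesis using comp[OF k(1)] False unfolding compatible_def by blast
  qed
  finally have 1: "- (real (k - 1) * real s / 80) \<le> (\<Sum>j\<in>{1..<k}. ?f j)" .
  have "T \<inter> N k \<in> ps k" using state_part[OF st T k(1)] by blast
  then have cq: "clique u (T \<inter> N k)" by (rule cl[OF k(1)])
  have "card ((T \<inter> N k) - {a}) * (1/2) \<le> ?f k"
  proof (rule util_bounds[OF fin])
    fix b assume "b \<in> T \<inter> N k" "b \<noteq> a"
    then show "1/2 \<le> u a b"
      using cq[unfolded clique_def, rule_format, of a b] a k(2) by simp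
  qed
  moreover have "card ((T \<inter> N k) - {a}) = s - 1"
    using state_part_card[OF st T k(1)] a k(2) fin by simp
  ultimately have 2: "(real s - 1) / 2 \<le> ?f k" using s_pos by (simp add: of_nat_diff)
  have "(\<Sum>j\<in>{k<..20}. - (real s / 80)) \<le> (\<Sum>j\<in>{k<..20}. ?f j)"
  proof (rule sum_mono)
    fix j assume "j \<in> {k<..20::nat}"
    then have j: "j \<in> {1..20}" "k \<in> {1..<j}" using k(1) by auto
    have "a \<in> prefix T j" using a k(2) j(2) unfolding prefix_def by blast
    moreover have "T \<inter> N j \<noteq> {}" using state_part_card[OF st T j(1)] s_pos by (metis card.empty less_irrefl)
    ultimately show "- (real s / 80) \<le> ?f j" using comp[OF j(1)] unfolding compatible_def by blast
  qed
  then have 3: "- (real (20 - k) * (real s / 80)) \<le> (\<Sum>j\<in>{k<..20}. ?f j)" by simp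
  have "real (k - 1) * real s / 80 + real (20 - k) * (real s / 80) = 19 * real s / 80"
    using k(1) by (simp add: of_nat_diff field_simps)
  then show ?thesis using eq 1 2 3 by linarith
qed

text \<open>Here \<open>D\<close> is the clique of class \<open>k\<close> containing \<open>x\<close>, or empty if \<open>x\<close> was left over by Stage 1. If \<open>D\<close>
  is compatible with the prefix of \<open>T\<close> but was not chosen, then it was not scanned when \<open>T\<close> was
  formed, so no pair between \<open>x\<close> and \<open>T\<close> has been read.\<close>

definition good :: "utility \<Rightarrow> nat \<Rightarrow> nat set \<Rightarrow> nat \<Rightarrow> nat set \<Rightarrow> bool" where
  "good u x D k T \<longleftrightarrow> compatible u s k (prefix T k) D \<and> real s \<le> util u x (T - N k)"

definition placeable :: "utility \<Rightarrow> (nat \<times> nat) set \<Rightarrow> nat \<Rightarrow> nat set \<Rightarrow> bool" where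
  "placeable u chk x C \<longleftrightarrow> util u x C > 0 \<and> (\<forall>b\<in>C. (x, b) \<notin> chk \<and> (b, x) \<notin> chk)"

text \<open>Placing one agent uses up one coalition, so every other agent loses at most one
  candidate while the number of waiting agents drops by one. The inequality between candidates and
  waiting agents is thus preserved, and any order of selection works. \<open>A\<close> is the set of
  agents already covered and grows along the way.\<close>

lemma stage3_succeeds:
  assumes "finite U" "finite Q" "card Q \<le> f" "\<And>x. x \<in> Q \<Longrightarrow> card Q \<le> card {C\<in>U. placeable u chk x C}"
    "partition_on A (U \<union> D)" "U \<inter> D = {}" "A \<inter> Q = {}"
  shows "\<exists>\<pi>. stage3 \<sigma> u chk f U D Q = Some \<pi> \<and> partition_on (A \<union> Q) \<pi> \<and>
     (\<forall>B\<in>\<pi>. B \<in> U \<union> D \<or> (\<exists>C\<in>U. \<exists>x\<in>Q. B = insert x C \<and> util u x C > 0))"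
  using assms
proof (induction f arbitrary: U D Q A)
  case 0
  then show ?case by auto
next
  case (Suc f)
  show ?case
  proof (cases "Q = {}")
    case True
    then show ?thesis using Suc.prems by auto
  next
    case False
    define xx where "xx = selX \<sigma> U D Q"
    define cands where "cands = {C \<in> U. util u xx C > 0 \<and> (\<forall>b\<in>C. (xx, b) \<notin> chk \<and> (b, xx) \<notin> chk)}"
    have x: "xx \<in> Q" unfolding xx_def by (rule selX[OF Suc.prems(2) False])
    have ce: "cands = {C\<in>U. placeable u chk xx C}" by (simp add: placeable_def cands_def)
    have "0 < card Q" using False Suc.prems(2) by (simp add: card_gt_0_iff)
    then have ne: "cands \<noteq> {}" using Suc.prems(4)[OF x] unfolding ce by (metis card.empty leD)
    define CC where "CC = selC \<sigma> xx U D cands"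
    have C: "CC \<in> cands" unfolding CC_def by (rule selC) (use Suc.prems(1) ne in \<open>auto simp: cands_def\<close>)
    then have CU: "CC \<in> U" and Cx: "util u xx CC > 0" by (auto simp: cands_def)
    have xA: "xx \<notin> A" using x Suc.prems(7) by blast
    have UA: "B \<subseteq> A" if "B \<in> U \<union> D" for B using Suc.prems(5) that unfolding partition_on_def by blast
    have nU: "insert xx CC \<notin> U" using UA xA by blast
    have "\<exists>\<pi>. stage3 \<sigma> u chk f (U - {CC}) (insert (insert xx CC) D) (Q - {xx}) = Some \<pi> \<and>
      partition_on (insert xx A \<union> (Q - {xx})) \<pi> \<and>
      (\<forall>B\<in>\<pi>. B \<in> (U - {CC}) \<union> insert (insert xx CC) D \<or>
         (\<exists>C\<in>U - {CC}. \<exists>x\<in>Q - {xx}. B = insert x C \<and> util u x C > 0))"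
    proof (rule Suc.IH)
      show "finite (U - {CC})" "finite (Q - {xx})" "card (Q - {xx}) \<le> f"
        using Suc.prems(1-3) x by auto
      show "partition_on (insert xx A) ((U - {CC}) \<union> insert (insert xx CC) D)"
      proof -
        have "(U - {CC}) \<union> insert (insert xx CC) D = insert (insert xx CC) ((U \<union> D) - {CC})"
          using CU Suc.prems(6) by blast
        then show ?thesis using partition_on_extend[OF Suc.prems(5) _ xA, of CC] CU by simp
      qed
      show "(U - {CC}) \<inter> insert (insert xx CC) D = {}" using nU Suc.prems(6) by blast
      show "insert xx A \<inter> (Q - {xx}) = {}" using Suc.prems(7) by blast
      fix y assume y: "y \<in> Q - {xx}"
      have e: "{C\<in>U - {CC}. placeable u chk y C} = {C\<in>U. placeable u chk y C} - {CC}" by blast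
      have "card {C\<in>U. placeable u chk y C} - 1 \<le> card ({C\<in>U. placeable u chk y C} - {CC})"
        by (simp add: card_Diff_singleton_if)
      moreover have "card Q \<le> card {C\<in>U. placeable u chk y C}" using y by (intro Suc.prems(4)) auto
      moreover have "card (Q - {xx}) = card Q - 1" using x Suc.prems(2) by simp
      ultimately show "card (Q - {xx}) \<le> card {C\<in>U - {CC}. placeable u chk y C}"
        unfolding e by linarith
    qed
    then obtain \<pi> where \<pi>: "stage3 \<sigma> u chk f (U - {CC}) (insert (insert xx CC) D) (Q - {xx}) = Some \<pi>"
      "partition_on (insert xx A \<union> (Q - {xx})) \<pi>"
      "\<forall>B\<in>\<pi>. B \<in> (U - {CC}) \<union> insert (insert xx CC) D \<or>
         (\<exists>C\<in>U - {CC}. \<exists>x\<in>Q - {xx}. B = insert x C \<and> util u x C > 0)" by (elim exE conjE)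
    have "stage3 \<sigma> u chk (Suc f) U D Q = Some \<pi>"
      using \<pi>(1) False ne unfolding CC_def cands_def xx_def by (simp only: stage3.simps Let_def if_False)
    moreover have "insert xx A \<union> (Q - {xx}) = A \<union> Q" using x by blast
    moreover have "B \<in> U \<union> D \<or> (\<exists>C\<in>U. \<exists>x\<in>Q. B = insert x C \<and> util u x C > 0)" if "B \<in> \<pi>" for B
      using bspec[OF \<pi>(3) that] CU Cx x by blast
    ultimately show ?thesis using \<pi>(2) by auto
  qed
qed

lemma families_union_card:
  assumes "families pis" "k \<in> {1..20}"
  shows "card (\<Union>(pis k)) = s * card (pis k)"
proof -
  have "finite C" if "C \<in> pis k" for C
    using familiesD(2)[OF assms that] N_finite[OF assms(2)] finite_subset by blast
  then have "card (\<Union>(pis k)) = (\<Sum>C\<in>pis k. card C)"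
    by (intro card_Union_disjoint familiesD(1)[OF assms])
  also have "\<dots> = (\<Sum>C\<in>pis k. s)" by (rule sum.cong[OF refl]) (rule familiesD(3)[OF assms])
  finally show ?thesis by (simp add: mult.commute)
qed

lemma run_alg_eq:
  assumes "stage2_loop \<sigma> u s (Suc (card (pis0 u 1))) (pis0 u) {} {} = (pisF, P, chk)"
  defines "R \<equiv> (\<Union>k\<in>{1..20}. N k - \<Union>(pis0 u k)) \<union> (\<Union>k\<in>{1..20}. \<Union>(pisF k))"
  shows "run_alg n \<sigma> u = stage3 \<sigma> u chk (card R) P {} R"
proof -
  let ?pis = "\<lambda>k. fst (stage1 \<sigma> u n k)"
  have p: "pis0 u k = ?pis k" if "k \<in> {1..20}" for k using that by (simp add: pis0_def)
  have p1: "?pis 1 = pis0 u 1" by (simp add: pis0_def)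
  obtain pisG P' chk' where g: "stage2_loop \<sigma> u s (Suc (card (pis0 u 1))) ?pis {} {} = (pisG, P', chk')"
    by (metis prod_cases3)
  have "snd (stage2_loop \<sigma> u s (Suc (card (pis0 u 1))) (pis0 u) {} {}) = snd (stage2_loop \<sigma> u s (Suc (card (pis0 u 1))) ?pis {} {})
     \<and> (\<forall>k\<in>{1..20}. fst (stage2_loop \<sigma> u s (Suc (card (pis0 u 1))) (pis0 u) {} {}) k
         = fst (stage2_loop \<sigma> u s (Suc (card (pis0 u 1))) ?pis {} {}) k)"
    by (rule stage2_cong[OF _ families_pis0 p]) (simp add: same_compat_def)
  then have eq: "P' = P" "chk' = chk" "\<And>k. k \<in> {1..20} \<Longrightarrow> pisG k = pisF k"
    unfolding g assms(1) by simp_all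
  have R1: "(\<Union>i\<in>{1..20}. snd (stage1 \<sigma> u n i)) = (\<Union>k\<in>{1..20}. N k - \<Union>(pis0 u k))"
    by (rule SUP_cong[OF refl]) (rule stage1_props(5))
  have R2: "(\<Union>k\<in>{1..20}. \<Union>(pisG k)) = (\<Union>k\<in>{1..20}. \<Union>(pisF k))"
    by (rule SUP_cong[OF refl]) (simp only: eq(3))
  show ?thesis
    unfolding run_alg_def Let_def p1 g fst_conv snd_conv R1 R2 eq(1,2) R_def[symmetric] by (rule refl)
qed

text \<open>Isolates what probability has to deliver: few agents outside cliques
  (\<open>H1\<close>), no failing round before some class is nearly exhausted (\<open>H2\<close>),
  many good coalitions for each unmerged agent (\<open>H3\<close>), and an objector in each merged
  coalition against each outsider (\<open>H4\<close>). \<open>H3\<close> speaks of a fixed number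
  \<open>m\<close> of rounds, whereas the loop stops after a random number; coalitions formed after
  round \<open>m\<close> can only add candidates.\<close>

lemma success:
  assumes H0: "\<And>a b. a < n \<Longrightarrow> b < n \<Longrightarrow> a \<noteq> b \<Longrightarrow> \<bar>u a b\<bar> < 1"
    and H1: "\<And>k. k \<in> {1..20} \<Longrightarrow> card (N k - \<Union>(pis0 u k)) \<le> r0"
    and H2: "\<And>t pis P. rounds \<sigma> u s t (pis0 u) {} = Some (pis, P) \<Longrightarrow> fst (round \<sigma> u s pis P {}) = None \<Longrightarrow>
        \<exists>k\<in>{1..20}. card (pis k) \<le> l"
    and H3: "\<And>pis P k x D. rounds \<sigma> u s m (pis0 u) {} = Some (pis, P) \<Longrightarrow> k \<in> {1..20} \<Longrightarrow> x \<in> N k \<Longrightarrow>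
        D \<in> pis k \<and> x \<in> D \<or> D = {} \<and> x \<notin> \<Union>(pis0 u k) \<Longrightarrow> r \<le> card {T\<in>P. good u x D k T}"
    and H4: "\<And>t pis P T a. rounds \<sigma> u s t (pis0 u) {} = Some (pis, P) \<Longrightarrow> T \<in> P \<Longrightarrow> a < n \<Longrightarrow> a \<notin> T \<Longrightarrow>
        \<exists>b\<in>T. u b a < 0"
    and m: "m * s + r0 + s * l \<le> n div 20" and r: "20 * (1 + 2 * r0 + s * l) \<le> r" and s6: "6 \<le> s"
  shows "outputs_IS n \<sigma> u"
proof -
  let ?p = "pis0 u"
  note fam = families_pis0[of u]
  note st0 = state_init[OF fam]
  obtain pisF P chk where F: "stage2_loop \<sigma> u s (Suc (card (?p 1))) ?p {} {} = (pisF, P, chk)"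
    by (metis prod_cases3)
  define R1 where "R1 = (\<Union>k\<in>{1..20}. N k - \<Union>(?p k))"
  define R2 where "R2 = (\<Union>k\<in>{1..20}. \<Union>(pisF k))"
  define R where "R = R1 \<union> R2"
  \<comment> \<open>Covers all reads of Stage 2: from a prefix of a merged coalition to the
    coalition itself or to a rejected clique, and among the agents left over by Stage 2, where a
    failing round takes place.\<close>
  define Rd where "Rd = (\<lambda>a b. (\<exists>T\<in>P. \<exists>k\<in>{1..20}. a \<in> prefix T k \<and>
      (b \<in> T \<or> (\<exists>D\<in>?p k. b \<in> D \<and> \<not> compatible u s k (prefix T k) D))) \<or> (a \<in> R2 \<and> b \<in> R2))"
  have "(\<exists>t\<le>Suc (card (?p 1)). rounds \<sigma> u s t ?p {} = Some (pisF, P) \<and>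
      (t = Suc (card (?p 1)) \<or> pisF 1 = {} \<or> fst (round \<sigma> u s pisF P {}) = None)) \<and> (\<forall>(a,b)\<in>chk. Rd a b)"
  proof (rule stage2_rounds[OF F st0])
    show "Rd a b" if "T \<in> P" "k \<in> {1..20}" "a \<in> prefix T k"
      "b \<in> T \<or> (b \<in> D \<and> D \<in> ?p k \<and> \<not> compatible u s k (prefix T k) D)" for T k a b D
      unfolding Rd_def using that by blast
    show "Rd a b" if "a \<in> (\<Union>k\<in>{1..20}. \<Union>(pisF k))" "b \<in> (\<Union>k\<in>{1..20}. \<Union>(pisF k))" for a b
      unfolding Rd_def R2_def using that by blast
  qed simp
  then obtain t where t: "rounds \<sigma> u s t ?p {} = Some (pisF, P)"
      "t = Suc (card (?p 1)) \<or> pisF 1 = {} \<or> fst (round \<sigma> u s pisF P {}) = None"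
    and chk: "\<And>a b. (a, b) \<in> chk \<Longrightarrow> Rd a b" by blast
  have st: "state ?p pisF P" and cP: "card P = t"
    using rounds_state[OF t(1) st0] by simp_all
  have ct: "card (pisF k) + t = card (?p k)" if "k \<in> {1..20}" for k
    using state_card[OF st that] cP by simp
  have famF: "families pisF" by (rule state_families[OF st])
  have "\<exists>k\<in>{1..20}. card (pisF k) \<le> l"
  proof (cases "pisF 1 = {}")
    case True
    then show ?thesis by (intro bexI[of _ 1]) simp_all
  next
    case False
    have "t \<noteq> Suc (card (?p 1))" using ct[of 1] by simp
    with t(2) False have "fst (round \<sigma> u s pisF P {}) = None" by (elim disjE) simp_all
    then show ?thesis by (rule H2[OF t(1)])
  qed
  then obtain k0 where k0: "k0 \<in> {1..20}" "card (pisF k0) \<le> l" by blast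
  have cN: "card (N k) = s * card (?p k) + card (N k - \<Union>(?p k))" if k: "k \<in> {1..20}" for k
  proof -
    have sub: "\<Union>(?p k) \<subseteq> N k" using familiesD(2)[OF fam k] by blast
    have "card (N k - \<Union>(?p k)) = card (N k) - card (\<Union>(?p k))"
      by (rule card_Diff_subset[OF finite_subset[OF sub N_finite[OF k]] sub])
    moreover have "card (\<Union>(?p k)) \<le> card (N k)" by (rule card_mono[OF N_finite[OF k] sub])
    ultimately show ?thesis using families_union_card[OF fam k] by simp
  qed
  have Nb: "n div 20 \<le> card (N k)" "card (N k) \<le> n div 20 + 1" if "k \<in> {1..20}" for k
    using N_card[OF that] by auto
  \<comment> \<open>Class \<open>k0\<close> has at most \<open>l\<close> free cliques and
    \<open>r0\<close> agents outside cliques; all its other agents have been merged,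
    \<open>s\<close> of them in each of the \<open>t\<close> rounds. This bounds the number of
    rounds from below.\<close>
  have st_lower: "n div 20 \<le> s * t + r0 + s * l"
  proof -
    have "n div 20 \<le> s * card (?p k0) + r0" using cN[OF k0(1)] Nb(1)[OF k0(1)] H1[OF k0(1)] by linarith
    also have "s * card (?p k0) = s * card (pisF k0) + s * t" using ct[OF k0(1)] by (metis add_mult_distrib2)
    also have "s * card (pisF k0) \<le> s * l" using k0(2) by simp
    finally show ?thesis by linarith
  qed
  have "m * s \<le> t * s" using st_lower m unfolding mult.commute[of s t] by linarith
  then have mt: "m \<le> t" using s_pos by simp
  have finP: "finite P" by (rule stateD(2)[OF st])
  have R1k: "finite (N k - \<Union>(?p k))" "finite (\<Union>(pisF k))" if "k \<in> {1..20}" for k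
  proof -
    have "\<Union>(pisF k) \<subseteq> N k" using familiesD(2)[OF famF that] by blast
    then show "finite (\<Union>(pisF k))" using N_finite[OF that] by (rule finite_subset)
    show "finite (N k - \<Union>(?p k))" using N_finite[OF that] by (rule finite_Diff)
  qed
  have finR: "finite R" unfolding R_def R1_def R2_def by (intro finite_UnI finite_UN_I finite_atLeastAtMost R1k)
  have cR: "card R \<le> r"
  proof -
    have "card R \<le> card R1 + card R2" unfolding R_def by (rule card_Un_le)
    also have "card R1 \<le> (\<Sum>k\<in>{1..20::nat}. card (N k - \<Union>(?p k)))"
      unfolding R1_def by (rule card_UN_le) simp
    also have "\<dots> \<le> (\<Sum>k\<in>{1..20::nat}. r0)" by (rule sum_mono) (rule H1)
    also have "card R2 \<le> (\<Sum>k\<in>{1..20::nat}. card (\<Union>(pisF k)))"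
      unfolding R2_def by (rule card_UN_le) simp
    \<comment> \<open>Every round takes \<open>s\<close> agents from every class, so the bound on
      \<open>t\<close> limits the remainder of all classes; the additional 1 accounts for class
      sizes that differ by one.\<close>
    also have "\<dots> \<le> (\<Sum>k\<in>{1..20::nat}. 1 + r0 + s * l)"
    proof (rule sum_mono)
      fix k assume k: "k \<in> {1..20::nat}"
      have "s * card (?p k) = s * card (pisF k) + s * t" using ct[OF k] by (metis add_mult_distrib2)
      then show "card (\<Union>(pisF k)) \<le> 1 + r0 + s * l"
        using cN[OF k] Nb(2)[OF k] st_lower families_union_card[OF famF k] by linarith
    qed
    finally have "card R \<le> 20 * r0 + 20 * (1 + r0 + s * l)" by simp
    then show ?thesis using r by simp
  qed
  have PR: "\<Union>P \<inter> R = {}"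
  proof (rule ccontr)
    assume "\<Union>P \<inter> R \<noteq> {}"
    then obtain x T where x: "T \<in> P" "x \<in> T" "x \<in> R" by blast
    then consider k where "k \<in> {1..20}" "x \<in> N k" "x \<notin> \<Union>(?p k)" | k C where "k \<in> {1..20}" "C \<in> pisF k" "x \<in> C"
      unfolding R_def R1_def R2_def by blast
    then show False
    proof cases
      case 1
      then show ?thesis using state_part[OF st x(1) 1(1)] x(2) by blast
    next
      case 2
      then show ?thesis using state_disjoint_rest[OF st 2(1,2) x(1)] x(2) by blast
    qed
  qed
  have PRu: "\<Union>P \<union> R = {0..<n}"
  proof (rule subset_antisym)
    show "\<Union>P \<union> R \<subseteq> {0..<n}"
    proof
      fix x assume "x \<in> \<Union>P \<union> R"
      then consider T where "T \<in> P" "x \<in> T" | k where "k \<in> {1..20}" "x \<in> N k"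
        | k C where "k \<in> {1..20}" "C \<in> pisF k" "x \<in> C" unfolding R_def R1_def R2_def by blast
      then show "x \<in> {0..<n}"
      proof cases
        case 1
        then show ?thesis using stateD(4)[OF st 1(1)] by blast
      next
        case 2
        then show ?thesis using N_subset[OF 2(1)] by blast
      next
        case 3
        then show ?thesis using N_subset[OF 3(1)] familiesD(2)[OF famF 3(1,2)] by blast
      qed
    qed
    show "{0..<n} \<subseteq> \<Union>P \<union> R"
    proof
      fix x assume "x \<in> {0..<n}"
      then obtain k where k: "k \<in> {1..20}" "x \<in> N k" unfolding N_union[symmetric] by blast
      show "x \<in> \<Union>P \<union> R"
      proof (cases "x \<in> \<Union>(?p k)")
        case False
        then show ?thesis unfolding R_def R1_def using k by blast
      next
        case True
        then obtain C where C: "C \<in> ?p k" "x \<in> C" by blast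
        then have "C \<in> pisF k \<or> C \<in> (\<lambda>T. T \<inter> N k) ` P" using stateD(6)[OF st k(1)] by blast
        then show ?thesis unfolding R_def R2_def using C(2) k(1) by blast
      qed
    qed
  qed
  have partP: "partition_on (\<Union>P) P"
  proof (rule partition_onI)
    show "\<Union>P = \<Union>P" by (rule refl)
    show "disjnt p q" if "p \<in> P" "q \<in> P" "p \<noteq> q" for p q by (rule pairwiseD[OF stateD(3)[OF st] that])
    show "{} \<notin> P" using state_part_card[OF st, of "{}" 1] s_pos by auto
  qed
  have plc: "card R \<le> card {T\<in>P. placeable u chk x T}" if x: "x \<in> R" for x
  proof -
    obtain k D where k: "k \<in> {1..20}" "x \<in> N k" and D: "D \<in> pisF k \<and> x \<in> D \<or> D = {} \<and> x \<notin> \<Union>(?p k)"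
    proof -
      from x consider k where "k \<in> {1..20}" "x \<in> N k" "x \<notin> \<Union>(?p k)" | k C where "k \<in> {1..20}" "C \<in> pisF k" "x \<in> C"
        unfolding R_def R1_def R2_def by blast
      then show ?thesis
      proof cases
        case 1
        then show ?thesis using that[of k "{}"] by blast
      next
        case 2
        then show ?thesis using that[of k C] familiesD(2)[OF famF 2(1,2)] by blast
      qed
    qed
    \<comment> \<open>The history is cut after round \<open>m\<close>. A clique that is free at the
      end was free then, so \<open>H3\<close> applies to it.\<close>
    have "rounds \<sigma> u s (m + (t - m)) ?p {} = Some (pisF, P)" using t(1) mt by simp
    then obtain pism Pm where pm: "rounds \<sigma> u s m ?p {} = Some (pism, Pm)"
      "rounds \<sigma> u s (t - m) pism Pm = Some (pisF, P)" by (rule rounds_add)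
    have stm: "state ?p pism Pm" using rounds_state[OF pm(1) st0] by blast
    have sub: "Pm \<subseteq> P" "pisF k \<subseteq> pism k" using rounds_state[OF pm(2) stm] k(1) by blast+
    have "r \<le> card {T\<in>Pm. good u x D k T}"
      by (rule H3[OF pm(1) k]) (use D sub in blast)
    also have "\<dots> \<le> card {T\<in>P. placeable u chk x T}"
    proof (rule card_mono)
      show "finite {T\<in>P. placeable u chk x T}" using finP by simp
      show "{T\<in>Pm. good u x D k T} \<subseteq> {T\<in>P. placeable u chk x T}"
      proof
        fix T assume "T \<in> {T\<in>Pm. good u x D k T}"
        then have T: "T \<in> P" and g: "good u x D k T" using sub by auto
        have Tn: "T \<subseteq> {0..<n}" by (rule stateD(4)[OF st T])
        have xT: "x \<notin> T" using PR T x by blast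
        have xn: "x < n" using x PRu by auto
        have fT: "finite (T - N k)" "finite (T \<inter> N k)" using Tn finite_subset[of T "{0..<n}"] by auto
        have pos: "util u x T > 0"
        proof -
          have "T = (T - N k) \<union> (T \<inter> N k)" by blast
          then have "util u x T = util u x ((T - N k) \<union> (T \<inter> N k))" by (rule arg_cong)
          also have "\<dots> = util u x (T - N k) + util u x (T \<inter> N k)"
            by (rule util_union[OF fT]) blast
          finally have e: "util u x T = util u x (T - N k) + util u x (T \<inter> N k)" .
          \<comment> \<open>The \<open>s\<close> members in the class of \<open>x\<close> contribute
            more than -s, since every utility exceeds -1, while \<open>good\<close> guarantees at
            least s from the other classes.\<close>
          have "(\<Sum>b\<in>T \<inter> N k. (- 1::real)) < (\<Sum>b\<in>T \<inter> N k. u x b)"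
          proof (rule sum_strict_mono[OF fT(2)])
            show "T \<inter> N k \<noteq> {}" using state_part_card[OF st T k(1)] s_pos by auto
            fix b assume b: "b \<in> T \<inter> N k"
            then have "b < n" "x \<noteq> b" using Tn xT by auto
            then show "- 1 < u x b" using H0[OF xn, of b] by auto
          qed
          moreover have "T \<inter> N k - {x} = T \<inter> N k" using xT by blast
          ultimately have "- real s < util u x (T \<inter> N k)"
            using state_part_card[OF st T k(1)] by (simp add: util_def)
          then show ?thesis using e g unfolding good_def by linarith
        qed
        have inT: "T' = T" if "T' \<in> P" "b \<in> T" "b \<in> T'" for T' b
          using disjointD[OF stateD(3)[OF st] that(1) T] that by blast
        have nR2: "b \<notin> R2" if "b \<in> T" for b using PR T that unfolding R_def by blast
        have pre: "prefix T' j \<subseteq> T'" for T' j unfolding prefix_def by blast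
        have "\<not> Rd x b \<and> \<not> Rd b x" if b: "b \<in> T" for b
        proof
          have "x \<notin> \<Union>P" using PR x by blast
          then have "x \<notin> T'" if "T' \<in> P" for T' using that by blast
          then show "\<not> Rd x b" unfolding Rd_def using nR2[OF b] pre by blast
          show "\<not> Rd b x"
          proof
            assume "Rd b x"
            then obtain T' j where T': "T' \<in> P" "j \<in> {1..20}" "b \<in> prefix T' j"
              "x \<in> T' \<or> (\<exists>D\<in>?p j. x \<in> D \<and> \<not> compatible u s j (prefix T' j) D)"
              unfolding Rd_def using nR2[OF b] by blast
            have "T' = T" by (rule inT[OF T'(1) b]) (use T'(3) pre in blast)
            then obtain D' where D': "D' \<in> ?p j" "x \<in> D'" "\<not> compatible u s j (prefix T j) D'"
              using T'(4) xT by blast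
            have "x \<in> N j" using familiesD(2)[OF fam T'(2) D'(1)] D'(2) by blast
            then have jk: "j = k" using N_disjoint[OF T'(2) k(1)] k(2) by blast
            have "D \<in> ?p k" "x \<in> D" using D D' state_sub[OF st k(1)] jk by blast+
            then have "D' = D" using disjointD[OF familiesD(1)[OF fam k(1)], of D' D] D'(1,2) jk by blast
            then show False using g D'(3) jk unfolding good_def by simp
          qed
        qed
        then show "T \<in> {T\<in>P. placeable u chk x T}"
          using T pos chk unfolding placeable_def by blast
      qed
    qed
    finally show ?thesis using cR by linarith
  qed
  have "\<exists>\<pi>. stage3 \<sigma> u chk (card R) P {} R = Some \<pi> \<and> partition_on (\<Union>P \<union> R) \<pi> \<and>
     (\<forall>B\<in>\<pi>. B \<in> P \<union> {} \<or> (\<exists>C\<in>P. \<exists>x\<in>R. B = insert x C \<and> util u x C > 0))"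
    by (rule stage3_succeeds[OF finP finR order_refl plc]) (use partP PR in simp_all)
  then obtain \<pi> where \<pi>: "stage3 \<sigma> u chk (card R) P {} R = Some \<pi>" "partition_on {0..<n} \<pi>"
    "\<And>B. B \<in> \<pi> \<Longrightarrow> B \<in> P \<or> (\<exists>C\<in>P. \<exists>x\<in>R. B = insert x C \<and> util u x C > 0)"
    unfolding PRu by auto
  have run: "run_alg n \<sigma> u = Some \<pi>"
    using run_alg_eq[OF F] \<pi>(1) unfolding R_def R1_def R2_def by simp
  have ut: "1 \<le> util u a T" if "T \<in> P" "a \<in> T" for a T
  proof -
    have c: "compatible u s k (prefix T k) (T \<inter> N k)" if "k \<in> {1..20}" for k
      using rounds_compatible[OF t(1) st0 \<open>T \<in> P\<close>] that by blast
    have "(real s - 1) / 2 - 19 * real s / 80 \<le> util u a T"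
      by (rule formed_utility[OF st that(1) c stage1_props(4) that(2)])
    \<comment> \<open>The lower bound equals (21 s - 40) / 80, which reaches 1 from s = 6
      on.\<close>
    then show ?thesis using s6 by (simp add: field_simps)
  qed
  have IR: "0 \<le> util u a B" if B: "B \<in> \<pi>" "a \<in> B" for a B
    using \<pi>(3)[OF B(1)]
  proof (elim disjE bexE conjE)
    assume "B \<in> P"
    then show ?thesis using ut[of B a] B(2) by simp
  next
    fix C x assume C: "C \<in> P" "x \<in> R" "B = insert x C" "0 < util u x C"
    have xC: "x \<notin> C" using PR C by blast
    have finC: "finite C" using stateD(4)[OF st C(1)] finite_subset[of C "{0..<n}"] by simp
    show ?thesis
    proof (cases "a = x")
      case True
      then have "util u a B = util u x C" unfolding C(3) util_def using xC by simp
      then show ?thesis using C(4) by simp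
    next
      case False
      then have a: "a \<in> C" using B(2) C(3) by blast
      have an: "a < n" "x < n" using a C stateD(4)[OF st C(1)] PRu by auto
      have "B - {a} = insert x (C - {a})" using C(3) False by blast
      then have "util u a B = u a x + util u a C" unfolding util_def using xC finC by simp
      then show ?thesis using ut[OF C(1) a] H0[OF an False] by linarith
    qed
  qed
  have "individually_stable u {0..<n} \<pi>"
    unfolding individually_stable_def
  proof (rule notI, elim bexE conjE)
    fix a A T
    assume a: "a \<in> {0..<n}" "A \<in> \<pi>" "a \<in> A" and T: "T \<in> insert {} \<pi>" "a \<notin> T"
      and dev: "util u a A < util u a (insert a T)" "favor_out u (insert a T) a = {}"
    show False
    proof (cases "T = {}")
      case True
      then show ?thesis using dev(1) IR[OF a(2,3)] by (simp add: util_def)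
    next
      case False
      \<comment> \<open>A coalition extended in Stage 3 still contains the merged one, and an
        objector of the latter keeps objecting: whether \<open>b\<close> favours the departure of
        \<open>a\<close> is decided by the sign of \<open>u b a\<close> alone.\<close>
      then obtain T0 where T0: "T0 \<in> P" "T0 \<subseteq> T" using T(1) \<pi>(3)[of T] by blast
      have "a \<notin> T0" using T0 T(2) by blast
      then obtain b where b: "b \<in> T0" "u b a < 0" using H4[OF t(1) T0(1), of a] a(1) by auto
      have bT: "b \<in> T" "b \<noteq> a" using b(1) T0 T(2) by blast+
      have "T \<subseteq> {0..<n}" using T(1) \<pi>(2) False unfolding partition_on_def by blast
      then have finT: "finite (T - {b})" using finite_subset[of T "{0..<n}"] by simp
      have "insert a T - {a} - {b} = T - {b}" "(insert a T \<union> {a}) - {b} = insert a (T - {b})"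
        using T(2) bT by blast+
      then have "util u b (insert a T \<union> {a}) = u b a + util u b (insert a T - {a})"
        unfolding util_def using T(2) finT by simp
      then have "b \<in> favor_out u (insert a T) a" unfolding favor_out_def using bT b(2) by simp
      then show ?thesis using dev(2) by blast
    qed
  qed
  then show ?thesis unfolding outputs_IS_def using run \<pi>(2) by blast
qed

section \<open>The space of random utilities\<close>

sublocale uniform_product "pairs n"
  by unfold_locales (rule finite_pairs)

lemma same_clique_ok:
  "(\<And>z. z \<in> C \<Longrightarrow> u w z = u' w z \<and> u z w = u' z w) \<Longrightarrow> clique_ok u C w = clique_ok u' C w"
  unfolding clique_ok_def by simp

lemma util_cong: "(\<And>b. b \<in> C \<Longrightarrow> b \<noteq> a \<Longrightarrow> u a b = u' a b) \<Longrightarrow> util u a C = util u' a C"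
  unfolding util_def by (rule sum.cong) auto

lemma compatible_cong:
  assumes "\<And>a b. a \<in> A \<Longrightarrow> b \<in> C \<Longrightarrow> a \<noteq> b \<Longrightarrow> u a b = u' a b \<and> u b a = u' b a"
  shows "compatible u s k A C = compatible u' s k A C"
proof -
  have "util u a C = util u' a C" if "a \<in> A" for a by (rule util_cong) (use assms that in blast)
  moreover have "util u b A = util u' b A" if "b \<in> C" for b by (rule util_cong) (use assms that in blast)
  ultimately show ?thesis unfolding compatible_def by simp
qed

lemma M_eq: "M = utility_space n"
  unfolding M_def unfolding utility_space_def pairs_def by (rule refl)

section \<open>Measurability and Stage 1\<close>

text \<open>The algorithm accesses the utilities only through these finitely many comparisons, which makes
  every event about its run measurable.\<close>

definition same_cmp :: "utility \<Rightarrow> utility \<Rightarrow> bool" where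
  "same_cmp u u' \<longleftrightarrow>
    (\<forall>C w. C \<subseteq> {0..<n} \<longrightarrow> w < n \<longrightarrow> w \<notin> C \<longrightarrow> clique_ok u C w = clique_ok u' C w) \<and>
    (\<forall>k A C. k \<in> {1..20} \<longrightarrow> A \<subseteq> {0..<n} \<longrightarrow> C \<subseteq> {0..<n} \<longrightarrow> compatible u s k A C = compatible u' s k A C) \<and>
    (\<forall>a A B. a < n \<longrightarrow> A \<subseteq> {0..<n} \<longrightarrow> B \<subseteq> {0..<n} \<longrightarrow>
        (util u a A < util u a B) = (util u' a A < util u' a B)) \<and>
    (\<forall>a A. a < n \<longrightarrow> A \<subseteq> {0..<n} \<longrightarrow> (real s \<le> util u a A) = (real s \<le> util u' a A))"

lemma measurable_util:
  assumes "a < n" "C \<subseteq> {0..<n}"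
  shows "(\<lambda>f. util (curry f) a C) \<in> borel_measurable M"
  unfolding util_def curry_def
proof (rule borel_measurable_sum)
  fix b assume "b \<in> C - {a}"
  then show "(\<lambda>f. f (a, b)) \<in> borel_measurable M"
    by (intro measurable_coord) (use assms in \<open>auto simp: pairs_def\<close>)
qed

lemma measurable_clique_ok:
  assumes "w < n" "C \<subseteq> {0..<n}" "w \<notin> C"
  shows "Measurable.pred M (\<lambda>f. clique_ok (curry f) C w)"
  unfolding clique_ok_def curry_def
proof (rule pred_intros_finite(3))
  show "finite C" using assms(2) finite_subset by blast
  fix z assume z: "z \<in> C"
  have [measurable]: "(\<lambda>f. f (w, z)) \<in> borel_measurable M" "(\<lambda>f. f (z, w)) \<in> borel_measurable M"
    by (intro measurable_coord; use assms z in \<open>auto simp: pairs_def\<close>)+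
  show "Measurable.pred M (\<lambda>f. 1/2 \<le> f (w, z) \<and> 1/2 \<le> f (z, w))" by measurable
qed

lemma measurable_compatible:
  assumes "A \<subseteq> {0..<n}" "C \<subseteq> {0..<n}"
  shows "Measurable.pred M (\<lambda>f. compatible (curry f) s k A C)"
  unfolding compatible_def
proof (intro pred_intros_finite(3))
  show "finite A" "finite C" using assms finite_subset by blast+
  fix a b assume "a \<in> A" "b \<in> C"
  then have [measurable]: "(\<lambda>f. util (curry f) a C) \<in> borel_measurable M" "(\<lambda>f. util (curry f) b A) \<in> borel_measurable M"
    by (intro measurable_util; use assms in auto)+
  show "Measurable.pred M (\<lambda>f. - (real s / 80) \<le> util (curry f) a C \<and> - (real (k - 1) * real s / 80) \<le> util (curry f) b A)"
    by measurable
qed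

text \<open>The elementary comparisons themselves form the finite index set: there are finitely many
  because agents and coalitions range over subsets of a finite set. A predicate of the run is
  measurable as soon as these comparisons determine it.\<close>

lemma measurable_same_cmp:
  assumes "\<And>f g. f \<in> space M \<Longrightarrow> g \<in> space M \<Longrightarrow> same_cmp (curry f) (curry g) \<Longrightarrow> Q f = Q g"
  shows "Measurable.pred M Q"
proof (rule pred_finite_determined)
  let ?S1 = "(\<lambda>(C, w) f. clique_ok (curry f) C w) ` {(C, w). C \<in> Pow {0..<n} \<and> w \<in> {0..<n} \<and> w \<notin> C}"
  let ?S2 = "(\<lambda>(k, A, C) f. compatible (curry f) s k A C) ` ({1..20} \<times> Pow {0..<n} \<times> Pow {0..<n})"
  let ?S3 = "(\<lambda>(a, A, B) f. util (curry f) a A < util (curry f) a B) ` ({0..<n} \<times> Pow {0..<n} \<times> Pow {0..<n})"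
  let ?S4 = "(\<lambda>(a, A) f. real s \<le> util (curry f) a A) ` ({0..<n} \<times> Pow {0..<n})"
  have "finite {(C, w). C \<in> Pow {0..<n} \<and> w \<in> {0..<n} \<and> w \<notin> C}"
    by (rule finite_subset[of _ "Pow {0..<n} \<times> {0..<n}"]) auto
  then show "finite (?S1 \<union> ?S2 \<union> ?S3 \<union> ?S4)" by simp
  fix q assume "q \<in> ?S1 \<union> ?S2 \<union> ?S3 \<union> ?S4"
  then show "Measurable.pred M (\<lambda>f. q f)"
  proof (elim UnE imageE; clarsimp)
    fix C w assume "C \<subseteq> {0..<n}" "w < n" "w \<notin> C"
    then show "Measurable.pred M (\<lambda>f. clique_ok (curry f) C w)" by (intro measurable_clique_ok)
  next
    fix k A C assume "A \<subseteq> {0..<n}" "C \<subseteq> {0..<n}"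
    then show "Measurable.pred M (\<lambda>f. compatible (curry f) s k A C)" by (intro measurable_compatible)
  next
    fix a A B assume "a < n" "A \<subseteq> {0..<n}" "B \<subseteq> {0..<n}"
    note [measurable] = measurable_util[OF this(1,2)] measurable_util[OF this(1,3)]
    show "Measurable.pred M (\<lambda>f. util (curry f) a A < util (curry f) a B)" by measurable
  next
    fix a A assume "a < n" "A \<subseteq> {0..<n}"
    note [measurable] = measurable_util[OF this]
    show "Measurable.pred M (\<lambda>f. real s \<le> util (curry f) a A)" by measurable
  qed
next
  fix f g assume fg: "f \<in> space M" "g \<in> space M"
  let ?S1 = "(\<lambda>(C, w) f. clique_ok (curry f) C w) ` {(C, w). C \<in> Pow {0..<n} \<and> w \<in> {0..<n} \<and> w \<notin> C}"
  let ?S2 = "(\<lambda>(k, A, C) f. compatible (curry f) s k A C) ` ({1..20} \<times> Pow {0..<n} \<times> Pow {0..<n})"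
  let ?S3 = "(\<lambda>(a, A, B) f. util (curry f) a A < util (curry f) a B) ` ({0..<n} \<times> Pow {0..<n} \<times> Pow {0..<n})"
  let ?S4 = "(\<lambda>(a, A) f. real s \<le> util (curry f) a A) ` ({0..<n} \<times> Pow {0..<n})"
  assume q: "\<forall>q\<in>?S1 \<union> ?S2 \<union> ?S3 \<union> ?S4. q f = q g"
  have "clique_ok (curry f) C w = clique_ok (curry g) C w" if "C \<subseteq> {0..<n}" "w < n" "w \<notin> C" for C w
  proof -
    have "(\<lambda>f. clique_ok (curry f) C w) \<in> ?S1"
      using that by (intro image_eqI[of _ _ "(C, w)"]) simp_all
    then show ?thesis using bspec[OF q, of "\<lambda>f. clique_ok (curry f) C w"] by blast
  qed
  moreover have "compatible (curry f) s k A C = compatible (curry g) s k A C"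
    if "k \<in> {1..20}" "A \<subseteq> {0..<n}" "C \<subseteq> {0..<n}" for k A C
  proof -
    have "(\<lambda>f. compatible (curry f) s k A C) \<in> ?S2"
      using that by (intro image_eqI[of _ _ "(k, A, C)"]) simp_all
    then show ?thesis using bspec[OF q, of "\<lambda>f. compatible (curry f) s k A C"] by blast
  qed
  moreover have "(util (curry f) a A < util (curry f) a B) = (util (curry g) a A < util (curry g) a B)"
    if "a < n" "A \<subseteq> {0..<n}" "B \<subseteq> {0..<n}" for a A B
  proof -
    have "(\<lambda>f. util (curry f) a A < util (curry f) a B) \<in> ?S3"
      using that by (intro image_eqI[of _ _ "(a, A, B)"]) simp_all
    then show ?thesis using bspec[OF q, of "\<lambda>f. util (curry f) a A < util (curry f) a B"] by blast
  qed
  moreover have "(real s \<le> util (curry f) a A) = (real s \<le> util (curry g) a A)"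
    if "a < n" "A \<subseteq> {0..<n}" for a A
  proof -
    have "(\<lambda>f. real s \<le> util (curry f) a A) \<in> ?S4"
      using that by (intro image_eqI[of _ _ "(a, A)"]) simp_all
    then show ?thesis using bspec[OF q, of "\<lambda>f. real s \<le> util (curry f) a A"] by blast
  qed
  ultimately have "same_cmp (curry f) (curry g)" unfolding same_cmp_def by simp
  then show "Q f = Q g" by (rule assms[OF fg])
qed

lemma grow_cong:
  assumes "finite L" "C \<inter> L = {}"
    and "\<And>w B. w \<in> L \<Longrightarrow> B \<subseteq> C \<union> L \<Longrightarrow> w \<notin> B \<Longrightarrow> clique_ok u B w = clique_ok u' B w"
  shows "grow \<sigma> u s' i P R f C L = grow \<sigma> u' s' i P R f C L"
  using assms
proof (induction f arbitrary: C L)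
  case (Suc f)
  show ?case
  proof (cases "L = {} \<or> card C \<ge> s'")
    case False
    let ?w = "selW \<sigma> i P R C L" let ?C = "if clique_ok u C ?w then insert ?w C else C"
    have w: "?w \<in> L" by (rule selW) (use Suc.prems(1) False in auto)
    have "?w \<notin> C" using w Suc.prems(2) by blast
    then have ok: "clique_ok u C ?w = clique_ok u' C ?w" by (intro Suc.prems(3)[OF w]) auto
    have "grow \<sigma> u s' i P R f ?C (L - {?w}) = grow \<sigma> u' s' i P R f ?C (L - {?w})"
    proof (rule Suc.IH)
      show "finite (L - {?w})" using Suc.prems(1) by simp
      show "?C \<inter> (L - {?w}) = {}" using Suc.prems(2) by auto
      have "?C \<union> (L - {?w}) \<subseteq> C \<union> L" using w by auto
      then show "clique_ok u B v = clique_ok u' B v" if "v \<in> L - {?w}" "B \<subseteq> ?C \<union> (L - {?w})" "v \<notin> B" for v B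
        using that by (intro Suc.prems(3)) blast+
    qed
    then show ?thesis using False ok by (simp add: Let_def)
  qed auto
qed simp

lemma greedy_cong_ok:
  assumes "finite R" "\<And>w B. w \<in> R \<Longrightarrow> B \<subseteq> R \<Longrightarrow> w \<notin> B \<Longrightarrow> clique_ok u B w = clique_ok u' B w"
  shows "greedy \<sigma> u s' i f P R = greedy \<sigma> u' s' i f P R"
  using assms
proof (induction f arbitrary: P R)
  case (Suc f)
  show ?case
  proof (cases "R = {}")
    case False
    let ?v = "selV \<sigma> i P R"
    have v: "?v \<in> R" by (rule selV) (use Suc.prems(1) False in auto)
    let ?G = "grow \<sigma> u s' i P R (card R) {?v} (R - {?v})"
    have G: "?G = grow \<sigma> u' s' i P R (card R) {?v} (R - {?v})"
    proof (rule grow_cong)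
      show "finite (R - {?v})" using Suc.prems(1) by simp
      fix w B assume "w \<in> R - {?v}" "B \<subseteq> {?v} \<union> (R - {?v})" "w \<notin> B"
      then show "clique_ok u B w = clique_ok u' B w" using v by (intro Suc.prems(2)) auto
    qed simp
    have "greedy \<sigma> u s' i f (insert ?G P) (R - ?G) = greedy \<sigma> u' s' i f (insert ?G P) (R - ?G)"
    proof (rule Suc.IH)
      show "finite (R - ?G)" using Suc.prems(1) by simp
      fix w B assume "w \<in> R - ?G" "B \<subseteq> R - ?G" "w \<notin> B"
      then show "clique_ok u B w = clique_ok u' B w" by (intro Suc.prems(2)) auto
    qed
    then show ?thesis using False G by (simp add: Let_def)
  qed simp
qed simp

lemma same_cmpD:
  assumes "same_cmp u u'"
  shows same_cmp_clique: "C \<subseteq> {0..<n} \<Longrightarrow> w < n \<Longrightarrow> w \<notin> C \<Longrightarrow> clique_ok u C w = clique_ok u' C w"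
    and same_cmp_compatible: "k \<in> {1..20} \<Longrightarrow> A \<subseteq> {0..<n} \<Longrightarrow> C \<subseteq> {0..<n} \<Longrightarrow>
      compatible u s k A C = compatible u' s k A C"
    and same_cmp_util: "a < n \<Longrightarrow> A \<subseteq> {0..<n} \<Longrightarrow> B \<subseteq> {0..<n} \<Longrightarrow>
        (util u a A < util u a B) = (util u' a A < util u' a B)"
    and same_cmp_util_ge: "a < n \<Longrightarrow> A \<subseteq> {0..<n} \<Longrightarrow> (real s \<le> util u a A) = (real s \<le> util u' a A)"
proof -
  note * = assms[unfolded same_cmp_def]
  show "C \<subseteq> {0..<n} \<Longrightarrow> w < n \<Longrightarrow> w \<notin> C \<Longrightarrow> clique_ok u C w = clique_ok u' C w"
    by (rule *[THEN conjunct1, rule_format])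
  show "k \<in> {1..20} \<Longrightarrow> A \<subseteq> {0..<n} \<Longrightarrow> C \<subseteq> {0..<n} \<Longrightarrow> compatible u s k A C = compatible u' s k A C"
    by (rule *[THEN conjunct2, THEN conjunct1, rule_format])
  show "a < n \<Longrightarrow> A \<subseteq> {0..<n} \<Longrightarrow> B \<subseteq> {0..<n} \<Longrightarrow> (util u a A < util u a B) = (util u' a A < util u' a B)"
    by (rule *[THEN conjunct2, THEN conjunct2, THEN conjunct1, rule_format])
  show "a < n \<Longrightarrow> A \<subseteq> {0..<n} \<Longrightarrow> (real s \<le> util u a A) = (real s \<le> util u' a A)"
    by (rule *[THEN conjunct2, THEN conjunct2, THEN conjunct2, rule_format])
qed

lemma same_cmp_greedy:
  assumes "same_cmp u u'" "R \<subseteq> {0..<n}"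
  shows "greedy \<sigma> u s' i f P R = greedy \<sigma> u' s' i f P R"
proof (rule greedy_cong_ok)
  show "finite R" using assms(2) finite_subset by blast
  fix w B assume "w \<in> R" "B \<subseteq> R" "w \<notin> B"
  then show "clique_ok u B w = clique_ok u' B w"
    using assms(2) by (intro same_cmp_clique[OF assms(1)]) auto
qed

lemma same_cmp_pis0:
  assumes "same_cmp u u'"
  shows "pis0 u = pis0 u'"
proof
  fix k
  show "pis0 u k = pis0 u' k"
  proof (cases "k \<in> {1..20}")
    case True
    show ?thesis unfolding pis0_def stage1_def same_cmp_greedy[OF assms N_subset[OF True]] by (rule refl)
  next
    case False
    then show ?thesis unfolding pis0_def by (simp only: if_False)
  qed
qed

lemma same_cmp_compat: "same_cmp u u' \<Longrightarrow> same_compat u u'"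
  unfolding same_compat_def
proof (intro ballI allI impI)
  fix k C A assume *: "same_cmp u u'" "k \<in> {1..20}" "C \<subseteq> N k" "A \<subseteq> (\<Union>j\<in>{1..<k}. N j)"
  have "(\<Union>j\<in>{1..<k}. N j) \<subseteq> (\<Union>j\<in>{1..20}. N j)" using *(2) by (intro UN_mono) auto
  then have "A \<subseteq> {0..<n}" using *(4) unfolding N_union by (rule subset_trans[rotated])
  moreover have "C \<subseteq> {0..<n}" by (rule subset_trans[OF *(3) N_subset[OF *(2)]])
  ultimately show "compatible u s k A C = compatible u' s k A C"
    by (rule same_cmp_compatible[OF *(1,2)])
qed

lemma stage3_cong:
  assumes sc: "same_cmp u u'" and U: "\<And>C. C \<in> U \<Longrightarrow> C \<subseteq> {0..<n}" and Q: "Q \<subseteq> {0..<n}"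
  shows "stage3 \<sigma> u chk f U D Q = stage3 \<sigma> u' chk f U D Q"
  using U Q
proof (induction f arbitrary: U D Q)
  case (Suc f)
  show ?case
  proof (cases "Q = {}")
    case False
    define x where "x = selX \<sigma> U D Q"
    have x: "x \<in> Q" unfolding x_def by (rule selX) (use Suc.prems(2) False finite_subset in auto)
    \<comment> \<open>Positivity of a utility is expressed as a comparison with the empty
      coalition.\<close>
    have util0: "util v x {} = 0" for v by (simp add: util_def)
    have e: "(util u x C > 0) = (util u' x C > 0)" if "C \<in> U" for C
      using same_cmp_util[OF sc, of x "{}" C] Suc.prems x that unfolding util0 by auto
    define c where "c = (\<lambda>u. {C \<in> U. util u x C > 0 \<and> (\<forall>b\<in>C. (x, b) \<notin> chk \<and> (b, x) \<notin> chk)})"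
    have c: "c u = c u'" unfolding c_def using e by blast
    have IH: "stage3 \<sigma> u chk f (U - {C}) D' (Q - {x}) = stage3 \<sigma> u' chk f (U - {C}) D' (Q - {x})" for C D'
      by (rule Suc.IH) (use Suc.prems in auto)
    have step: "stage3 \<sigma> v chk (Suc f) U D Q = (if c v = {} then None else let C = selC \<sigma> x U D (c v)
       in stage3 \<sigma> v chk f (U - {C}) (insert (insert x C) D) (Q - {x}))" for v
      using False unfolding stage3.simps Let_def x_def[symmetric] c_def by (simp only: if_False)
    show ?thesis unfolding step[of u] step[of u'] c Let_def IH by (rule refl)
  qed simp
qed simp

lemma same_cmp_run:
  assumes sc: "same_cmp u u'"
  shows "run_alg n \<sigma> u = run_alg n \<sigma> u'"
proof -
  obtain pisF P chk where F: "stage2_loop \<sigma> u s (Suc (card (pis0 u 1))) (pis0 u) {} {} = (pisF, P, chk)"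
    by (metis prod_cases3)
  obtain pisF' P' chk' where F': "stage2_loop \<sigma> u' s (Suc (card (pis0 u' 1))) (pis0 u') {} {} = (pisF', P', chk')"
    by (metis prod_cases3)
  have p: "pis0 u' = pis0 u" using same_cmp_pis0[OF sc] by simp
  have "snd (stage2_loop \<sigma> u s (Suc (card (pis0 u 1))) (pis0 u) {} {}) = snd (stage2_loop \<sigma> u' s (Suc (card (pis0 u 1))) (pis0 u) {} {})
     \<and> (\<forall>k\<in>{1..20}. fst (stage2_loop \<sigma> u s (Suc (card (pis0 u 1))) (pis0 u) {} {}) k
         = fst (stage2_loop \<sigma> u' s (Suc (card (pis0 u 1))) (pis0 u) {} {}) k)"
    by (rule stage2_cong[OF same_cmp_compat[OF sc] families_pis0]) (rule refl)
  then have eq: "P' = P" "chk' = chk" "\<And>k. k \<in> {1..20} \<Longrightarrow> pisF' k = pisF k"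
    using F F' unfolding p by simp_all
  have "(\<exists>t\<le>Suc (card (pis0 u 1)). rounds \<sigma> u s t (pis0 u) {} = Some (pisF, P) \<and>
      (t = Suc (card (pis0 u 1)) \<or> pisF 1 = {} \<or> fst (round \<sigma> u s pisF P {}) = None)) \<and> (\<forall>(a,b)\<in>chk. True)"
    by (rule stage2_rounds[OF F state_init[OF families_pis0]]) simp_all
  then obtain t where "rounds \<sigma> u s t (pis0 u) {} = Some (pisF, P)" by blast
  from rounds_state[OF this state_init[OF families_pis0]] have st: "state (pis0 u) pisF P" by blast
  have R2: "(\<Union>k\<in>{1..20}. \<Union>(pisF' k)) = (\<Union>k\<in>{1..20}. \<Union>(pisF k))"
    by (rule SUP_cong[OF refl]) (simp only: eq(3))
  have sub: "(\<Union>k\<in>{1..20}. N k - \<Union>(pis0 u k)) \<union> (\<Union>k\<in>{1..20}. \<Union>(pisF k)) \<subseteq> {0..<n}"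
  proof (intro Un_least UN_least)
    fix k assume k: "k \<in> {1..20::nat}"
    show "N k - \<Union>(pis0 u k) \<subseteq> {0..<n}" using N_subset[OF k] by blast
    show "\<Union>(pisF k) \<subseteq> {0..<n}"
      using N_subset[OF k] familiesD(2)[OF state_families[OF st] k] by blast
  qed
  show ?thesis
    unfolding run_alg_eq[OF F] run_alg_eq[OF F'] p eq(1,2) R2
    by (rule stage3_cong[OF sc stateD(4)[OF st] sub])
qed

lemma same_cmp_stable:
  assumes sc: "same_cmp u u'" and p: "partition_on {0..<n} \<pi>"
  shows "individually_stable u {0..<n} \<pi> = individually_stable u' {0..<n} \<pi>"
proof -
  have sub: "B \<subseteq> {0..<n}" if "B \<in> \<pi>" for B using p that unfolding partition_on_def by blast
  have d: "(util u a (insert a T) > util u a A \<and> favor_out u (insert a T) a = {}) =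
        (util u' a (insert a T) > util u' a A \<and> favor_out u' (insert a T) a = {})"
    if a: "a \<in> {0..<n}" and AT: "A \<in> \<pi>" "T \<in> insert {} \<pi>" for a A T
  proof -
    have s: "insert a T \<subseteq> {0..<n}" "A \<subseteq> {0..<n}" using a AT sub by auto
    have "(util u a (insert a T) > util u a A) = (util u' a (insert a T) > util u' a A)"
      using same_cmp_util[OF sc, of a A "insert a T"] a s by simp
    moreover have "(util u b (insert a T \<union> {a}) < util u b (insert a T - {a})) =
       (util u' b (insert a T \<union> {a}) < util u' b (insert a T - {a}))" if "b \<in> insert a T" for b
      by (rule same_cmp_util[OF sc]) (use s that in auto)
    then have "favor_out u (insert a T) a = favor_out u' (insert a T) a"
      unfolding favor_out_def by blast
    ultimately show ?thesis by simp
  qed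
  show ?thesis unfolding individually_stable_def using d by (metis (no_types, lifting))
qed

lemma measurable_outputs_IS: "Measurable.pred M (\<lambda>f. outputs_IS n \<sigma> (curry f))"
proof (rule measurable_same_cmp)
  fix f g assume sc: "same_cmp (curry f) (curry g)"
  show "outputs_IS n \<sigma> (curry f) = outputs_IS n \<sigma> (curry g)"
    unfolding outputs_IS_def same_cmp_run[OF sc] using same_cmp_stable[OF sc] by blast
qed

text \<open>The test reads two distinct utilities for each member of \<open>C\<close>, each at least
  1/2 with probability 1/4. This is where the base 16 in the choice of s comes from.\<close>

lemma prob_clique_ok:
  assumes "C \<subseteq> {0..<n}" "w < n" "w \<notin> C"
  shows "\<P>(f in M. clique_ok (curry f) C w) = (1/16) ^ card C"
proof -
  let ?J = "(\<lambda>z. (w, z)) ` C \<union> (\<lambda>z. (z, w)) ` C"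
  have fC: "finite C" using assms finite_subset by blast
  have "clique_ok (curry f) C w \<longleftrightarrow> (\<forall>j\<in>?J. 1/2 \<le> f j)" for f :: "nat \<times> nat \<Rightarrow> real"
    unfolding clique_ok_def by auto
  then have "\<P>(f in M. clique_ok (curry f) C w) = \<P>(f in M. \<forall>j\<in>?J. 1/2 \<le> f j)" by simp
  also have "\<dots> = measure unif {x. 1/2 \<le> x} ^ card ?J"
    by (rule prob_all_coords) (use assms in \<open>auto simp: pairs_def\<close>)
  also have "card ?J = card C + card C"
    by (subst card_Un_disjoint) (use fC assms(3) in \<open>auto simp: card_image inj_on_def\<close>)
  also have "measure unif {x. 1/2 \<le> x} ^ (card C + card C) = (1/16) ^ card C"
    unfolding measure_unif_ge_half power_add power_mult_distrib[symmetric] by simp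
  finally show ?thesis .
qed

lemma dep_grow:
  assumes "finite L"
  shows "dep {(a, b). a \<in> L \<or> b \<in> L} (\<lambda>f. Q (grow \<sigma> (curry f) s' i P R F C L))"
proof (rule depI)
  fix f g :: "nat \<times> nat \<Rightarrow> real"
  assume eq: "\<And>j. j \<in> {(a, b). a \<in> L \<or> b \<in> L} \<or> j \<notin> pairs n \<Longrightarrow> f j = g j"
  have "grow \<sigma> (curry g) s' i P R F C L = grow \<sigma> (curry f) s' i P R F C L"
  proof (rule grow_dep[OF assms])
    fix w z assume "w \<in> L"
    then show "curry f w z = curry g w z \<and> curry f z w = curry g z w"
      using eq[of "(w, z)"] eq[of "(z, w)"] by simp
  qed
  then show "Q (grow \<sigma> (curry f) s' i P R F C L) = Q (grow \<sigma> (curry g) s' i P R F C L)" by simp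
qed

lemma measurable_grow:
  assumes "C \<union> L \<subseteq> {0..<n}" "C \<inter> L = {}"
  shows "Measurable.pred M (\<lambda>f. Q (grow \<sigma> (curry f) s' i P R F C L))"
proof (rule measurable_same_cmp)
  fix f g assume sc: "same_cmp (curry f) (curry g)"
  have "grow \<sigma> (curry f) s' i P R F C L = grow \<sigma> (curry g) s' i P R F C L"
  proof (rule grow_cong[OF _ assms(2)])
    show "finite L" using assms finite_subset[of L "{0..<n}"] by simp
    fix w B assume "w \<in> L" "B \<subseteq> C \<union> L" "w \<notin> B"
    then show "clique_ok (curry f) B w = clique_ok (curry g) B w"
      using assms(1) by (intro same_cmp_clique[OF sc]) auto
  qed
  then show "Q (grow \<sigma> (curry f) s' i P R F C L) = Q (grow \<sigma> (curry g) s' i P R F C L)" by simp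
qed

text \<open>The argument of \<open>prob_few_successes\<close> carried out along an adaptive process:
  with fewer than s members present, each candidate is accepted with probability at least
  \<open>p\<close>, and \<open>s - card C\<close> acceptances are still missing. Which test comes
  next depends on earlier results, so the success events are not given in advance and the induction
  has to follow the procedure.\<close>

lemma prob_grow_fails:
  fixes p :: real
  assumes "C \<union> L \<subseteq> {0..<n}" "C \<inter> L = {}" "card L \<le> F" and p: "0 \<le> p" "p \<le> (1/16) ^ (s - 1)"
  shows "\<P>(f in M. card (grow \<sigma> (curry f) s i P R F C L) < s) \<le> 2 ^ (s - card C) * (1 - p / 2) ^ card L"
  using assms(1-3)
proof (induction F arbitrary: C L)
  case 0
  have "finite L" using 0 finite_subset[of L "{0..<n}"] by simp
  then have "card L = 0" "L = {}" using 0 by auto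
  then show ?case using order_trans[OF prob_le_1, of "2 ^ (s - card C)"] by simp
next
  case (Suc F)
  have fL: "finite L" and fC: "finite C"
    using Suc.prems finite_subset[of L "{0..<n}"] finite_subset[of C "{0..<n}"] by simp_all
  have "(1/16::real) ^ (s - 1) \<le> 1" by (rule power_le_one) auto
  with p have p1: "p \<le> 1" by simp
  have b0: "0 \<le> (1 - p / 2) ^ m" for m by (rule zero_le_power) (use p1 in simp)
  consider "s \<le> card C" | "L = {}" | "L \<noteq> {}" "card C < s" by linarith
  then show ?case
  proof cases
    case 1
    then have "\<not> card (grow \<sigma> (curry f) s i P R (Suc F) C L) < s" for f :: "nat \<times> nat \<Rightarrow> real" by simp
    then have "{f\<in>space M. card (grow \<sigma> (curry f) s i P R (Suc F) C L) < s} = {}" by blast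
    then show ?thesis using b0 by (simp only: measure_empty) simp
  next
    case 2
    then show ?thesis using order_trans[OF prob_le_1, of "2 ^ (s - card C)"] by simp
  next
    case 3
    let ?w = "selW \<sigma> i P R C L"
    have w: "?w \<in> L" by (rule selW[OF fL 3(1)])
    have wn: "?w < n" "?w \<notin> C" using w Suc.prems by auto
    let ?ok = "\<lambda>f. clique_ok (curry f) C ?w"
    let ?E1 = "\<lambda>f. card (grow \<sigma> (curry f) s i P R F (insert ?w C) (L - {?w})) < s"
    let ?E0 = "\<lambda>f. card (grow \<sigma> (curry f) s i P R F C (L - {?w})) < s"
    let ?q = "\<P>(f in M. ?ok f)"
    have step: "(card (grow \<sigma> (curry f) s i P R (Suc F) C L) < s) = (?ok f \<and> ?E1 f \<or> \<not> ?ok f \<and> ?E0 f)"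
      for f :: "nat \<times> nat \<Rightarrow> real" using 3 by (simp add: Let_def)
    have Cn: "C \<subseteq> {0..<n}" using Suc.prems(1) by simp
    have mok[measurable]: "Measurable.pred M ?ok" by (rule measurable_clique_ok[OF wn(1) Cn wn(2)])
    have mE[measurable]: "Measurable.pred M ?E1" "Measurable.pred M ?E0"
      by (rule measurable_grow; use Suc.prems w in auto)+
    have dok: "dep {(a, b). a \<in> insert ?w C \<and> b \<in> insert ?w C} ?ok"
    proof (rule depI)
      fix f g :: "nat \<times> nat \<Rightarrow> real"
      assume eq: "\<And>j. j \<in> {(a, b). a \<in> insert ?w C \<and> b \<in> insert ?w C} \<or> j \<notin> pairs n \<Longrightarrow> f j = g j"
      show "?ok f = ?ok g" by (rule same_clique_ok) (use eq in simp)
    qed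
    have dE: "dep {(a, b). a \<in> L - {?w} \<or> b \<in> L - {?w}} ?E1" "dep {(a, b). a \<in> L - {?w} \<or> b \<in> L - {?w}} ?E0"
      by (rule dep_grow; use fL in simp)+
    \<comment> \<open>The test of \<open>?w\<close> reads pairs inside \<open>insert ?w C\<close>;
      every later test has a remaining candidate at one end.\<close>
    have dis: "{(a, b). a \<in> insert ?w C \<and> b \<in> insert ?w C} \<inter> {(a, b). a \<in> L - {?w} \<or> b \<in> L - {?w}} = {}"
      using Suc.prems(2) by blast
    have cL: "card L = Suc (card (L - {?w}))" using w fL by (metis card_Suc_Diff1)
    have cF: "card (L - {?w}) \<le> F" using cL Suc.prems(3) by linarith
    have subL: "insert ?w C \<union> (L - {?w}) \<subseteq> {0..<n}" "C \<union> (L - {?w}) \<subseteq> {0..<n}"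
      "insert ?w C \<inter> (L - {?w}) = {}" "C \<inter> (L - {?w}) = {}"
      using Suc.prems(1,2) w by blast+
    let ?B = "(1 - p / 2) ^ card (L - {?w})"
    have IH1: "\<P>(f in M. ?E1 f) \<le> 2 ^ (s - Suc (card C)) * ?B"
    proof -
      have "\<P>(f in M. ?E1 f) \<le> 2 ^ (s - card (insert ?w C)) * ?B"
        by (rule Suc.IH[OF subL(1,3) cF])
      then show ?thesis using wn(2) fC by simp
    qed
    have IH0: "\<P>(f in M. ?E0 f) \<le> 2 ^ (s - card C) * ?B"
      by (rule Suc.IH[OF subL(2,4) cF])
    have pow: "(2::real) ^ (s - card C) = 2 * 2 ^ (s - Suc (card C))"
      using 3(2) by (metis Suc_diff_Suc power_Suc)
    have le: "(1/16::real) ^ (s - 1) \<le> (1/16) ^ card C" by (rule power_decreasing) (use 3(2) in auto)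
    have q: "p \<le> ?q" unfolding prob_clique_ok[OF Cn wn] using p(2) le by (rule order_trans)
    have "\<P>(f in M. card (grow \<sigma> (curry f) s i P R (Suc F) C L) < s) = \<P>(f in M. ?ok f \<and> ?E1 f \<or> \<not> ?ok f \<and> ?E0 f)"
      by (simp only: step)
    also have "{f\<in>space M. ?ok f \<and> ?E1 f \<or> \<not> ?ok f \<and> ?E0 f} = {f\<in>space M. ?ok f \<and> ?E1 f} \<union> {f\<in>space M. \<not> ?ok f \<and> ?E0 f}"
      by blast
    also have "prob ({f\<in>space M. ?ok f \<and> ?E1 f} \<union> {f\<in>space M. \<not> ?ok f \<and> ?E0 f}) = \<P>(f in M. ?ok f \<and> ?E1 f) + \<P>(f in M. \<not> ?ok f \<and> ?E0 f)"
      by (rule finite_measure_Union) (measurable, blast)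
    also have "\<P>(f in M. ?ok f \<and> ?E1 f) = ?q * \<P>(f in M. ?E1 f)"
      by (rule prob_indep[OF mok dok mE(1) dE(1) dis])
    also have "\<P>(f in M. \<not> ?ok f \<and> ?E0 f) = \<P>(f in M. \<not> ?ok f) * \<P>(f in M. ?E0 f)"
      by (rule prob_indep[OF _ dep_not[OF dok] mE(2) dE(2) dis]) measurable
    also have "\<P>(f in M. \<not> ?ok f) = 1 - ?q" by (rule prob_neg) measurable
    also have "?q * \<P>(f in M. ?E1 f) + (1 - ?q) * \<P>(f in M. ?E0 f)
       \<le> ?q * (2 ^ (s - Suc (card C)) * ?B) + (1 - ?q) * (2 ^ (s - card C) * ?B)"
      by (intro add_mono mult_left_mono IH0 IH1) auto
    also have "\<dots> = 2 ^ (s - card C) * ?B * (1 - ?q / 2)"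
      unfolding pow by (simp add: algebra_simps)
    also have "\<dots> \<le> 2 ^ (s - card C) * ?B * (1 - p / 2)"
      by (intro mult_left_mono mult_nonneg_nonneg b0) (use q in auto)
    finally show ?thesis unfolding cL by (simp add: mult_ac)
  qed
qed

text \<open>Failure bound for one clique: it starts with a single agent, so \<open>s - 1\<close>
  acceptances are missing, each of probability at least \<open>(1/16) ^ (s - 1)\<close>.\<close>

definition eps1 :: "nat \<Rightarrow> real" where
  "eps1 r0 = 2 ^ (s - 1) * (1 - (1/16) ^ (s - 1) / 2) ^ r0"

lemma eps1_nonneg: "0 \<le> eps1 r0"
proof -
  have "(1/16::real) ^ (s - 1) \<le> 1" by (rule power_le_one) auto
  then show ?thesis unfolding eps1_def by (intro mult_nonneg_nonneg zero_le_power) auto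
qed

text \<open>Either the first clique already fails although at least \<open>r0\<close> candidates are
  available, or it is some set \<open>C\<close> and the failure happens later. The first clique is
  determined by pairs touching \<open>C\<close>, the rest of the procedure by pairs inside
  \<open>R - C\<close>; conditioning on \<open>C\<close> thus costs nothing, and the failure bounds
  of the single attempts add up.\<close>

lemma prob_greedy_fails:
  assumes "R \<subseteq> {0..<n}" "card R < F"
  shows "\<P>(f in M. r0 < card (snd (greedy \<sigma> (curry f) s i F P R))) \<le> F * eps1 r0"
  using assms
proof (induction F arbitrary: P R)
  case (Suc F)
  have fR: "finite R" using Suc.prems finite_subset[of R "{0..<n}"] by simp
  show ?case
  proof (cases "R = {}")
    case True
    then show ?thesis using eps1_nonneg by simp
  next
    case False
    let ?v = "selV \<sigma> i P R"
    have v: "?v \<in> R" by (rule selV[OF fR False])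
    let ?G = "\<lambda>f. grow \<sigma> (curry f) s i P R (card R) {?v} (R - {?v})"
    let ?B = "\<lambda>C f. r0 < card (snd (greedy \<sigma> (curry f) s i F (insert C P) (R - C)))"
    let ?Q = "\<lambda>f. \<not> card (?G f) < s \<and> ?B (?G f) f"
    have f: "finite (R - {?v})" using fR by simp
    have sub: "{?v} \<subseteq> ?G g \<and> ?G g \<subseteq> R" for g using grow_subset[OF f, of "{?v}"] v by blast
    have mG: "Measurable.pred M (\<lambda>f. Q (?G f))" for Q by (rule measurable_grow) (use Suc.prems v in auto)
    have mB: "Measurable.pred M (?B C)" for C
    proof (rule measurable_same_cmp)
      fix f g assume "same_cmp (curry f) (curry g)"
      from same_cmp_greedy[OF this, of "R - C"] Suc.prems
      have "greedy \<sigma> (curry f) s i F (insert C P) (R - C) = greedy \<sigma> (curry g) s i F (insert C P) (R - C)" by blast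
      then show "?B C f = ?B C g" by simp
    qed
    have Qb: "\<P>(f in M. ?Q f) \<le> F * eps1 r0"
    proof (rule prob_by_indep_value[where V = "{C. {?v} \<subseteq> C \<and> C \<subseteq> R}" and G = "\<lambda>C f. ?G f = C" and B = ?B
          and J = "\<lambda>C. {(a, b). a \<in> C \<or> b \<in> C}" and K = "\<lambda>C. (R - C) \<times> (R - C)"])
      show "finite {C. {?v} \<subseteq> C \<and> C \<subseteq> R}" using fR by (rule_tac finite_subset[of _ "Pow R"]) auto
      show "0 \<le> F * eps1 r0" using eps1_nonneg by simp
      fix C assume C: "C \<in> {C. {?v} \<subseteq> C \<and> C \<subseteq> R}"
      show "Measurable.pred M (\<lambda>f. ?G f = C)" by (rule mG)
      show "Measurable.pred M (?B C)" by (rule mB)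
      show "dep {(a, b). a \<in> C \<or> b \<in> C} (\<lambda>f. ?G f = C)"
      proof (rule depI)
        fix f g :: "nat \<times> nat \<Rightarrow> real"
        assume eq: "\<And>j. j \<in> {(a, b). a \<in> C \<or> b \<in> C} \<or> j \<notin> pairs n \<Longrightarrow> f j = g j"
        have eq': "curry f w z = curry g w z \<and> curry f z w = curry g z w" if "z \<in> C" for w z
          using eq[of "(w, z)"] eq[of "(z, w)"] that by simp
        \<comment> \<open>\<open>grow_dep\<close> asks for agreement only on pairs touching the
          outcome of one of the two runs, so it is applied from whichever run yields
          \<open>C\<close>.\<close>
        have 1: "?G g = ?G f" if "?G f = C"
          by (rule grow_dep[OF f]) (use eq' that in blast)
        have 2: "?G f = ?G g" if "?G g = C"
          by (rule grow_dep[OF f]) (metis eq' that)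
        show "(?G f = C) = (?G g = C)" using 1 2 by metis
      qed
      show "dep ((R - C) \<times> (R - C)) (?B C)"
      proof (rule depI)
        fix f g :: "nat \<times> nat \<Rightarrow> real"
        assume eq: "\<And>j. j \<in> (R - C) \<times> (R - C) \<or> j \<notin> pairs n \<Longrightarrow> f j = g j"
        have "greedy \<sigma> (curry f) s i F (insert C P) (R - C) = greedy \<sigma> (curry g) s i F (insert C P) (R - C)"
          by (rule greedy_cong) (use fR eq in auto)
        then show "?B C f = ?B C g" by simp
      qed
      show "{(a, b). a \<in> C \<or> b \<in> C} \<inter> (R - C) \<times> (R - C) = {}" by blast
      have "card (R - C) < card R" using C v fR by (intro psubset_card_mono) auto
      then show "\<P>(f in M. ?B C f) \<le> F * eps1 r0"
        by (intro Suc.IH) (use Suc.prems in auto)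
    next
      fix f assume "?Q f"
      then show "\<exists>C\<in>{C. {?v} \<subseteq> C \<and> C \<subseteq> R}. ?G f = C \<and> ?B C f" using sub[of f] by blast
    qed simp
    let ?A = "\<lambda>f. r0 < card R \<and> card (?G f) < s"
    have Ab: "\<P>(f in M. ?A f) \<le> eps1 r0"
    proof (cases "r0 < card R")
      case True
      have b: "0 \<le> 1 - (1/16::real) ^ (s - 1) / 2" "1 - (1/16::real) ^ (s - 1) / 2 \<le> 1"
        using power_le_one[of "1/16::real" "s - 1"] by auto
      have "\<P>(f in M. ?A f) = \<P>(f in M. card (?G f) < s)" using True by simp
      also have "\<dots> \<le> 2 ^ (s - card {?v}) * (1 - (1/16) ^ (s - 1) / 2) ^ card (R - {?v})"
        by (rule prob_grow_fails) (use Suc.prems v card_Diff1_le[of R ?v] in auto)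
      also have "\<dots> \<le> 2 ^ (s - 1) * (1 - (1/16) ^ (s - 1) / 2) ^ r0"
      proof -
        have "r0 \<le> card (R - {?v})" using True v fR by simp
        then show ?thesis using power_decreasing[OF _ b, of r0 "card (R - {?v})"] by simp
      qed
      finally show ?thesis by (simp add: eps1_def)
    qed (use eps1_nonneg in simp)
    have "(r0 < card (snd (greedy \<sigma> (curry f) s i (Suc F) P R))) = (?A f \<or> ?Q f)" for f :: "nat \<times> nat \<Rightarrow> real"
      using False by (simp add: Let_def)
    then have "\<P>(f in M. r0 < card (snd (greedy \<sigma> (curry f) s i (Suc F) P R))) = \<P>(f in M. ?A f \<or> ?Q f)" by simp
    also have "{f\<in>space M. ?A f \<or> ?Q f} = {f\<in>space M. ?A f} \<union> {f\<in>space M. ?Q f}" by blast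
    also have "prob ({f\<in>space M. ?A f} \<union> {f\<in>space M. ?Q f}) \<le> \<P>(f in M. ?A f) + \<P>(f in M. ?Q f)"
    proof (rule measure_Un_le)
      show "{f\<in>space M. ?A f} \<in> sets M"
        using mG[of "\<lambda>G. r0 < card R \<and> card G < s"] unfolding pred_def .
      have "Measurable.pred M ?Q"
      proof (rule measurable_same_cmp)
        fix f g assume sc: "same_cmp (curry f) (curry g)"
        have G: "?G f = ?G g"
        proof (rule grow_cong[OF f])
          fix w B assume "w \<in> R - {?v}" "B \<subseteq> {?v} \<union> (R - {?v})" "w \<notin> B"
          then show "clique_ok (curry f) B w = clique_ok (curry g) B w"
            using Suc.prems(1) v by (intro same_cmp_clique[OF sc]) auto
        qed simp
        have "greedy \<sigma> (curry f) s i F (insert C P) (R - C) = greedy \<sigma> (curry g) s i F (insert C P) (R - C)" for C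
          by (rule same_cmp_greedy[OF sc]) (use Suc.prems in blast)
        then show "?Q f = ?Q g" unfolding G by (simp only:)
      qed
      then show "{f\<in>space M. ?Q f} \<in> sets M" unfolding pred_def .
    qed
    also have "\<dots> \<le> eps1 r0 + F * eps1 r0" by (rule add_mono[OF Ab Qb])
    finally show ?thesis by (simp add: algebra_simps)
  qed
qed simp

lemma prob_stage1_fails:
  "\<P>(f in M. \<exists>k\<in>{1..20}. r0 < card (N k - \<Union>(pis0 (curry f) k))) \<le> 20 * ((n + 1) * eps1 r0)"
proof -
  have "\<P>(f in M. \<exists>k\<in>{1..20}. r0 < card (N k - \<Union>(pis0 (curry f) k))) \<le> card {1..20::nat} * ((n + 1) * eps1 r0)"
  proof (rule prob_union_bound[where B = "\<lambda>k f. r0 < card (N k - \<Union>(pis0 (curry f) k))"])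
    fix k assume k: "k \<in> {1..20::nat}"
    have e: "N k - \<Union>(pis0 (curry f) k) = snd (greedy \<sigma> (curry f) s k (Suc (card (N k))) {} (N k))" for f
      using stage1_props(5)[OF k, of "curry f"] unfolding stage1_def by (rule sym)
    show "Measurable.pred M (\<lambda>f. r0 < card (N k - \<Union>(pis0 (curry f) k)))"
      by (rule measurable_same_cmp) (simp only: same_cmp_pis0)
    have "\<P>(f in M. r0 < card (N k - \<Union>(pis0 (curry f) k))) \<le> Suc (card (N k)) * eps1 r0"
      unfolding e by (rule prob_greedy_fails[OF N_subset[OF k]]) simp
    also have "card (N k) \<le> n" using card_mono[OF _ N_subset[OF k]] by simp
    then have "Suc (card (N k)) * eps1 r0 \<le> (n + 1) * eps1 r0"
      by (intro mult_right_mono eps1_nonneg) simp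
    finally show "\<P>(f in M. r0 < card (N k - \<Union>(pis0 (curry f) k))) \<le> (n + 1) * eps1 r0" .
  qed auto
  then show ?thesis by simp
qed

section \<open>Stages 2 and 3\<close>

text \<open>Holds almost surely but not at every point of the space, which contains all real values.
  It guarantees that -1 really lies below every utility that the ghost replaces.\<close>

definition bounded_by_1 :: "(nat \<times> nat \<Rightarrow> real) \<Rightarrow> bool" where
  "bounded_by_1 f \<longleftrightarrow> (\<forall>i\<in>pairs n. \<bar>f i\<bar> < 1)"

lemma measurable_bounded: "Measurable.pred M bounded_by_1"
  unfolding bounded_by_1_def
proof (rule pred_intros_finite(3)[OF finite_pairs])
  fix i assume [measurable]: "i \<in> pairs n"
  show "Measurable.pred M (\<lambda>f. \<bar>f i\<bar> < 1)" by measurable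
qed

lemma prob_bounded:
  assumes "Measurable.pred M Q"
  shows "\<P>(f in M. Q f) = \<P>(f in M. bounded_by_1 f \<and> Q f)"
proof (rule finite_measure_eq_AE)
  note [measurable] = assms measurable_bounded
  show "{f \<in> space M. Q f} \<in> sets M" "{f \<in> space M. bounded_by_1 f \<and> Q f} \<in> sets M" by measurable
  show "AE f in M. (f \<in> {f \<in> space M. Q f}) = (f \<in> {f \<in> space M. bounded_by_1 f \<and> Q f})"
    using AE_abs_less by eventually_elim (simp add: bounded_by_1_def)
qed

text \<open>Only entries at genuine pairs are changed, so the result is again a point of the product
  space and measurability of runs carries over by composition.\<close>

definition ghost :: "nat set \<Rightarrow> (nat \<times> nat \<Rightarrow> real) \<Rightarrow> (nat \<times> nat \<Rightarrow> real)" where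
  "ghost D f = (\<lambda>(a, b). if (a, b) \<in> pairs n \<and> (a \<in> D \<or> b \<in> D) then -1 else f (a, b))"

lemma measurable_ghost: "ghost D \<in> M \<rightarrow>\<^sub>M M"
proof (rule measurable_into_M)
  fix i assume i: "i \<in> pairs n"
  obtain a b where ab: "i = (a, b)" by fastforce
  show "(\<lambda>f. ghost D f i) \<in> borel_measurable M"
    using i measurable_coord[OF i] unfolding ghost_def ab by (cases "a \<in> D \<or> b \<in> D") simp_all
next
  fix f i assume "f \<in> space M" "i \<notin> pairs n"
  then show "ghost D f i = undefined"
    unfolding ghost_def space_M by (cases i) (auto simp: PiE_iff extensional_def)
qed

lemma ghost_le: "bounded_by_1 f \<Longrightarrow> curry (ghost D f) a b \<le> curry f a b"
  unfolding bounded_by_1_def ghost_def curry_def by force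

lemma ghost_eq: "a \<notin> D \<Longrightarrow> b \<notin> D \<Longrightarrow> curry (ghost D f) a b = curry f a b"
  unfolding ghost_def curry_def by simp

lemma rounds_ghost:
  assumes "rounds \<sigma> (curry f) s t pis {} = Some (pis', P')" "families pis" "bounded_by_1 f"
    and "\<And>T. T \<in> P' \<Longrightarrow> T \<inter> D = {}"
  shows "rounds \<sigma> (curry (ghost D f)) s t pis {} = Some (pis', P')"
proof (rule rounds_mono[OF assms(1) state_init[OF assms(2)] ghost_le[OF assms(3)]])
  fix T a b assume "T \<in> P'" "a \<in> T" "b \<in> T"
  then have "a \<notin> D" "b \<notin> D" using assms(4)[of T] by blast+
  then show "curry (ghost D f) a b = curry f a b" by (rule ghost_eq)
qed

lemma measurable_rounds:
  assumes "families pis"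
  shows "Measurable.pred M (\<lambda>f. Q (rounds \<sigma> (curry f) s t pis {}))"
proof (rule measurable_same_cmp)
  fix f g assume "same_cmp (curry f) (curry g)"
  then show "Q (rounds \<sigma> (curry f) s t pis {}) = Q (rounds \<sigma> (curry g) s t pis {})"
    by (simp only: rounds_cong[OF same_cmp_compat assms])
qed

lemma measurable_ghost_rounds:
  assumes "families pis"
  shows "Measurable.pred M (\<lambda>f. Q (rounds \<sigma> (curry (ghost D f)) s t pis {}))"
  by (rule measurable_compose[OF measurable_ghost measurable_rounds[OF assms]])

lemma dep_ghost: "dep {(a, b). a \<notin> D \<and> b \<notin> D} (\<lambda>f. Q (ghost D f))"
proof (rule depI)
  fix f g :: "nat \<times> nat \<Rightarrow> real"
  assume eq: "\<And>j. j \<in> {(a, b). a \<notin> D \<and> b \<notin> D} \<or> j \<notin> pairs n \<Longrightarrow> f j = g j"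
  have "ghost D f = ghost D g"
  proof (rule ext)
    fix j :: "nat \<times> nat"
    obtain a b where j: "j = (a, b)" by fastforce
    show "ghost D f j = ghost D g j" unfolding ghost_def j using eq[of "(a, b)"] by auto
  qed
  then show "Q (ghost D f) = Q (ghost D g)" by (simp only:)
qed

lemma families_card:
  assumes "families pis" "k \<in> {1..20}" shows "card (pis k) \<le> n"
proof -
  have sub: "\<Union>(pis k) \<subseteq> N k" using familiesD(2)[OF assms] by blast
  have "card (pis k) \<le> s * card (pis k)" using s_pos by simp
  also have "\<dots> = card (\<Union>(pis k))" by (rule families_union_card[OF assms, symmetric])
  also have "\<dots> \<le> card {0..<n}" by (rule card_mono) (use sub N_subset[OF assms(2)] in auto)
  finally show ?thesis by simp
qed

lemma finite_subset_N: "k \<in> {1..20} \<Longrightarrow> C \<subseteq> N k \<Longrightarrow> finite C"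
  using N_finite[of k] by (rule finite_subset[rotated])

text \<open>The tail bound with c = 1/80, where the constant in the exponent is 12800, twice the
  square of 80. The allowed loss is proportional to the size of the coalition, so the bound only
  improves for coalitions larger than s.\<close>

lemma prob_util_less:
  assumes "a < n" "C \<subseteq> {0..<n}" "a \<notin> C" "s \<le> card C"
  shows "\<P>(f in M. util (curry f) a C < - (real (card C) / 80)) \<le> exp (- (real s / 12800))"
proof -
  have fC: "finite C" using assms(2) finite_subset[of C "{0..<n}"] by simp
  have c: "card (Pair a ` C) = card C" by (rule card_image) (simp add: inj_on_def)
  have "C \<noteq> {}" using assms(4) s_pos by auto
  have "\<P>(f in M. (\<Sum>j\<in>Pair a ` C. f j) < - ((1/80) * real (card (Pair a ` C)))) \<le> exp (- ((1/80)\<^sup>2 * real (card (Pair a ` C)) / 2))"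
    by (rule prob_sum_less) (use assms \<open>C \<noteq> {}\<close> in \<open>auto simp: pairs_def\<close>)
  also have "\<dots> \<le> exp (- (real s / 12800))" unfolding c using assms(4) by (simp add: power2_eq_square)
  finally show ?thesis unfolding c util_row[OF assms(3)] by simp
qed

text \<open>Compatibility consists of one inequality for each of the k s agents involved, at most 20
  s, and both thresholds are 1/80 of the size of the opposite side. A union bound over the violated
  inequalities suffices, because s tends to infinity. For k = 1 the prefix is empty and nothing is
  tested.\<close>

lemma prob_incompatible:
  assumes hq: "20 * real s * exp (- (real s / 12800)) \<le> 1/2"
    and AC: "A \<subseteq> {0..<n}" "C \<subseteq> {0..<n}" "A \<inter> C = {}" "card A = (k - 1) * s" "card C = s" and k: "k \<in> {1..20}"
  shows "\<P>(f in M. \<not> compatible (curry f) s k A C) \<le> 1/2"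
proof (cases "k = 1")
  case True
  then have "A = {}" using AC(1,4) finite_subset[of A "{0..<n}"] by simp
  then show ?thesis by (simp add: compatible_def)
next
  case False
  then have k2: "1 \<le> k - 1" using k by auto
  have sA: "s \<le> card A" using mult_le_mono1[OF k2, of s] AC(4) by simp
  have fin: "finite A" "finite C" using AC finite_subset[of _ "{0..<n}"] by simp_all
  let ?B = "\<lambda>v f. case v of Inl a \<Rightarrow> util (curry f) a C < - (real (card C) / 80)
      | Inr b \<Rightarrow> util (curry f) b A < - (real (card A) / 80)"
  have "\<P>(f in M. \<not> compatible (curry f) s k A C) \<le> card (A <+> C) * exp (- (real s / 12800))"
  proof (rule prob_union_bound[where B = ?B])
    show "finite (A <+> C)" using fin by simp
    fix v assume "v \<in> A <+> C"
    then consider a where "v = Inl a" "a \<in> A" | b where "v = Inr b" "b \<in> C" by blast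
    then show "\<P>(f in M. ?B v f) \<le> exp (- (real s / 12800))" "Measurable.pred M (?B v)"
    proof (atomize (full), cases)
      case 1
      have a: "a < n" "a \<notin> C" using 1 AC by auto
      note [measurable] = measurable_util[OF a(1) AC(2)]
      show "\<P>(f in M. ?B v f) \<le> exp (- (real s / 12800)) \<and> Measurable.pred M (?B v)"
        unfolding 1(1) sum.case by (intro conjI prob_util_less a AC) (use AC(5) in simp, measurable)
    next
      case 2
      have b: "b < n" "b \<notin> A" using 2 AC by auto
      note [measurable] = measurable_util[OF b(1) AC(1)]
      show "\<P>(f in M. ?B v f) \<le> exp (- (real s / 12800)) \<and> Measurable.pred M (?B v)"
        unfolding 2(1) sum.case by (intro conjI prob_util_less b AC sA) measurable
    qed
  next
    fix f assume "\<not> compatible (curry f) s k A C"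
    then obtain a b where ab: "a \<in> A" "b \<in> C"
      "\<not> (- (real s / 80) \<le> util (curry f) a C \<and> - (real (k - 1) * real s / 80) \<le> util (curry f) b A)"
      unfolding compatible_def by blast
    have "real (card A) = real (k - 1) * real s" unfolding AC(4) by simp
    then have "?B (Inl a) f \<or> ?B (Inr b) f" using ab(3) AC(5) by (simp, linarith)
    then show "\<exists>v\<in>A <+> C. ?B v f" using ab(1,2) by blast
  qed
  also have "card (A <+> C) = k * s" using card_Plus[OF fin] AC(4,5) k by (simp add: algebra_simps)
  also have "real (k * s) * exp (- (real s / 12800)) \<le> (20 * real s) * exp (- (real s / 12800))"
  proof (rule mult_right_mono)
    have "real k * real s \<le> 20 * real s" by (rule mult_right_mono) (use k in simp_all)
    then show "real (k * s) \<le> 20 * real s" by simp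
  qed simp
  finally show ?thesis using hq by linarith
qed

definition bad2 :: "(nat \<Rightarrow> nat set set) \<Rightarrow> nat \<Rightarrow> utility \<Rightarrow> bool" where
  "bad2 ps l u \<longleftrightarrow> (\<exists>t pis P. rounds \<sigma> u s t ps {} = Some (pis, P) \<and> fst (round \<sigma> u s pis P {}) = None \<and>
     (\<forall>k\<in>{1..20}. l < card (pis k)))"

lemma bad2_cong:
  assumes sc: "same_compat u u'" and fam: "families ps"
  shows "bad2 ps l u = bad2 ps l u'"
proof -
  have "round \<sigma> u s pis P {} = round \<sigma> u' s pis P {}" if "rounds \<sigma> u' s t ps {} = Some (pis, P)" for t pis P
  proof (rule round_cong[OF sc])
    show "families pis" using rounds_state[OF that state_init[OF fam]] state_families by blast
  qed (rule refl)
  then have *: "(rounds \<sigma> u' s t ps {} = Some (pis, P) \<and> fst (round \<sigma> u s pis P {}) = None \<and> X) =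
      (rounds \<sigma> u' s t ps {} = Some (pis, P) \<and> fst (round \<sigma> u' s pis P {}) = None \<and> X)" for t pis P X by metis
  show ?thesis unfolding bad2_def rounds_cong[OF sc fam] * by (rule refl)
qed

text \<open>With the number of rounds and the prefix \<open>A\<close> fixed, the value conditioned
  on is the set of cliques of class \<open>k\<close> that remain free. It is read off the run with
  ghost utilities for \<open>A\<close>, hence independent of the pairs touching \<open>A\<close>;
  and for different cliques the pairs joining them to \<open>A\<close> are disjoint. More than
  \<open>l\<close> independent rejections, each of probability at most 1/2, give the bound.\<close>

lemma prob_bad2_fixed:
  assumes hq: "20 * real s * exp (- (real s / 12800)) \<le> 1/2" and fam: "families ps" and k: "k \<in> {1..20}"
    and A_def: "A = earlier cs k"
  shows "\<P>(f in M. bounded_by_1 f \<and> (\<exists>pis P. rounds \<sigma> (curry f) s t ps {} = Some (pis, P) \<and>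
     (\<forall>i\<in>{1..<k}. cs i \<in> pis i) \<and> l < card (pis k) \<and> (\<forall>C\<in>pis k. \<not> compatible (curry f) s k A C))) \<le> (1/2) ^ l"
    (is "\<P>(f in M. ?Q f) \<le> _")
proof (cases "\<forall>i\<in>{1..<k}. cs i \<in> ps i")
  case False
  have "\<not> ?Q f" for f
  proof
    assume "?Q f"
    then obtain pis P where r: "rounds \<sigma> (curry f) s t ps {} = Some (pis, P)" "\<forall>i\<in>{1..<k}. cs i \<in> pis i" by blast
    have sub: "pis i \<subseteq> ps i" if "i \<in> {1..20}" for i using rounds_state[OF r(1) state_init[OF fam]] that by blast
    have "cs i \<in> ps i" if "i \<in> {1..<k}" for i
    proof -
      have "i \<in> {1..20}" using that k by auto
      then show ?thesis using sub r(2) that by blast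
    qed
    then show False using False by blast
  qed
  then have "{f\<in>space M. ?Q f} = {}" by blast
  then show ?thesis by (simp only: measure_empty) simp
next
  case True
  have i20: "i \<in> {1..20}" if "i \<in> {1..<k}" for i using that k by auto
  have csN: "cs i \<subseteq> N i" "card (cs i) = s" if "i \<in> {1..<k}" for i
    using familiesD(2,3)[OF fam i20[OF that]] True that by blast+
  have AN: "A \<subseteq> (\<Union>i\<in>{1..<k}. N i)" unfolding A_def earlier_def using csN(1) by blast
  have An: "A \<subseteq> {0..<n}" using AN N_subset i20 by blast
  have cA: "card A = (k - 1) * s"
  proof -
    have "card A = (\<Sum>i\<in>{1..<k}. card (cs i))"
      unfolding A_def earlier_def
    proof (rule card_UN_disjoint; (intro ballI impI)?)
      show "finite (cs i)" if "i \<in> {1..<k}" for i by (rule finite_subset_N[OF i20[OF that] csN(1)[OF that]])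
      show "cs i \<inter> cs j = {}" if "i \<in> {1..<k}" "j \<in> {1..<k}" "i \<noteq> j" for i j
        using csN(1)[OF that(1)] csN(1)[OF that(2)] N_disjoint[OF i20[OF that(1)] i20[OF that(2)] that(3)] by blast
    qed simp
    also have "\<dots> = (\<Sum>i\<in>{1..<k}. s)" by (rule sum.cong[OF refl]) (rule csN(2))
    finally show ?thesis by simp
  qed
  have ANk: "A \<inter> N k = {}"
  proof -
    have "N i \<inter> N k = {}" if "i \<in> {1..<k}" for i by (rule N_disjoint[OF i20[OF that] k]) (use that in simp)
    then show ?thesis using AN by blast
  qed
  let ?G = "\<lambda>c f. \<exists>pis P. rounds \<sigma> (curry (ghost A f)) s t ps {} = Some (pis, P) \<and> pis k = c"
  let ?B = "\<lambda>c f. l < card c \<and> (\<forall>C\<in>c. \<not> compatible (curry f) s k A C)"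
  let ?K = "\<lambda>C. {(a, b). a \<in> A \<and> b \<in> C \<or> a \<in> C \<and> b \<in> A}"
  note psk = familiesD[OF fam k]
  have fps: "finite (ps k)" by (rule families_finite[OF fam k])
  have Cn: "C \<subseteq> {0..<n}" if "C \<in> ps k" for C by (rule subset_trans[OF psk(2)[OF that] N_subset[OF k]])
  have mC: "Measurable.pred M (\<lambda>f. \<not> compatible (curry f) s k A C)" if "C \<in> ps k" for C
    using measurable_compatible[OF An Cn[OF that], of k] by measurable
  have dC: "dep (?K C) (\<lambda>f. \<not> compatible (curry f) s k A C)" for C
  proof (rule dep_not, rule depI)
    fix f g :: "nat \<times> nat \<Rightarrow> real"
    assume eq: "\<And>j. j \<in> ?K C \<or> j \<notin> pairs n \<Longrightarrow> f j = g j"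
    show "compatible (curry f) s k A C = compatible (curry g) s k A C"
      by (rule compatible_cong) (use eq in simp)
  qed
  show ?thesis
  proof (rule prob_by_indep_value[where V = "Pow (ps k)" and G = ?G and B = ?B and J = "\<lambda>_. {(a, b). a \<notin> A \<and> b \<notin> A}"
        and K = "\<lambda>c. \<Union>C\<in>c. ?K C"])
    show "finite (Pow (ps k))" using fps by simp
    fix c assume c: "c \<in> Pow (ps k)"
    have fc: "finite c" using c fps finite_subset by blast
    show "Measurable.pred M (?G c)"
      by (rule measurable_ghost_rounds[OF fam, where Q = "\<lambda>r. \<exists>pis P. r = Some (pis, P) \<and> pis k = c"])
    show "dep {(a, b). a \<notin> A \<and> b \<notin> A} (?G c)"
      by (rule dep_ghost[where Q = "\<lambda>f. \<exists>pis P. rounds \<sigma> (curry f) s t ps {} = Some (pis, P) \<and> pis k = c"])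
    have mall: "Measurable.pred M (\<lambda>f. \<forall>C\<in>c. \<not> compatible (curry f) s k A C)"
      by (rule pred_intros_finite(3)[OF fc]) (use mC c in blast)
    then show "Measurable.pred M (?B c)" by measurable
    have "dep (\<Union>C\<in>c. ?K C) (\<lambda>f. \<forall>C\<in>c. \<not> compatible (curry f) s k A C)"
      by (rule dep_Ball) (rule dC)
    then show "dep (\<Union>C\<in>c. ?K C) (?B c)" unfolding dep_def by blast
    show "{(a, b). a \<notin> A \<and> b \<notin> A} \<inter> (\<Union>C\<in>c. ?K C) = {}" by blast
    show "\<P>(f in M. ?B c f) \<le> (1/2) ^ l"
    proof (cases "l < card c")
      case False
      then show ?thesis by simp
    next
      case True
      have "\<P>(f in M. ?B c f) = \<P>(f in M. \<forall>C\<in>c. \<not> compatible (curry f) s k A C)" using True by simp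
      also have "\<dots> = (\<Prod>C\<in>c. \<P>(f in M. \<not> compatible (curry f) s k A C))"
      proof (rule prob_Ball[OF fc])
        show "Measurable.pred M (\<lambda>f. \<not> compatible (curry f) s k A C)" if "C \<in> c" for C
          by (rule mC) (use that c in blast)
        show "dep (?K C) (\<lambda>f. \<not> compatible (curry f) s k A C)" for C by (rule dC)
        show "disjoint_family_on ?K c" unfolding disjoint_family_on_def
        proof (intro ballI impI)
          fix C D assume CD: "C \<in> c" "D \<in> c" "C \<noteq> D"
          then have cd: "C \<in> ps k" "D \<in> ps k" using c by blast+
          have "C \<inter> D = {}" by (rule disjointD[OF psk(1) cd CD(3)])
          moreover have "A \<inter> C = {}" "A \<inter> D = {}" using psk(2)[OF cd(1)] psk(2)[OF cd(2)] ANk by blast+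
          ultimately show "?K C \<inter> ?K D = {}" by blast
        qed
      qed
      also have "\<dots> \<le> (\<Prod>C\<in>c. 1/2)"
      proof (rule prod_mono, rule conjI)
        fix C assume C: "C \<in> c"
        then have C': "C \<in> ps k" using c by blast
        show "\<P>(f in M. \<not> compatible (curry f) s k A C) \<le> 1/2"
          by (rule prob_incompatible[OF hq An Cn[OF C'] _ cA psk(3)[OF C'] k]) (use psk(2)[OF C'] ANk in blast)
      qed simp
      also have "\<dots> = (1/2) ^ card c" by simp
      also have "\<dots> \<le> (1/2) ^ l" by (rule power_decreasing) (use True in auto)
      finally show ?thesis .
    qed
  next
    fix f assume f: "?Q f"
    then obtain pis P where r: "rounds \<sigma> (curry f) s t ps {} = Some (pis, P)" "\<forall>i\<in>{1..<k}. cs i \<in> pis i"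
      "l < card (pis k)" "\<forall>C\<in>pis k. \<not> compatible (curry f) s k A C" by blast
    have st: "state ps pis P" using rounds_state[OF r(1) state_init[OF fam]] by blast
    \<comment> \<open>The parts of \<open>A\<close> are still free before the failing round, so no
      coalition merged so far meets \<open>A\<close> and the ghost utilities reproduce the
      run.\<close>
    have "T \<inter> A = {}" if T: "T \<in> P" for T
    proof -
      have "cs i \<inter> T = {}" if i: "i \<in> {1..<k}" for i
        by (rule state_disjoint_rest[OF st i20[OF i] _ T]) (use r(2) i in blast)
      then show ?thesis unfolding A_def earlier_def by blast
    qed
    with f have "rounds \<sigma> (curry (ghost A f)) s t ps {} = Some (pis, P)" by (intro rounds_ghost[OF r(1) fam]) blast+
    then have "?G (pis k) f" by blast
    moreover have "pis k \<in> Pow (ps k)" using state_sub[OF st k] by blast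
    ultimately show "\<exists>c\<in>Pow (ps k). ?G c f \<and> ?B c f" using r(3,4) by blast
  next
    fix c c' f assume "?G c f" "?G c' f"
    then show "c = c'" by auto
  qed simp
qed

lemma measurable_bad2_fixed:
  assumes fam: "families ps" and k: "k \<in> {1..20}"
  shows "Measurable.pred M (\<lambda>f. bounded_by_1 f \<and> (\<exists>pis P. rounds \<sigma> (curry f) s t ps {} = Some (pis, P) \<and>
     (\<forall>i\<in>{1..<k}. cs i \<in> pis i) \<and> l < card (pis k) \<and> (\<forall>C\<in>pis k. \<not> compatible (curry f) s k (earlier cs k) C)))"
proof -
  note [measurable] = measurable_bounded
  have [measurable]: "Measurable.pred M (\<lambda>f. \<exists>pis P. rounds \<sigma> (curry f) s t ps {} = Some (pis, P) \<and>
     (\<forall>i\<in>{1..<k}. cs i \<in> pis i) \<and> l < card (pis k) \<and> (\<forall>C\<in>pis k. \<not> compatible (curry f) s k (earlier cs k) C))"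
  proof (rule measurable_same_cmp)
    fix f g assume sc: "same_cmp (curry f) (curry g)"
    have "(\<forall>C\<in>pis k. \<not> compatible (curry f) s k (earlier cs k) C) = (\<forall>C\<in>pis k. \<not> compatible (curry g) s k (earlier cs k) C)"
      if r: "rounds \<sigma> (curry g) s t ps {} = Some (pis, P)" and cs: "\<forall>i\<in>{1..<k}. cs i \<in> pis i" for pis P
    proof -
      have fp: "families pis" using rounds_state[OF r state_init[OF fam]] state_families by blast
      have "earlier cs k \<subseteq> (\<Union>i\<in>{1..<k}. N i)"
        unfolding earlier_def
      proof (rule UN_mono[OF subset_refl])
        fix i assume i: "i \<in> {1..<k}"
        then have "i \<in> {1..20}" using k by auto
        from familiesD(2)[OF fp this] cs i show "cs i \<subseteq> N i" by blast
      qed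
      moreover have "C \<subseteq> N k" if "C \<in> pis k" for C by (rule familiesD(2)[OF fp k that])
      ultimately have "compatible (curry f) s k (earlier cs k) C = compatible (curry g) s k (earlier cs k) C"
        if "C \<in> pis k" for C
        using same_cmp_compat[OF sc, unfolded same_compat_def, rule_format, OF k] that by blast
      then show ?thesis by blast
    qed
    then show "(\<exists>pis P. rounds \<sigma> (curry f) s t ps {} = Some (pis, P) \<and>
     (\<forall>i\<in>{1..<k}. cs i \<in> pis i) \<and> l < card (pis k) \<and> (\<forall>C\<in>pis k. \<not> compatible (curry f) s k (earlier cs k) C)) =
     (\<exists>pis P. rounds \<sigma> (curry g) s t ps {} = Some (pis, P) \<and>
     (\<forall>i\<in>{1..<k}. cs i \<in> pis i) \<and> l < card (pis k) \<and> (\<forall>C\<in>pis k. \<not> compatible (curry g) s k (earlier cs k) C))"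
      unfolding rounds_cong[OF same_cmp_compat[OF sc] fam] by (intro ex_cong1 conj_cong refl)
  qed
  show ?thesis by measurable
qed

text \<open>A union bound over the failing round (n + 1 values), the class without compatible clique
  (20 values) and the up to 19 parts chosen before it (at most n + 1 values each).\<close>

lemma prob_bad2:
  assumes hq: "20 * real s * exp (- (real s / 12800)) \<le> 1/2" and fam: "families ps"
  shows "\<P>(f in M. bad2 ps l (curry f)) \<le> 20 * (real n + 1) ^ 20 * (1/2) ^ l"
proof -
  let ?F = "PiE {1..<20::nat} (\<lambda>i. insert {} (ps i))"
  let ?V = "{0..n} \<times> {1..20::nat} \<times> ?F"
  let ?B = "\<lambda>(t, k, cs) f. bounded_by_1 f \<and> (\<exists>pis P. rounds \<sigma> (curry f) s t ps {} = Some (pis, P) \<and>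
     (\<forall>i\<in>{1..<k}. cs i \<in> pis i) \<and> l < card (pis k) \<and> (\<forall>C\<in>pis k. \<not> compatible (curry f) s k (earlier cs k) C))"
  have fin: "finite (insert {} (ps i))" if "i \<in> {1..<20}" for i
    using families_finite[OF fam, of i] that by simp
  have mb: "Measurable.pred M (\<lambda>f. bad2 ps l (curry f))"
    by (rule measurable_same_cmp) (rule bad2_cong[OF same_cmp_compat fam])
  have "\<P>(f in M. bad2 ps l (curry f)) = \<P>(f in M. bounded_by_1 f \<and> bad2 ps l (curry f))"
    by (rule prob_bounded[OF mb])
  also have "\<dots> \<le> card ?V * (1/2) ^ l"
  proof (rule prob_union_bound[where B = ?B])
    show "finite ?V" using fin by (intro finite_cartesian_product finite_PiE) auto
    fix v assume "v \<in> ?V"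
    then obtain t k cs where v: "v = (t, k, cs)" "k \<in> {1..20}" by blast
    show "\<P>(f in M. ?B v f) \<le> (1/2) ^ l"
      unfolding v(1) prod.case by (rule prob_bad2_fixed[OF hq fam v(2) refl])
    show "Measurable.pred M (?B v)"
      unfolding v(1) prod.case by (rule measurable_bad2_fixed[OF fam v(2)])
  next
    fix f assume f: "bounded_by_1 f \<and> bad2 ps l (curry f)"
    then obtain t pis P where r: "rounds \<sigma> (curry f) s t ps {} = Some (pis, P)"
      "fst (round \<sigma> (curry f) s pis P {}) = None" "\<forall>k\<in>{1..20}. l < card (pis k)" unfolding bad2_def by blast
    have st: "state ps pis P" "card P = t" using rounds_state[OF r(1) state_init[OF fam]] by simp_all
    have fp: "families pis" by (rule state_families[OF st(1)])
    have tn: "t \<le> n" using state_card[OF st(1), of 1] families_card[OF fam, of 1] st(2) by simp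
    from round_NoneD[OF r(2)] obtain cs k where k: "k \<in> {1..20}"
      "\<forall>i\<in>{1..<k}. selected \<sigma> (curry f) s pis P cs i"
      "\<forall>C\<in>set (ord2 \<sigma> k P (pis k) (earlier cs k)). \<not> compatible (curry f) s k (earlier cs k) C" by blast
    have csp: "cs i \<in> pis i" if "i \<in> {1..<k}" for i
      by (rule selected_mem[OF fp]) (use k(1,2) that in auto)
    \<comment> \<open>Normalised so as to range over a finite set of functions. The failing class is
      at most 20, so parts of class 20 never occur in the prefix.\<close>
    define cs' where "cs' = (\<lambda>i. if i \<in> {1..<20} then (if i < k then cs i else {}) else undefined)"
    have e: "earlier cs' k = earlier cs k"
      unfolding earlier_def by (rule SUP_cong[OF refl]) (use k(1) in \<open>auto simp: cs'_def\<close>)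
    have "cs' \<in> ?F"
    proof (rule PiE_I)
      fix i assume i: "i \<in> {1..<20::nat}"
      then have i': "i \<in> {1..20}" by simp
      show "cs' i \<in> insert {} (ps i)"
      proof (cases "i < k")
        case True
        then have "cs i \<in> ps i" using csp[of i] state_sub[OF st(1) i'] i by auto
        then show ?thesis unfolding cs'_def using i True by simp
      qed (use i in \<open>simp add: cs'_def\<close>)
    next
      fix i assume "i \<notin> {1..<20::nat}"
      then show "cs' i = undefined" unfolding cs'_def by (simp only: if_False)
    qed
    then have V: "(t, k, cs') \<in> ?V" using tn k(1) by (intro SigmaI) simp_all
    have "\<forall>i\<in>{1..<k}. cs' i \<in> pis i" using csp k(1) by (auto simp: cs'_def)
    moreover have "\<forall>C\<in>pis k. \<not> compatible (curry f) s k (earlier cs' k) C"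
      using k(3) unfolding e ord2[OF families_finite[OF fp k(1)]] .
    moreover have "l < card (pis k)" using r(3) k(1) by blast
    ultimately have "?B (t, k, cs') f" unfolding prod.case using r(1) f by blast
    with V show "\<exists>v\<in>?V. ?B v f" by (rule bexI[rotated])
  qed
  also have "card ?V * (1/2) ^ l \<le> 20 * (real n + 1) ^ 20 * (1/2::real) ^ l"
  proof (rule mult_right_mono)
    have "card ?F = (\<Prod>i\<in>{1..<20}. card (insert {} (ps i)))" by (rule card_PiE) simp
    also have "\<dots> \<le> (\<Prod>i\<in>{1..<20::nat}. n + 1)"
    proof (rule prod_mono, rule conjI)
      fix i assume "i \<in> {1..<20::nat}"
      then have "i \<in> {1..20}" by simp
      from families_card[OF fam this] show "card (insert {} (ps i)) \<le> n + 1"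
        using families_finite[OF fam \<open>i \<in> {1..20}\<close>] by (simp add: card_insert_if)
    qed simp
    also have "\<dots> = (n + 1) ^ 19" by simp
    finally have "(n + 1) * (20 * card ?F) \<le> (n + 1) * (20 * (n + 1) ^ 19)"
      by (intro mult_le_mono order_refl)
    moreover have "card ?V = (n + 1) * (20 * card ?F)"
      by (simp only: card_cartesian_product card_atLeastAtMost) simp
    ultimately have "card ?V \<le> (n + 1) * (20 * (n + 1) ^ 19)" by (simp only:)
    then have "real (card ?V) \<le> real ((n + 1) * (20 * (n + 1) ^ 19))" by (rule of_nat_mono)
    also have "\<dots> = 20 * ((real n + 1) * (real n + 1) ^ 19)" by (simp add: algebra_simps)
    also have "(real n + 1) * (real n + 1) ^ 19 = (real n + 1) ^ 20" by (simp flip: power_Suc)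
    finally show "real (card ?V) \<le> 20 * (real n + 1) ^ 20" .
  qed simp
  finally show ?thesis .
qed

text \<open>Four independent requirements: the clauses of compatibility that concern the other
  agents hold with probability at least 1/2; the utilities of \<open>x\<close> for a block
  \<open>J\<close> of 2 s members of \<open>T\<close> add up to at least s, with probability at
  least \<open>(1/2) ^ (2 * s) / 2\<close>; and the utilities of \<open>x\<close> for the rest of
  the prefix and for the rest of \<open>T\<close> outside class k have nonnegative sums, with
  probability at least 1/2 each. The product is \<open>(1/2) ^ (2 * s + 4)\<close>.\<close>

lemma prob_good:
  assumes hq: "20 * real s * exp (- (real s / 12800)) \<le> 1/2"
    and T: "T \<subseteq> {0..<n}" "\<And>j. j \<in> {1..20} \<Longrightarrow> card (T \<inter> N j) = s" and k: "k \<in> {1..20}"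
    and x: "x \<in> N k" "x \<notin> T" and D: "D \<subseteq> N k" "D \<inter> T = {}" "D = {} \<or> card D = s"
  shows "(1/2) ^ (2 * s + 4) \<le> \<P>(f in M. good (curry f) x D k T)"
proof -
  let ?X = "prefix T k"
  \<comment> \<open>Two classes on the same side of k. Then \<open>J\<close> lies wholly inside the
    prefix or wholly outside it, and in both cases the block sums force a nonnegative utility of
    \<open>x\<close> for the prefix.\<close>
  let ?a = "if 3 \<le> k then 1 else 3 :: nat" and ?b = "if 3 \<le> k then 2 else 4 :: nat"
  define J where "J = (T \<inter> N ?a) \<union> (T \<inter> N ?b)"
  let ?E = "T - N k - ?X"
  have ab: "?a \<in> {1..20}" "?b \<in> {1..20}" "?a \<noteq> ?b" "?a \<noteq> k" "?b \<noteq> k" using k by auto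
  have fT: "finite T" using T(1) finite_subset[of T "{0..<n}"] by simp
  have k20: "j \<in> {1..20}" if "j \<in> {1..<k}" for j using that k by auto
  have XN: "?X \<inter> N k = {}"
  proof -
    have "N j \<inter> N k = {}" if "j \<in> {1..<k}" for j by (rule N_disjoint[OF k20[OF that] k]) (use that in simp)
    then show ?thesis unfolding prefix_def by blast
  qed
  have XT: "?X \<subseteq> T" unfolding prefix_def by blast
  have JT: "J \<subseteq> T - N k" unfolding J_def using N_disjoint[OF ab(1) k ab(4)] N_disjoint[OF ab(2) k ab(5)] by blast
  have cJ: "card J = 2 * s"
  proof -
    have "card J = card (T \<inter> N ?a) + card (T \<inter> N ?b)"
      unfolding J_def by (rule card_Un_disjoint) (use fT N_disjoint[OF ab(1,2,3)] in auto)
    then show ?thesis using T(2)[OF ab(1)] T(2)[OF ab(2)] by simp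
  qed
  have JX: "J \<subseteq> ?X \<or> J \<inter> ?X = {}"
  proof (cases "3 \<le> k")
    case True
    then have "?a \<in> {1..<k}" "?b \<in> {1..<k}" by auto
    then show ?thesis unfolding prefix_def J_def by blast
  next
    case False
    have "N j \<inter> N ?a = {} \<and> N j \<inter> N ?b = {}" if "j \<in> {1..<k}" for j
    proof
      show "N j \<inter> N ?a = {}" by (rule N_disjoint[OF k20[OF that] ab(1)]) (use that False in auto)
      show "N j \<inter> N ?b = {}" by (rule N_disjoint[OF k20[OF that] ab(2)]) (use that False in auto)
    qed
    then show ?thesis unfolding prefix_def J_def by blast
  qed
  have cX: "card ?X = (k - 1) * s"
  proof -
    have "?X = (\<Union>j\<in>{1..<k}. T \<inter> N j)" unfolding prefix_def by blast
    then have "card ?X = card (\<Union>j\<in>{1..<k}. T \<inter> N j)" by (rule arg_cong)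
    also have "\<dots> = (\<Sum>j\<in>{1..<k}. card (T \<inter> N j))"
    proof (rule card_UN_disjoint; (intro ballI impI)?)
      show "finite (T \<inter> N j)" for j using fT by simp
      show "(T \<inter> N i) \<inter> (T \<inter> N j) = {}" if "i \<in> {1..<k}" "j \<in> {1..<k}" "i \<noteq> j" for i j
        using N_disjoint[OF k20[OF that(1)] k20[OF that(2)] that(3)] by blast
    qed simp
    also have "\<dots> = (\<Sum>j\<in>{1..<k}. s)" by (rule sum.cong[OF refl]) (rule T(2)[OF k20])
    finally show ?thesis by simp
  qed
  have xn: "x < n" using x(1) N_subset[OF k] by auto
  have Dn: "D \<subseteq> {0..<n}" by (rule subset_trans[OF D(1) N_subset[OF k]])
  have Xn: "?X \<subseteq> {0..<n}" by (rule subset_trans[OF XT T(1)])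
  let ?c = "real (k - 1) * real s / 80"
  \<comment> \<open>The clause on the utility of \<open>x\<close> for the prefix is left out: it
    uses the same entries as the block sums and will be derived from them. Without it, only pairs
    outside the row of \<open>x\<close> are read.\<close>
  let ?A = "\<lambda>f. (\<forall>a\<in>?X. - (real s / 80) \<le> util (curry f) a D) \<and> (\<forall>b\<in>D - {x}. - ?c \<le> util (curry f) b ?X)"
  let ?KA = "{(a, b). a \<in> ?X \<and> b \<in> D \<or> a \<in> D - {x} \<and> b \<in> ?X}"
  have mA: "Measurable.pred M ?A"
  proof (rule pred_intros_logic; rule pred_intros_finite(3))
    show "finite ?X" "finite (D - {x})" using Xn Dn finite_subset[of _ "{0..<n}"] by simp_all
    fix a assume "a \<in> ?X"
    then have "a < n" using Xn by auto
    note [measurable] = measurable_util[OF this Dn]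
    show "Measurable.pred M (\<lambda>f. - (real s / 80) \<le> util (curry f) a D)" by measurable
  next
    fix b assume "b \<in> D - {x}"
    then have "b < n" using Dn by auto
    note [measurable] = measurable_util[OF this Xn]
    show "Measurable.pred M (\<lambda>f. - ?c \<le> util (curry f) b ?X)" by measurable
  qed
  have dA: "dep ?KA ?A"
  proof (rule depI)
    fix f g :: "nat \<times> nat \<Rightarrow> real"
    assume eq: "\<And>j. j \<in> ?KA \<or> j \<notin> pairs n \<Longrightarrow> f j = g j"
    have "util (curry f) a D = util (curry g) a D" if "a \<in> ?X" for a
      by (rule util_cong) (use eq that in simp)
    moreover have "util (curry f) b ?X = util (curry g) b ?X" if "b \<in> D - {x}" for b
      by (rule util_cong) (use eq that in simp)
    ultimately show "?A f = ?A g" by simp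
  qed
  have pA: "1/2 \<le> \<P>(f in M. ?A f)"
  proof (cases "D = {} \<or> ?X = {}")
    case True
    then have "?A f" for f by (auto simp: util_def)
    then have "{f\<in>space M. ?A f} = space M" by blast
    then show ?thesis by (simp only: prob_space)
  next
    case False
    then have cD: "card D = s" using D(3) by blast
    have XD: "?X \<inter> D = {}" using XT D(2) by blast
    have mc: "Measurable.pred M (\<lambda>f. compatible (curry f) s k ?X D)" by (rule measurable_compatible[OF Xn Dn])
    have "1/2 \<le> 1 - \<P>(f in M. \<not> compatible (curry f) s k ?X D)"
      using prob_incompatible[OF hq Xn Dn XD cX cD k] by simp
    also have "\<P>(f in M. \<not> compatible (curry f) s k ?X D) = 1 - \<P>(f in M. compatible (curry f) s k ?X D)"
      by (rule prob_neg) (use mc in \<open>simp add: pred_def\<close>)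
    also have "1 - (1 - \<P>(f in M. compatible (curry f) s k ?X D)) = \<P>(f in M. compatible (curry f) s k ?X D)" by simp
    also have "\<dots> \<le> \<P>(f in M. ?A f)"
    proof (rule finite_measure_mono)
      show "{f \<in> space M. compatible (curry f) s k ?X D} \<subseteq> {f \<in> space M. ?A f}"
        using False unfolding compatible_def by blast
      show "{f \<in> space M. ?A f} \<in> sets M" using mA unfolding pred_def .
    qed
    finally show ?thesis .
  qed
  have xJ: "x \<notin> J" "x \<notin> ?X - J" "x \<notin> ?E - J" "x \<notin> ?X" using x(2) XT JT by blast+
  have sub: "Pair x ` B \<subseteq> pairs n" if "B \<subseteq> T" for B using that T(1) xn x(2) by (auto simp: pairs_def)
  have cP: "card (Pair x ` B) = card B" for B by (rule card_image) (simp add: inj_on_def)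
  let ?B = "\<lambda>J c f. c \<le> (\<Sum>j\<in>Pair x ` J. f j)"
  have subs: "J \<subseteq> T" "?X - J \<subseteq> T" "?E - J \<subseteq> T" using XT JT by blast+
  have mB: "Measurable.pred M (?B J c)" if "J \<subseteq> T" for J c by (rule pred_sum_ge[OF sub[OF that]])
  have dB: "dep (Pair x ` J) (?B J c)" for J c by (rule dep_sum)
  have pB1: "(1/2) ^ (2 * s) / 2 \<le> \<P>(f in M. ?B J (real s) f)"
    using prob_sum_ge_half_card[OF sub[OF subs(1)]] unfolding cP cJ by simp
  have pB2: "1/2 \<le> \<P>(f in M. ?B (?X - J) 0 f)" by (rule prob_sum_nonneg[OF sub[OF subs(2)]])
  have pB3: "1/2 \<le> \<P>(f in M. ?B (?E - J) 0 f)" by (rule prob_sum_nonneg[OF sub[OF subs(3)]])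
  let ?B23 = "\<lambda>f. ?B (?X - J) 0 f \<and> ?B (?E - J) 0 f"
  let ?B123 = "\<lambda>f. ?B J (real s) f \<and> ?B23 f"
  have m23: "Measurable.pred M ?B23" using mB[OF subs(2)] mB[OF subs(3)] by (rule pred_intros_logic)
  have m123: "Measurable.pred M ?B123" using mB[OF subs(1)] m23 by (rule pred_intros_logic)
  have d23: "dep (Pair x ` (?X - J) \<union> Pair x ` (?E - J)) ?B23"
    by (rule dep_conj[OF dB dB])
  have d123: "dep (Pair x ` J \<union> (Pair x ` (?X - J) \<union> Pair x ` (?E - J))) ?B123"
    by (rule dep_conj[OF dB d23])
  have p23: "\<P>(f in M. ?B23 f) = \<P>(f in M. ?B (?X - J) 0 f) * \<P>(f in M. ?B (?E - J) 0 f)"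
    by (rule prob_indep[OF mB[OF subs(2)] dB mB[OF subs(3)] dB]) blast
  have p123: "\<P>(f in M. ?B123 f) = \<P>(f in M. ?B J (real s) f) * \<P>(f in M. ?B23 f)"
    by (rule prob_indep[OF mB[OF subs(1)] dB m23 d23]) blast
  have pall: "\<P>(f in M. ?A f \<and> ?B123 f) = \<P>(f in M. ?A f) * \<P>(f in M. ?B123 f)"
    by (rule prob_indep[OF mA dA m123 d123]) (use xJ(4) in blast)
  have "(1/2::real) ^ (2 * s + 4) = (1/2) * ((1/2) ^ (2 * s) / 2 * ((1/2) * (1/2)))"
    by (simp add: power_add eval_nat_numeral)
  also have "\<dots> \<le> \<P>(f in M. ?A f) * (\<P>(f in M. ?B J (real s) f) * (\<P>(f in M. ?B (?X - J) 0 f) * \<P>(f in M. ?B (?E - J) 0 f)))"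
    by (intro mult_mono pA pB1 pB2 pB3 mult_nonneg_nonneg measure_nonneg) simp_all
  also have "\<dots> = \<P>(f in M. ?A f \<and> ?B123 f)" unfolding pall p123 p23 by (rule refl)
  also have "\<dots> \<le> \<P>(f in M. good (curry f) x D k T)"
  proof (rule finite_measure_mono)
    have "T - N k \<subseteq> {0..<n}" using T(1) by blast
    note [measurable] = measurable_util[OF xn this] measurable_compatible[OF Xn Dn, of k]
    have "Measurable.pred M (\<lambda>f. good (curry f) x D k T)" unfolding good_def by measurable
    then show "{f \<in> space M. good (curry f) x D k T} \<in> sets M" unfolding pred_def .
    show "{f \<in> space M. ?A f \<and> ?B123 f} \<subseteq> {f \<in> space M. good (curry f) x D k T}"
    proof
      fix f assume "f \<in> {f \<in> space M. ?A f \<and> ?B123 f}"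
      then have f: "f \<in> space M" and A: "?A f" and B: "?B J (real s) f" "?B (?X - J) 0 f" "?B (?E - J) 0 f" by blast+
      let ?u = "util (curry f) x"
      have u: "real s \<le> ?u J" "0 \<le> ?u (?X - J)" "0 \<le> ?u (?E - J)"
        unfolding util_row[OF xJ(1)] util_row[OF xJ(2)] util_row[OF xJ(3)] using B by blast+
      have fin: "finite J" "finite (?X - J)" "finite (?E - J)" using fT subs finite_subset[of _ T] by auto
      have "?u (J \<union> ((?X - J) \<union> (?E - J))) = ?u J + (?u (?X - J) + ?u (?E - J))"
        by (subst util_union, use fin in simp, use fin in simp, blast, subst util_union[OF fin(2,3)], blast, rule refl)
      moreover have "J \<union> ((?X - J) \<union> (?E - J)) = T - N k" using JT XT XN by blast
      ultimately have "?u (T - N k) = ?u J + (?u (?X - J) + ?u (?E - J))" by (simp only:)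
      then have uT: "real s \<le> ?u (T - N k)" using u by linarith
      have uX: "- ?c \<le> ?u ?X"
      proof -
        have c0: "0 \<le> ?c" by simp
        from JX show ?thesis
        proof
          assume "J \<subseteq> ?X"
          then have "?X = J \<union> (?X - J)" by blast
          then have "?u ?X = ?u (J \<union> (?X - J))" by (rule arg_cong)
          also have "\<dots> = ?u J + ?u (?X - J)" by (rule util_union[OF fin(1,2)]) blast
          finally show ?thesis using u c0 by linarith
        next
          assume "J \<inter> ?X = {}"
          then have "?X - J = ?X" by blast
          then have "0 \<le> ?u ?X" using u(2) by (simp only:)
          then show ?thesis using c0 by linarith
        qed
      qed
      have "compatible (curry f) s k ?X D"
        unfolding compatible_def
      proof (intro ballI conjI)
        fix a b assume ab: "a \<in> ?X" "b \<in> D"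
        show "- (real s / 80) \<le> util (curry f) a D" using A ab(1) by blast
        show "- ?c \<le> util (curry f) b ?X" using A ab(2) uX by (cases "b = x") blast+
      qed
      then show "f \<in> {f \<in> space M. good (curry f) x D k T}" using f uT unfolding good_def by blast
    qed
  qed
  finally show ?thesis .
qed

section \<open>Failure of placement and missing objectors for a fixed outcome of Stage 1\<close>

definition bad3_at :: "(nat \<Rightarrow> nat set set) \<Rightarrow> nat \<Rightarrow> nat \<Rightarrow> nat \<Rightarrow> nat \<Rightarrow> nat set \<Rightarrow> utility \<Rightarrow> bool" where
  "bad3_at ps m r k x D u \<longleftrightarrow> (\<exists>pis P. rounds \<sigma> u s m ps {} = Some (pis, P) \<and> k \<in> {1..20} \<and> x \<in> N k \<and>
     (D \<in> pis k \<and> x \<in> D \<or> D = {} \<and> x \<notin> \<Union>(ps k)) \<and> card {T\<in>P. good u x D k T} < r)"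

text \<open>The member \<open>b0\<close> indexes the union bound: at most one merged coalition contains it.\<close>

definition bad4_at :: "(nat \<Rightarrow> nat set set) \<Rightarrow> nat \<Rightarrow> nat \<Rightarrow> nat \<Rightarrow> utility \<Rightarrow> bool" where
  "bad4_at ps i a b0 u \<longleftrightarrow> (\<exists>t pis P T. rounds \<sigma> u s t ps {} = Some (pis, P) \<and> T \<in> P \<and> i \<in> {1..20} \<and> a \<in> N i \<and>
     a \<notin> T \<and> b0 \<in> T \<and> (\<forall>b\<in>T - N i. 0 \<le> u b a))"

text \<open>Lies between two finer relations. Agreement in all comparisons (\<open>same_cmp\<close>)
  implies it and gives measurability of the failure events; agreement of the utilities between
  different classes (\<open>cross_similar\<close>) implies it too and gives their independence of
  Stage 1.\<close>

definition similar :: "utility \<Rightarrow> utility \<Rightarrow> bool" where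
  "similar u u' \<longleftrightarrow> same_compat u u' \<and>
    (\<forall>k x T. k \<in> {1..20} \<longrightarrow> x \<in> N k \<longrightarrow> T \<subseteq> {0..<n} \<longrightarrow> (real s \<le> util u x (T - N k)) = (real s \<le> util u' x (T - N k))) \<and>
    (\<forall>i a b. i \<in> {1..20} \<longrightarrow> a \<in> N i \<longrightarrow> b \<in> {0..<n} - N i \<longrightarrow> (0 \<le> u b a) = (0 \<le> u' b a))"

lemma similarD:
  assumes "similar u u'"
  shows "same_compat u u'"
    "k \<in> {1..20} \<Longrightarrow> x \<in> N k \<Longrightarrow> T \<subseteq> {0..<n} \<Longrightarrow> (real s \<le> util u x (T - N k)) = (real s \<le> util u' x (T - N k))"
    "i \<in> {1..20} \<Longrightarrow> a \<in> N i \<Longrightarrow> b \<in> {0..<n} - N i \<Longrightarrow> (0 \<le> u b a) = (0 \<le> u' b a)"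
proof -
  note * = assms[unfolded similar_def]
  show "same_compat u u'" by (rule *[THEN conjunct1])
  show "k \<in> {1..20} \<Longrightarrow> x \<in> N k \<Longrightarrow> T \<subseteq> {0..<n} \<Longrightarrow> (real s \<le> util u x (T - N k)) = (real s \<le> util u' x (T - N k))"
    by (rule *[THEN conjunct2, THEN conjunct1, rule_format])
  show "i \<in> {1..20} \<Longrightarrow> a \<in> N i \<Longrightarrow> b \<in> {0..<n} - N i \<Longrightarrow> (0 \<le> u b a) = (0 \<le> u' b a)"
    by (rule *[THEN conjunct2, THEN conjunct2, rule_format])
qed

lemma same_cmp_similar:
  assumes "same_cmp u u'" shows "similar u u'"
  unfolding similar_def
proof (intro conjI allI impI)
  show "same_compat u u'" by (rule same_cmp_compat[OF assms])
  fix k x T assume "k \<in> {1..20}" "x \<in> N k" "T \<subseteq> {0..<n}"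
  then have "x < n" "T - N k \<subseteq> {0..<n}" using N_subset[of k] by auto
  then show "(real s \<le> util u x (T - N k)) = (real s \<le> util u' x (T - N k))" by (rule same_cmp_util_ge[OF assms])
next
  fix i a b assume *: "i \<in> {1..20}" "a \<in> N i" "b \<in> {0..<n} - N i"
  then have ab: "a < n" "b < n" "a \<noteq> b" using N_subset[OF *(1)] by auto
  have "util v b {a} = v b a" "util v b {} = 0" for v using ab by (simp_all add: util_def)
  then show "(0 \<le> u b a) = (0 \<le> u' b a)"
    using same_cmp_util[OF assms ab(2), of "{a}" "{}"] ab(1) by auto
qed

definition cross :: "(nat \<times> nat) set" where
  "cross = {(a, b). \<exists>i\<in>{1..20}. \<exists>j\<in>{1..20}. i \<noteq> j \<and> a \<in> N i \<and> b \<in> N j}"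

lemma crossI: "i \<in> {1..20} \<Longrightarrow> j \<in> {1..20} \<Longrightarrow> i \<noteq> j \<Longrightarrow> a \<in> N i \<Longrightarrow> b \<in> N j \<Longrightarrow> (a, b) \<in> cross"
  unfolding cross_def mem_Collect_eq prod.case by (intro bexI[of _ i] bexI[of _ j] conjI)

lemma cross_similar:
  assumes "\<And>a b. (a, b) \<in> cross \<Longrightarrow> u a b = u' a b" shows "similar u u'"
  unfolding similar_def
proof (intro conjI allI impI)
  have c: "(a, b) \<in> cross \<and> (b, a) \<in> cross" if "i \<in> {1..20}" "a \<in> N i" "b \<in> {0..<n} - N i" for a b i
  proof -
    from that(3) have "b \<in> (\<Union>j\<in>{1..20}. N j)" "b \<notin> N i" unfolding N_union by blast+
    then obtain j where "j \<in> {1..20}" "b \<in> N j" "j \<noteq> i" by blast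
    then show ?thesis using crossI[of i j a b] crossI[of j i b a] that(1,2) by simp
  qed
  show "same_compat u u'" unfolding same_compat_def
  proof (intro ballI allI impI)
    fix k C A assume *: "k \<in> {1..20}" "C \<subseteq> N k" "A \<subseteq> (\<Union>j\<in>{1..<k}. N j)"
    show "compatible u s k A C = compatible u' s k A C"
    proof (rule compatible_cong)
      fix a b assume ab: "a \<in> A" "b \<in> C"
      obtain j where j: "j \<in> {1..<k}" "a \<in> N j" using ab(1) *(3) by blast
      then have "j \<in> {1..20}" "j \<noteq> k" using *(1) by auto
      then have "(a, b) \<in> cross" "(b, a) \<in> cross"
        using crossI[of j k a b] crossI[of k j b a] j(2) ab(2) *(1,2) by auto
      then show "u a b = u' a b \<and> u b a = u' b a" using assms by blast
    qed
  qed
  fix k x T assume *: "k \<in> {1..20}" "x \<in> N k" "T \<subseteq> {0..<n}"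
  have "util u x (T - N k) = util u' x (T - N k)"
  proof (rule util_cong)
    fix b assume "b \<in> T - N k"
    then have "b \<in> {0..<n} - N k" using *(3) by blast
    then show "u x b = u' x b" using c[OF *(1,2)] assms by blast
  qed
  then show "(real s \<le> util u x (T - N k)) = (real s \<le> util u' x (T - N k))" by (simp only:)
next
  fix i a b assume *: "i \<in> {1..20}" "a \<in> N i" "b \<in> {0..<n} - N i"
  from *(3) have "b \<in> (\<Union>j\<in>{1..20}. N j)" "b \<notin> N i" unfolding N_union by blast+
  then obtain j where "j \<in> {1..20}" "b \<in> N j" "j \<noteq> i" by blast
  then have "(b, a) \<in> cross" using crossI[of j i b a] *(1,2) by simp
  then show "(0 \<le> u b a) = (0 \<le> u' b a)" using assms by simp
qed

lemma bad3_at_cong: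
  assumes sim: "similar u u'" and fam: "families ps"
  shows "bad3_at ps m r k x D u = bad3_at ps m r k x D u'"
proof -
  note sc = similarD(1)[OF sim]
  have *: "{T\<in>P. good u x D k T} = {T\<in>P. good u' x D k T}"
    if r: "rounds \<sigma> u' s m ps {} = Some (pis, P)" and k: "k \<in> {1..20}" and x: "x \<in> N k"
      and D: "D \<in> pis k \<and> x \<in> D \<or> D = {} \<and> x \<notin> \<Union>(ps k)" for pis P k x D
  proof -
    have st: "state ps pis P" using rounds_state[OF r state_init[OF fam]] by blast
    have DN: "D \<subseteq> N k" using D familiesD(2)[OF state_families[OF st] k] by blast
    have "good u x D k T = good u' x D k T" if "T \<in> P" for T
    proof -
      have "prefix T k \<subseteq> (\<Union>j\<in>{1..<k}. N j)" unfolding prefix_def by blast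
      then have "compatible u s k (prefix T k) D = compatible u' s k (prefix T k) D"
        using sc[unfolded same_compat_def, rule_format, OF k DN] by blast
      moreover have "(real s \<le> util u x (T - N k)) = (real s \<le> util u' x (T - N k))"
        by (rule similarD(2)[OF sim k x stateD(4)[OF st that]])
      ultimately show ?thesis unfolding good_def by blast
    qed
    then show ?thesis by blast
  qed
  show ?thesis
    unfolding bad3_at_def rounds_cong[OF sc fam]
    by (intro ex_cong1 conj_cong refl) (simp only: *)
qed

lemma bad4_at_cong:
  assumes sim: "similar u u'" and fam: "families ps"
  shows "bad4_at ps i a b0 u = bad4_at ps i a b0 u'"
proof -
  note sc = similarD(1)[OF sim]
  have *: "(\<forall>b\<in>T - N i. 0 \<le> u b a) = (\<forall>b\<in>T - N i. 0 \<le> u' b a)"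
    if r: "rounds \<sigma> u' s t ps {} = Some (pis, P)" and T: "T \<in> P" and i: "i \<in> {1..20}" "a \<in> N i" for t pis P T i a
  proof (rule ball_cong[OF refl])
    fix b assume b: "b \<in> T - N i"
    have "state ps pis P" using rounds_state[OF r state_init[OF fam]] by blast
    from stateD(4)[OF this T] b have "b \<in> {0..<n} - N i" by blast
    then show "(0 \<le> u b a) = (0 \<le> u' b a)" by (rule similarD(3)[OF sim i])
  qed
  show ?thesis
    unfolding bad4_at_def rounds_cong[OF sc fam]
    by (intro ex_cong1 conj_cong refl) (rule *)
qed

lemma measurable_good:
  assumes "T \<subseteq> {0..<n}" "D \<subseteq> {0..<n}" "x < n"
  shows "Measurable.pred M (\<lambda>f. good (curry f) x D k T)"
proof -
  have X: "prefix T k \<subseteq> {0..<n}" "T - N k \<subseteq> {0..<n}" using assms(1) unfolding prefix_def by blast+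
  note [measurable] = measurable_compatible[OF X(1) assms(2), of k] measurable_util[OF assms(3) X(2)]
  show ?thesis unfolding good_def by measurable
qed

lemma dep_good:
  "dep {(a, b). a \<in> insert x D \<and> b \<in> T \<or> a \<in> T \<and> b \<in> insert x D} (\<lambda>f. good (curry f) x D k T)"
    (is "dep ?K _")
proof (rule depI)
  fix f g :: "nat \<times> nat \<Rightarrow> real"
  assume eq: "\<And>j. j \<in> ?K \<or> j \<notin> pairs n \<Longrightarrow> f j = g j"
  have "compatible (curry f) s k (prefix T k) D = compatible (curry g) s k (prefix T k) D"
    by (rule compatible_cong) (use eq in \<open>simp add: prefix_def\<close>)
  moreover have "util (curry f) x (T - N k) = util (curry g) x (T - N k)"
    by (rule util_cong) (use eq in simp)
  ultimately show "good (curry f) x D k T = good (curry g) x D k T" unfolding good_def by simp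
qed

text \<open>The set \<open>c\<close> of coalitions merged in \<open>m\<close> rounds is read off the
  run with ghost utilities for \<open>insert x D\<close>. For distinct members of \<open>c\<close>
  the pairs joining them to \<open>insert x D\<close> are disjoint and fresh, so the good coalitions
  are counted by independent trials with the success probability from
  \<open>prob_good\<close>.\<close>

lemma prob_bad3_at:
  assumes hq: "20 * real s * exp (- (real s / 12800)) \<le> 1/2" and fam: "families ps"
  shows "\<P>(f in M. bounded_by_1 f \<and> bad3_at ps m r k x D (curry f)) \<le> 2 ^ r * (1 - (1/2) ^ (2 * s + 4) / 2) ^ m"
    (is "_ \<le> ?e")
proof (cases "k \<in> {1..20} \<and> x \<in> N k \<and> (D \<in> ps k \<and> x \<in> D \<or> D = {} \<and> x \<notin> \<Union>(ps k))")
  case False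
  have e0: "0 \<le> ?e" by (intro mult_nonneg_nonneg zero_le_power) (use power_le_one[of "1/2::real" "2 * s + 4"] in auto)
  have "\<not> bad3_at ps m r k x D u" for u
  proof
    assume "bad3_at ps m r k x D u"
    then obtain pis P where b: "rounds \<sigma> u s m ps {} = Some (pis, P)" "k \<in> {1..20}" "x \<in> N k"
      "D \<in> pis k \<and> x \<in> D \<or> D = {} \<and> x \<notin> \<Union>(ps k)" unfolding bad3_at_def by blast
    have "state ps pis P" using rounds_state[OF b(1) state_init[OF fam]] by blast
    from state_sub[OF this b(2)] show False using False b(2-4) by blast
  qed
  then have "{f\<in>space M. bounded_by_1 f \<and> bad3_at ps m r k x D (curry f)} = {}" by blast
  then show ?thesis using e0 by (simp only: measure_empty)
next
  case True
  then have k: "k \<in> {1..20}" and x: "x \<in> N k" and D: "D \<in> ps k \<and> x \<in> D \<or> D = {} \<and> x \<notin> \<Union>(ps k)" by blast+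
  have DN: "D \<subseteq> N k" "D = {} \<or> card D = s" using D familiesD(2,3)[OF fam k] by blast+
  have Dn: "D \<subseteq> {0..<n}" by (rule subset_trans[OF DN(1) N_subset[OF k]])
  have xn: "x < n" using x N_subset[OF k] by auto
  let ?D = "insert x D"
  let ?valid = "\<lambda>c. (\<exists>pis. state ps pis c) \<and> card c = m \<and> (\<forall>T\<in>c. T \<inter> ?D = {})"
  let ?G = "\<lambda>c f. \<exists>pis. rounds \<sigma> (curry (ghost ?D f)) s m ps {} = Some (pis, c)"
  let ?few = "\<lambda>c f. card {T\<in>c. good (curry f) x D k T} < r"
  let ?K = "\<lambda>T. {(a, b). a \<in> ?D \<and> b \<in> T \<or> a \<in> T \<and> b \<in> ?D}"
  show ?thesis
  proof (rule prob_by_indep_value[where V = "{c \<in> Pow (Pow {0..<n}). ?valid c}" and G = ?G and B = ?few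
        and J = "\<lambda>_. {(a, b). a \<notin> ?D \<and> b \<notin> ?D}" and K = "\<lambda>c. \<Union>T\<in>c. ?K T"])
    show "finite {c \<in> Pow (Pow {0..<n}). ?valid c}" by simp
    show "0 \<le> ?e" by (intro mult_nonneg_nonneg zero_le_power) (use power_le_one[of "1/2::real" "2 * s + 4"] in auto)
    fix c assume "c \<in> {c \<in> Pow (Pow {0..<n}). ?valid c}"
    then obtain pis where c: "c \<subseteq> Pow {0..<n}" "state ps pis c" "card c = m" "\<And>T. T \<in> c \<Longrightarrow> T \<inter> ?D = {}" by blast
    have fc: "finite c" by (rule stateD(2)[OF c(2)])
    have Tn: "T \<subseteq> {0..<n}" if "T \<in> c" for T using that c(1) by blast
    show "Measurable.pred M (?G c)"
      by (rule measurable_ghost_rounds[OF fam, where Q = "\<lambda>r. \<exists>pis. r = Some (pis, c)"])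
    show "dep {(a, b). a \<notin> ?D \<and> b \<notin> ?D} (?G c)"
      by (rule dep_ghost[where Q = "\<lambda>f. \<exists>pis. rounds \<sigma> (curry f) s m ps {} = Some (pis, c)"])
    show "Measurable.pred M (?few c)"
      by (rule pred_card_less[OF fc measurable_good[OF Tn Dn xn]])
    show "dep (\<Union>T\<in>c. ?K T) (?few c)" by (rule dep_card_less) (rule dep_good)
    show "{(a, b). a \<notin> ?D \<and> b \<notin> ?D} \<inter> (\<Union>T\<in>c. ?K T) = {}" by blast
    have "\<P>(f in M. ?few c f) \<le> 2 ^ r * (1 - (1/2) ^ (2 * s + 4) / 2) ^ card c"
    proof (rule prob_few_successes[OF fc measurable_good[OF Tn Dn xn] dep_good])
      show "disjoint_family_on ?K c" unfolding disjoint_family_on_def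
      proof (intro ballI impI)
        fix T T' assume TT: "T \<in> c" "T' \<in> c" "T \<noteq> T'"
        have "T \<inter> T' = {}" by (rule disjointD[OF stateD(3)[OF c(2)] TT])
        moreover have "T \<inter> ?D = {}" "T' \<inter> ?D = {}" using c(4) TT by blast+
        ultimately show "?K T \<inter> ?K T' = {}" by blast
      qed
      show "(1/2::real) ^ (2 * s + 4) \<le> 1" by (rule power_le_one) auto
      fix T assume T: "T \<in> c"
      show "(1/2) ^ (2 * s + 4) \<le> \<P>(f in M. good (curry f) x D k T)"
      proof (rule prob_good[OF hq Tn[OF T] _ k x _ DN(1) _ DN(2)])
        show "card (T \<inter> N j) = s" if "j \<in> {1..20}" for j by (rule state_part_card[OF c(2) T that])
        show "x \<notin> T" "D \<inter> T = {}" using c(4)[OF T] by blast+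
      qed
    qed
    then show "\<P>(f in M. ?few c f) \<le> ?e" unfolding c(3) .
  next
    fix f assume f: "bounded_by_1 f \<and> bad3_at ps m r k x D (curry f)"
    then obtain pis P where b: "rounds \<sigma> (curry f) s m ps {} = Some (pis, P)"
      "D \<in> pis k \<and> x \<in> D \<or> D = {} \<and> x \<notin> \<Union>(ps k)" "card {T\<in>P. good (curry f) x D k T} < r"
      unfolding bad3_at_def by blast
    have st: "state ps pis P" and cP: "card P = m" using rounds_state[OF b(1) state_init[OF fam]] by simp_all
    \<comment> \<open>A free clique is disjoint from all merged coalitions; an agent outside all
      cliques cannot lie in \<open>T\<close>, whose trace on each class is a clique of the
      family.\<close>
    have dis: "T \<inter> ?D = {}" if T: "T \<in> P" for T
      using b(2)
    proof (elim disjE conjE)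
      assume "D \<in> pis k" "x \<in> D"
      then show ?thesis using state_disjoint_rest[OF st k _ T] by blast
    next
      assume "D = {}" "x \<notin> \<Union>(ps k)"
      moreover have "T \<inter> N k \<in> ps k" using state_part[OF st T k] by blast
      ultimately show ?thesis using x by blast
    qed
    have "rounds \<sigma> (curry (ghost ?D f)) s m ps {} = Some (pis, P)"
      by (rule rounds_ghost[OF b(1) fam]) (use f dis in blast)+
    then have "?G P f" by blast
    moreover have "P \<subseteq> Pow {0..<n}" using stateD(4)[OF st] by blast
    ultimately show "\<exists>c\<in>{c \<in> Pow (Pow {0..<n}). ?valid c}. ?G c f \<and> ?few c f"
      using st cP dis b(3) by (intro bexI[of _ P]) blast+
  next
    fix c c' f assume "?G c f" "?G c' f"
    then show "c = c'" by auto
  qed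
qed

lemma prob_bad3:
  assumes hq: "20 * real s * exp (- (real s / 12800)) \<le> 1/2" and fam: "families ps"
  shows "\<P>(f in M. \<exists>k x D. bad3_at ps m r k x D (curry f)) \<le>
    400 * (real n + 1)\<^sup>2 * (2 ^ r * (1 - (1/2) ^ (2 * s + 4) / 2) ^ m)" (is "_ \<le> _ * ?e")
proof -
  let ?V = "{1..20::nat} \<times> {0..<n} \<times> (insert {} (\<Union>k\<in>{1..20}. ps k))"
  have fps: "finite (\<Union>k\<in>{1..20}. ps k)" by (rule finite_UN_I) (use families_finite[OF fam] in auto)
  have m3: "Measurable.pred M (\<lambda>f. bad3_at ps m r k x D (curry f))" for k x D
    by (rule measurable_same_cmp) (rule bad3_at_cong[OF same_cmp_similar fam])
  have me: "Measurable.pred M (\<lambda>f. \<exists>k x D. bad3_at ps m r k x D (curry f))"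
  proof (rule measurable_same_cmp)
    fix f g assume "same_cmp (curry f) (curry g)"
    from bad3_at_cong[OF same_cmp_similar[OF this] fam]
    show "(\<exists>k x D. bad3_at ps m r k x D (curry f)) = (\<exists>k x D. bad3_at ps m r k x D (curry g))" by simp
  qed
  have "\<P>(f in M. \<exists>k x D. bad3_at ps m r k x D (curry f))
     = \<P>(f in M. bounded_by_1 f \<and> (\<exists>k x D. bad3_at ps m r k x D (curry f)))" by (rule prob_bounded[OF me])
  also have "\<dots> \<le> card ?V * ?e"
  proof (rule prob_union_bound[where B = "\<lambda>(k, x, D) f. bounded_by_1 f \<and> bad3_at ps m r k x D (curry f)"])
    show "finite ?V" using fps by simp
    fix v assume "v \<in> ?V"
    obtain k x D where v: "v = (k, x, D)" by (metis prod_cases3)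
    show "\<P>(f in M. (\<lambda>(k, x, D) f. bounded_by_1 f \<and> bad3_at ps m r k x D (curry f)) v f) \<le> ?e"
      unfolding v prod.case by (rule prob_bad3_at[OF hq fam])
    show "Measurable.pred M ((\<lambda>(k, x, D) f. bounded_by_1 f \<and> bad3_at ps m r k x D (curry f)) v)"
      unfolding v prod.case by (rule pred_intros_logic(3)[OF measurable_bounded m3])
  next
    fix f assume f: "bounded_by_1 f \<and> (\<exists>k x D. bad3_at ps m r k x D (curry f))"
    then obtain k x D where b: "bad3_at ps m r k x D (curry f)" by blast
    then obtain pis P where c: "rounds \<sigma> (curry f) s m ps {} = Some (pis, P)" "k \<in> {1..20}" "x \<in> N k"
      "D \<in> pis k \<and> x \<in> D \<or> D = {} \<and> x \<notin> \<Union>(ps k)" unfolding bad3_at_def by blast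
    have st: "state ps pis P" using rounds_state[OF c(1) state_init[OF fam]] by blast
    have "D \<in> insert {} (\<Union>k\<in>{1..20}. ps k)" using c(2,4) state_sub[OF st c(2)] by blast
    moreover have "x \<in> {0..<n}" using c(3) N_subset[OF c(2)] by blast
    ultimately have "(k, x, D) \<in> ?V" using c(2) by (intro SigmaI)
    then show "\<exists>v\<in>?V. (\<lambda>(k, x, D) f. bounded_by_1 f \<and> bad3_at ps m r k x D (curry f)) v f"
      by (rule bexI[rotated]) (use f b in simp)
  qed
  also have "card ?V * ?e \<le> 400 * (real n + 1)\<^sup>2 * ?e"
  proof (rule mult_right_mono)
    \<comment> \<open>20 classes, n agents and at most 20 n cliques together with the empty set give
      the factor 20 n (20 n + 1).\<close>
    have "card (\<Union>k\<in>{1..20}. ps k) \<le> (\<Sum>k\<in>{1..20::nat}. card (ps k))" by (rule card_UN_le) simp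
    also have "\<dots> \<le> (\<Sum>k\<in>{1..20::nat}. n)" by (rule sum_mono) (rule families_card[OF fam])
    finally have "card (insert {} (\<Union>k\<in>{1..20}. ps k)) \<le> 20 * n + 1" using fps by (simp add: card_insert_if)
    then have "20 * (n * card (insert {} (\<Union>k\<in>{1..20}. ps k))) \<le> 20 * (n * (20 * n + 1))"
      by (intro mult_le_mono order_refl)
    moreover have "card ?V = 20 * (n * card (insert {} (\<Union>k\<in>{1..20}. ps k)))"
      by (simp only: card_cartesian_product card_atLeastAtMost card_atLeastLessThan) simp
    ultimately have "card ?V \<le> 20 * (n * (20 * n + 1))" by (simp only:)
    then have "real (card ?V) \<le> real (20 * (n * (20 * n + 1)))" by (rule of_nat_mono)
    also have "\<dots> \<le> 400 * (real n + 1)\<^sup>2" by (simp add: power2_eq_square algebra_simps)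
    finally show "real (card ?V) \<le> 400 * (real n + 1)\<^sup>2" .
    show "0 \<le> ?e" by (intro mult_nonneg_nonneg zero_le_power) (use power_le_one[of "1/2::real" "2 * s + 4"] in auto)
  qed
  finally show ?thesis .
qed

lemma state_card_coalition:
  assumes "state ps pis P" "T \<in> P" "i \<in> {1..20}"
  shows "card (T - N i) = 19 * s"
proof -
  have Tn: "T \<subseteq> {0..<n}" by (rule stateD(4)[OF assms(1,2)])
  then have fT: "finite T" using finite_subset[of T "{0..<n}"] by simp
  have "T = (\<Union>j\<in>{1..20}. T \<inter> N j)" using Tn unfolding N_union[symmetric] by blast
  then have "card T = card (\<Union>j\<in>{1..20}. T \<inter> N j)" by (rule arg_cong)
  also have "\<dots> = (\<Sum>j\<in>{1..20}. card (T \<inter> N j))"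
  proof (rule card_UN_disjoint; (intro ballI impI)?)
    show "finite (T \<inter> N j)" for j using fT by simp
    show "(T \<inter> N i) \<inter> (T \<inter> N j) = {}" if "i \<in> {1..20}" "j \<in> {1..20}" "i \<noteq> j" for i j
      using N_disjoint[OF that] by blast
  qed simp
  also have "\<dots> = (\<Sum>j\<in>{1..20::nat}. s)" by (rule sum.cong[OF refl]) (rule state_part_card[OF assms(1,2)])
  finally have "card T = 20 * s" by simp
  then show ?thesis using card_Diff_subset_Int[of T "N i"] fT state_part_card[OF assms] by simp
qed

text \<open>The shorter history is an initial segment of the longer one, and merged coalitions are
  never dissolved, so both coalitions belong to one disjoint family. A member thus determines its
  coalition, whatever the number of rounds.\<close>

lemma formed_unique:
  assumes "rounds \<sigma> u s t ps {} = Some (pis, P)" "rounds \<sigma> u s t' ps {} = Some (pis', P')" "families ps"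
    and "T \<in> P" "T' \<in> P'" "b \<in> T" "b \<in> T'"
  shows "T = T'"
proof -
  have aux: "T = T'" if le: "t \<le> t'" and r: "rounds \<sigma> u s t ps {} = Some (pis, P)" "rounds \<sigma> u s t' ps {} = Some (pis', P')"
    and T: "T \<in> P" "T' \<in> P'" "b \<in> T" "b \<in> T'" for t t' pis pis' P P' T T'
  proof -
    have "rounds \<sigma> u s (t + (t' - t)) ps {} = Some (pis', P')" using r(2) le by simp
    then obtain pis1 P1 where r1: "rounds \<sigma> u s t ps {} = Some (pis1, P1)" "rounds \<sigma> u s (t' - t) pis1 P1 = Some (pis', P')"
      by (rule rounds_add)
    have eq: "pis1 = pis" "P1 = P" using r1(1) r(1) by simp_all
    have "P \<subseteq> P'" using rounds_state[OF r1(2)] rounds_state[OF r(1) state_init[OF assms(3)]] unfolding eq by blast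
    moreover have "disjoint P'" using rounds_state[OF r(2) state_init[OF assms(3)]] stateD(3) by blast
    ultimately show ?thesis using T disjointD[of P' T T'] by blast
  qed
  show ?thesis
  proof (cases "t \<le> t'")
    case True
    then show ?thesis using aux assms by blast
  next
    case False
    then have "t' \<le> t" by simp
    from aux[OF this assms(2,1,5,4,7,6)] show ?thesis by simp
  qed
qed

text \<open>The events that \<open>T\<close> is formed with \<open>b0\<close> as a member are
  disjoint for different \<open>T\<close>, so the exponential number of candidates does not enter
  the bound. For each \<open>T\<close> the sign flips apply. Only members outside the class of
  \<open>a\<close> are considered, because the signs inside a class may be known from Stage
  1.\<close>

lemma prob_bad4_at:
  assumes fam: "families ps"
  shows "\<P>(f in M. bad4_at ps i a b0 (curry f)) \<le> (1/2) ^ (19 * s)"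
proof (cases "i \<in> {1..20} \<and> a \<in> N i")
  case False
  then have "{f\<in>space M. bad4_at ps i a b0 (curry f)} = {}" unfolding bad4_at_def by blast
  then show ?thesis by (simp only: measure_empty) simp
next
  case True
  then have i: "i \<in> {1..20}" and a: "a \<in> N i" by blast+
  have an: "a < n" using a N_subset[OF i] by auto
  let ?G = "\<lambda>T f. \<exists>t pis P. rounds \<sigma> (curry f) s t ps {} = Some (pis, P) \<and> T \<in> P \<and> b0 \<in> T"
  let ?B = "\<lambda>T f. \<forall>b\<in>T - N i. 0 \<le> curry f b a"
  have mG: "Measurable.pred M (?G T)" for T
  proof (rule measurable_same_cmp)
    fix f g assume sc: "same_cmp (curry f) (curry g)"
    show "?G T f = ?G T g" unfolding rounds_cong[OF same_cmp_compat[OF sc] fam] by (rule refl)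
  qed
  let ?V = "{T \<in> Pow {0..<n}. card (T - N i) = 19 * s \<and> a \<notin> T}"
  show ?thesis
  proof (rule prob_by_value[where V = ?V and G = ?G and B = ?B])
    show "finite ?V" by simp
    fix T assume "T \<in> ?V"
    then have T: "T \<subseteq> {0..<n}" "card (T - N i) = 19 * s" "a \<notin> T" by auto
    let ?J = "(\<lambda>b. (b, a)) ` (T - N i)"
    have J: "?J \<subseteq> pairs n" using T(1,3) an by (auto simp: pairs_def)
    have B: "?B T f = (\<forall>j\<in>?J. 0 \<le> f j)" for f :: "nat \<times> nat \<Rightarrow> real" by auto
    show "Measurable.pred M (?G T)" by (rule mG)
    have "Measurable.pred M (\<lambda>f. \<forall>j\<in>?J. 0 \<le> f j)"
    proof (rule pred_intros_finite(3))
      show "finite ?J" by (rule finite_subset[OF J finite_pairs])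
      fix j assume "j \<in> ?J"
      then have [measurable]: "j \<in> pairs n" using J by blast
      show "Measurable.pred M (\<lambda>f. 0 \<le> f j)" by measurable
    qed
    then show "Measurable.pred M (\<lambda>f. ?G T f \<and> ?B T f)" unfolding B by (rule pred_intros_logic(3)[OF mG])
    have "\<P>(f in M. ?G T f \<and> ?B T f) \<le> (1/2) ^ card ?J * \<P>(f in M. ?G T f)"
      unfolding B
    proof (rule prob_flip_closed[OF mG J])
      fix f j assume f: "?G T f" and j: "j \<in> ?J" "0 \<le> f j"
      from f obtain t pis P where r: "rounds \<sigma> (curry f) s t ps {} = Some (pis, P)" "T \<in> P" "b0 \<in> T" by blast
      from j(1) obtain b where b: "j = (b, a)" "b \<in> T" by blast
      have st: "state ps pis P" using rounds_state[OF r(1) state_init[OF fam]] by blast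
      have "rounds \<sigma> (curry (f(j := - f j))) s t ps {} = Some (pis, P)"
      proof (rule rounds_mono[OF r(1) state_init[OF fam]])
        show "curry (f(j := - f j)) c d \<le> curry f c d" for c d using j(2) by (simp add: curry_def)
        fix T' c d assume T': "T' \<in> P" "c \<in> T'" "d \<in> T'"
        \<comment> \<open>The only merged coalition containing \<open>b\<close> is \<open>T\<close>,
          which does not contain \<open>a\<close>; the lowered utility is therefore inside no merged
          coalition.\<close>
        have "(c, d) \<noteq> j"
        proof
          assume "(c, d) = j"
          then have "c = b" "d = a" using b(1) by simp_all
          then have "T' = T" using disjointD[OF stateD(3)[OF st] T'(1) r(2)] T'(2) b(2) by blast
          then show False using T'(3) \<open>d = a\<close> T(3) by simp
        qed
        then show "curry (f(j := - f j)) c d = curry f c d" by (simp add: curry_def)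
      qed
      then show "?G T (f(j := - f j))" using r(2,3) by blast
    qed
    also have "card ?J = 19 * s" using T(2) by (subst card_image) (simp_all add: inj_on_def)
    finally show "\<P>(f in M. ?G T f \<and> ?B T f) \<le> (1/2) ^ (19 * s) * \<P>(f in M. ?G T f)" .
  next
    fix T T' f assume "?G T f" "?G T' f"
    then obtain t pis P t' pis' P' where "rounds \<sigma> (curry f) s t ps {} = Some (pis, P)" "T \<in> P" "b0 \<in> T"
      "rounds \<sigma> (curry f) s t' ps {} = Some (pis', P')" "T' \<in> P'" "b0 \<in> T'" by (elim exE conjE)
    then show "T = T'" by (intro formed_unique[OF _ _ fam])
  next
    fix f assume "bad4_at ps i a b0 (curry f)"
    then obtain t pis P T where r: "rounds \<sigma> (curry f) s t ps {} = Some (pis, P)" "T \<in> P" "a \<notin> T" "b0 \<in> T" "?B T f"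
      unfolding bad4_at_def by blast
    have st: "state ps pis P" using rounds_state[OF r(1) state_init[OF fam]] by blast
    have "T \<in> ?V" using stateD(4)[OF st r(2)] state_card_coalition[OF st r(2) i] r(3) by simp
    then show "\<exists>T\<in>?V. ?G T f \<and> ?B T f" using r by blast
  qed simp
qed

lemma prob_bad4:
  assumes fam: "families ps"
  shows "\<P>(f in M. \<exists>i a b0. bad4_at ps i a b0 (curry f)) \<le> 20 * (real n)\<^sup>2 * (1/2) ^ (19 * s)"
proof -
  let ?V = "{1..20::nat} \<times> {0..<n} \<times> {0..<n}"
  have "\<P>(f in M. \<exists>i a b0. bad4_at ps i a b0 (curry f)) \<le> card ?V * (1/2) ^ (19 * s)"
  proof (rule prob_union_bound[where B = "\<lambda>(i, a, b0) f. bad4_at ps i a b0 (curry f)"])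
    fix v :: "nat \<times> nat \<times> nat"
    obtain i a b0 where v: "v = (i, a, b0)" by (metis prod_cases3)
    show "\<P>(f in M. (\<lambda>(i, a, b0) f. bad4_at ps i a b0 (curry f)) v f) \<le> (1/2) ^ (19 * s)"
      unfolding v prod.case by (rule prob_bad4_at[OF fam])
    show "Measurable.pred M ((\<lambda>(i, a, b0) f. bad4_at ps i a b0 (curry f)) v)"
      unfolding v prod.case by (rule measurable_same_cmp) (rule bad4_at_cong[OF same_cmp_similar fam])
  next
    fix f assume "\<exists>i a b0. bad4_at ps i a b0 (curry f)"
    then obtain i a b0 where b: "bad4_at ps i a b0 (curry f)" by blast
    then obtain t pis P T where r: "rounds \<sigma> (curry f) s t ps {} = Some (pis, P)" "T \<in> P" "i \<in> {1..20}" "a \<in> N i" "b0 \<in> T"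
      unfolding bad4_at_def by blast
    have st: "state ps pis P" using rounds_state[OF r(1) state_init[OF fam]] by blast
    have "a \<in> {0..<n}" "b0 \<in> {0..<n}" using N_subset[OF r(3)] stateD(4)[OF st r(2)] r(4,5) by blast+
    then have "(i, a, b0) \<in> ?V" using r(3) by (intro SigmaI)
    then show "\<exists>v\<in>?V. (\<lambda>(i, a, b0) f. bad4_at ps i a b0 (curry f)) v f"
      by (rule bexI[rotated]) (use b in simp)
  qed simp
  then show ?thesis by (simp add: power2_eq_square mult_ac)
qed

definition bad :: "(nat \<Rightarrow> nat set set) \<Rightarrow> nat \<Rightarrow> nat \<Rightarrow> nat \<Rightarrow> utility \<Rightarrow> bool" where
  "bad ps l m r u \<longleftrightarrow> bad2 ps l u \<or> (\<exists>k x D. bad3_at ps m r k x D u) \<or> (\<exists>i a b0. bad4_at ps i a b0 u)"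

lemma bad_cong:
  assumes "similar u u'" "families ps"
  shows "bad ps l m r u = bad ps l m r u'"
  unfolding bad_def bad2_cong[OF similarD(1)[OF assms(1)] assms(2)] bad3_at_cong[OF assms] bad4_at_cong[OF assms]
  by (rule refl)

definition eps2 :: "nat \<Rightarrow> nat \<Rightarrow> nat \<Rightarrow> real" where
  "eps2 l m r = 20 * (real n + 1) ^ 20 * (1/2) ^ l
     + (400 * (real n + 1)\<^sup>2 * (2 ^ r * (1 - (1/2) ^ (2 * s + 4) / 2) ^ m) + 20 * (real n)\<^sup>2 * (1/2) ^ (19 * s))"

lemma eps2_nonneg: "0 \<le> eps2 l m r"
  unfolding eps2_def
  by (intro add_nonneg_nonneg mult_nonneg_nonneg zero_le_power) (use power_le_one[of "1/2::real" "2 * s + 4"] in auto)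

lemma measurable_bad:
  assumes fam: "families ps"
  shows "Measurable.pred M (\<lambda>f. bad ps l m r (curry f))"
  by (rule measurable_same_cmp) (rule bad_cong[OF same_cmp_similar fam])

lemma prob_bad:
  assumes hq: "20 * real s * exp (- (real s / 12800)) \<le> 1/2" and fam: "families ps"
  shows "\<P>(f in M. bad ps l m r (curry f)) \<le> eps2 l m r"
proof -
  let ?b2 = "\<lambda>f. bad2 ps l (curry f)" and ?b3 = "\<lambda>f. \<exists>k x D. bad3_at ps m r k x D (curry f)"
    and ?b4 = "\<lambda>f. \<exists>i a b0. bad4_at ps i a b0 (curry f)"
  have 2: "{f\<in>space M. ?b2 f} \<in> sets M"
  proof -
    have "Measurable.pred M ?b2"
      by (rule measurable_same_cmp) (rule bad2_cong[OF same_cmp_compat fam])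
    then show ?thesis unfolding pred_def .
  qed
  have 3: "{f\<in>space M. ?b3 f} \<in> sets M"
  proof -
    have "Measurable.pred M ?b3"
    proof (rule measurable_same_cmp)
      fix f g assume "same_cmp (curry f) (curry g)"
      from bad3_at_cong[OF same_cmp_similar[OF this] fam] show "?b3 f = ?b3 g" by simp
    qed
    then show ?thesis unfolding pred_def .
  qed
  have 4: "{f\<in>space M. ?b4 f} \<in> sets M"
  proof -
    have "Measurable.pred M ?b4"
    proof (rule measurable_same_cmp)
      fix f g assume "same_cmp (curry f) (curry g)"
      from bad4_at_cong[OF same_cmp_similar[OF this] fam] show "?b4 f = ?b4 g" by simp
    qed
    then show ?thesis unfolding pred_def .
  qed
  have "{f\<in>space M. bad ps l m r (curry f)} = {f\<in>space M. ?b2 f} \<union> ({f\<in>space M. ?b3 f} \<union> {f\<in>space M. ?b4 f})"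
    unfolding bad_def by blast
  then have "\<P>(f in M. bad ps l m r (curry f)) = prob ({f\<in>space M. ?b2 f} \<union> ({f\<in>space M. ?b3 f} \<union> {f\<in>space M. ?b4 f}))"
    by (rule arg_cong)
  also have "\<dots> \<le> \<P>(f in M. ?b2 f) + prob ({f\<in>space M. ?b3 f} \<union> {f\<in>space M. ?b4 f})"
    by (rule measure_Un_le[OF 2 sets.Un[OF 3 4]])
  also have "prob ({f\<in>space M. ?b3 f} \<union> {f\<in>space M. ?b4 f}) \<le> \<P>(f in M. ?b3 f) + \<P>(f in M. ?b4 f)"
    by (rule measure_Un_le[OF 3 4])
  also note prob_bad2[OF hq fam, of l]
  also note prob_bad3[OF hq fam, of m r]
  also note prob_bad4[OF fam]
  finally show ?thesis unfolding eps2_def by simp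
qed

lemma finite_families: "finite {ps. families ps \<and> (\<forall>k. k \<notin> {1..20} \<longrightarrow> ps k = {})}"
proof (rule finite_subset)
  let ?F = "{ps. \<forall>k. (k \<in> {1..20::nat} \<longrightarrow> ps k \<in> Pow (Pow {0..<n})) \<and> (k \<notin> {1..20} \<longrightarrow> ps k = {})}"
  show "finite ?F" by (rule finite_set_of_finite_funs) simp_all
  show "{ps. families ps \<and> (\<forall>k. k \<notin> {1..20} \<longrightarrow> ps k = {})} \<subseteq> ?F"
  proof
    fix ps assume "ps \<in> {ps. families ps \<and> (\<forall>k. k \<notin> {1..20} \<longrightarrow> ps k = {})}"
    then have ps: "families ps" "\<And>k. k \<notin> {1..20} \<Longrightarrow> ps k = {}" by auto
    have "ps k \<subseteq> Pow {0..<n}" if k: "k \<in> {1..20}" for k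
      using familiesD(2)[OF ps(1) k] N_subset[OF k] by blast
    then show "ps \<in> ?F" using ps(2) by simp
  qed
qed

text \<open>The outcome of Stage 1 depends on pairs within a class, the failure events for a fixed
  outcome on pairs across classes. The uniform bound for fixed families hence holds for the random
  one.\<close>

lemma prob_stage2_fails:
  assumes hq: "20 * real s * exp (- (real s / 12800)) \<le> 1/2"
  shows "\<P>(f in M. bad (pis0 (curry f)) l m r (curry f)) \<le> eps2 l m r"
proof (rule prob_by_indep_value[where V = "{ps. families ps \<and> (\<forall>k. k \<notin> {1..20} \<longrightarrow> ps k = {})}"
      and G = "\<lambda>ps f. pis0 (curry f) = ps" and B = "\<lambda>ps f. bad ps l m r (curry f)"
      and J = "\<lambda>_. {(a, b). \<exists>k\<in>{1..20}. a \<in> N k \<and> b \<in> N k}" and K = "\<lambda>_. cross"])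
  let ?V = "{ps. families ps \<and> (\<forall>k. k \<notin> {1..20} \<longrightarrow> ps k = {})}"
  show "finite ?V" by (rule finite_families)
  show "0 \<le> eps2 l m r" by (rule eps2_nonneg)
  show "{(a, b). \<exists>k\<in>{1..20}. a \<in> N k \<and> b \<in> N k} \<inter> cross = {}"
  proof (rule equals0I, clarsimp simp: cross_def)
    fix a b k i j
    assume *: "Suc 0 \<le> k" "k \<le> 20" "a \<in> N k" "b \<in> N k" "Suc 0 \<le> i" "i \<le> 20" "Suc 0 \<le> j" "j \<le> 20" "i \<noteq> j" "a \<in> N i" "b \<in> N j"
    have "k = i" using N_disjoint[of k i] * by auto
    moreover have "k = j" using N_disjoint[of k j] * by auto
    ultimately show False using * by simp
  qed
  fix ps assume "ps \<in> ?V"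
  then have fam: "families ps" by blast
  show "Measurable.pred M (\<lambda>f. pis0 (curry f) = ps)"
    by (rule measurable_same_cmp) (simp only: same_cmp_pis0)
  show "dep {(a, b). \<exists>k\<in>{1..20}. a \<in> N k \<and> b \<in> N k} (\<lambda>f. pis0 (curry f) = ps)"
  proof (rule depI)
    fix f g :: "nat \<times> nat \<Rightarrow> real"
    assume eq: "\<And>j. j \<in> {(a, b). \<exists>k\<in>{1..20}. a \<in> N k \<and> b \<in> N k} \<or> j \<notin> pairs n \<Longrightarrow> f j = g j"
    have "pis0 (curry f) k = pis0 (curry g) k" for k
    proof (cases "k \<in> {1..20}")
      case True
      have "greedy \<sigma> (curry f) s k (Suc (card (N k))) {} (N k) = greedy \<sigma> (curry g) s k (Suc (card (N k))) {} (N k)"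
      proof (rule greedy_cong[OF N_finite[OF True]])
        fix a b assume "a \<in> N k" "b \<in> N k"
        then have "(a, b) \<in> {(a, b). \<exists>k\<in>{1..20}. a \<in> N k \<and> b \<in> N k}" using True by blast
        then show "curry f a b = curry g a b" using eq[of "(a, b)"] by simp
      qed
      then show ?thesis unfolding pis0_def stage1_def by (simp only:)
    next
      case False
      then show ?thesis unfolding pis0_def by (simp only: if_False)
    qed
    then have "pis0 (curry f) = pis0 (curry g)" by (rule ext)
    then show "(pis0 (curry f) = ps) = (pis0 (curry g) = ps)" by (simp only:)
  qed
  show "Measurable.pred M (\<lambda>f. bad ps l m r (curry f))" by (rule measurable_bad[OF fam])
  show "dep cross (\<lambda>f. bad ps l m r (curry f))"
  proof (rule depI)
    fix f g :: "nat \<times> nat \<Rightarrow> real"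
    assume eq: "\<And>j. j \<in> cross \<or> j \<notin> pairs n \<Longrightarrow> f j = g j"
    have "similar (curry f) (curry g)" by (rule cross_similar) (use eq in simp)
    then show "bad ps l m r (curry f) = bad ps l m r (curry g)" by (rule bad_cong[OF _ fam])
  qed
  show "\<P>(f in M. bad ps l m r (curry f)) \<le> eps2 l m r" by (rule prob_bad[OF hq fam])
next
  fix f assume "bad (pis0 (curry f)) l m r (curry f)"
  moreover have "pis0 (curry f) \<in> {ps. families ps \<and> (\<forall>k. k \<notin> {1..20} \<longrightarrow> ps k = {})}"
    using families_pis0[of "curry f"] by (simp add: pis0_def)
  ultimately show "\<exists>ps\<in>{ps. families ps \<and> (\<forall>k. k \<notin> {1..20} \<longrightarrow> ps k = {})}. pis0 (curry f) = ps \<and> bad ps l m r (curry f)"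
    by blast
next
  fix ps ps' :: "nat \<Rightarrow> nat set set" and f :: "nat \<times> nat \<Rightarrow> real"
  assume "pis0 (curry f) = ps" "pis0 (curry f) = ps'"
  then show "ps = ps'" by simp
qed

lemma good_outcome:
  assumes f: "bounded_by_1 f" and s1: "\<not> (\<exists>k\<in>{1..20}. r0 < card (N k - \<Union>(pis0 (curry f) k)))"
    and nb: "\<not> bad (pis0 (curry f)) l m r (curry f)"
    and m: "m * s + r0 + s * l \<le> n div 20" and r: "20 * (1 + 2 * r0 + s * l) \<le> r" and s6: "6 \<le> s"
  shows "outputs_IS n \<sigma> (curry f)"
proof (rule success[OF _ _ _ _ _ m r s6])
  let ?u = "curry f"
  have nb2: "\<not> bad2 (pis0 ?u) l ?u" and nb3: "\<not> bad3_at (pis0 ?u) m r k x D ?u" and nb4: "\<not> bad4_at (pis0 ?u) i a b0 ?u"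
    for k x D i a b0 using nb unfolding bad_def by blast+
  show "\<bar>?u a b\<bar> < 1" if "a < n" "b < n" "a \<noteq> b" for a b
    using f[unfolded bounded_by_1_def, rule_format, of "(a, b)"] that by (simp add: pairs_def)
  show "card (N k - \<Union>(pis0 ?u k)) \<le> r0" if "k \<in> {1..20}" for k using s1 that by (meson not_le)
  show "\<exists>k\<in>{1..20}. card (pis k) \<le> l"
    if "rounds \<sigma> ?u s t (pis0 ?u) {} = Some (pis, P)" "fst (round \<sigma> ?u s pis P {}) = None" for t pis P
  proof (rule ccontr)
    assume "\<not> (\<exists>k\<in>{1..20}. card (pis k) \<le> l)"
    then have "\<forall>k\<in>{1..20}. l < card (pis k)" by (meson not_le)
    then show False using nb2 that unfolding bad2_def by blast
  qed
  show "r \<le> card {T\<in>P. good ?u x D k T}"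
    if *: "rounds \<sigma> ?u s m (pis0 ?u) {} = Some (pis, P)" "k \<in> {1..20}" "x \<in> N k"
      "D \<in> pis k \<and> x \<in> D \<or> D = {} \<and> x \<notin> \<Union>(pis0 ?u k)" for pis P k x D
  proof (rule ccontr)
    assume "\<not> r \<le> card {T\<in>P. good ?u x D k T}"
    then have "card {T\<in>P. good ?u x D k T} < r" by simp
    then have "bad3_at (pis0 ?u) m r k x D ?u"
      unfolding bad3_at_def using * by (intro exI[of _ pis] exI[of _ P] conjI)
    then show False using nb3 by blast
  qed
  show "\<exists>b\<in>T. ?u b a < 0"
    if *: "rounds \<sigma> ?u s t (pis0 ?u) {} = Some (pis, P)" "T \<in> P" "a < n" "a \<notin> T" for t pis P T a
  proof (rule ccontr)
    assume neg: "\<not> (\<exists>b\<in>T. ?u b a < 0)"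
    have "a \<in> (\<Union>k\<in>{1..20}. N k)" unfolding N_union using *(3) by simp
    then obtain i where i: "i \<in> {1..20}" "a \<in> N i" by blast
    have "state (pis0 ?u) pis P" using rounds_state[OF *(1) state_init[OF families_pis0]] by blast
    from state_part_card[OF this *(2) i(1)] have "T \<noteq> {}" using s_pos by auto
    then obtain b0 where b0: "b0 \<in> T" by blast
    have "\<forall>b\<in>T - N i. 0 \<le> ?u b a" using neg by (meson DiffD1 not_le)
    then have "bad4_at (pis0 ?u) i a b0 ?u"
      unfolding bad4_at_def using *(1,2,4) i b0 by (intro exI[of _ t] exI[of _ pis] exI[of _ P] exI[of _ T] conjI)
    then show False using nb4 by blast
  qed
qed

lemma prob_success:
  assumes hq: "20 * real s * exp (- (real s / 12800)) \<le> 1/2"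
    and m: "m * s + r0 + s * l \<le> n div 20" and r: "20 * (1 + 2 * r0 + s * l) \<le> r" and s6: "6 \<le> s"
  shows "1 - (20 * ((real n + 1) * eps1 r0) + eps2 l m r) \<le> \<P>(f in M. outputs_IS n \<sigma> (curry f))"
proof -
  let ?b1 = "\<lambda>f. \<exists>k\<in>{1..20}. r0 < card (N k - \<Union>(pis0 (curry f) k))"
  let ?b2 = "\<lambda>f. bad (pis0 (curry f)) l m r (curry f)"
  let ?o = "\<lambda>f. outputs_IS n \<sigma> (curry f)"
  have m1: "{f\<in>space M. ?b1 f} \<in> sets M"
  proof -
    have "Measurable.pred M ?b1" by (rule measurable_same_cmp) (simp only: same_cmp_pis0)
    then show ?thesis unfolding pred_def .
  qed
  have m2: "{f\<in>space M. ?b2 f} \<in> sets M"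
  proof -
    have "Measurable.pred M ?b2"
    proof (rule measurable_same_cmp)
      fix f g assume sc: "same_cmp (curry f) (curry g)"
      show "?b2 f = ?b2 g" unfolding same_cmp_pis0[OF sc] by (rule bad_cong[OF same_cmp_similar[OF sc] families_pis0])
    qed
    then show ?thesis unfolding pred_def .
  qed
  have "1 - \<P>(f in M. ?o f) = \<P>(f in M. \<not> ?o f)"
    by (rule prob_neg[symmetric]) (use measurable_outputs_IS in \<open>simp only: pred_def\<close>)
  also have "\<dots> = \<P>(f in M. bounded_by_1 f \<and> \<not> ?o f)"
  proof (rule prob_bounded)
    note [measurable] = measurable_outputs_IS
    show "Measurable.pred M (\<lambda>f. \<not> ?o f)" by measurable
  qed
  also have "\<dots> \<le> prob ({f\<in>space M. ?b1 f} \<union> {f\<in>space M. ?b2 f})"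
  proof (rule finite_measure_mono)
    show "{f\<in>space M. bounded_by_1 f \<and> \<not> ?o f} \<subseteq> {f\<in>space M. ?b1 f} \<union> {f\<in>space M. ?b2 f}"
      using good_outcome[OF _ _ _ m r s6] by blast
    show "{f\<in>space M. ?b1 f} \<union> {f\<in>space M. ?b2 f} \<in> sets M" by (rule sets.Un[OF m1 m2])
  qed
  also have "\<dots> \<le> \<P>(f in M. ?b1 f) + \<P>(f in M. ?b2 f)" by (rule measure_Un_le[OF m1 m2])
  also have "\<dots> \<le> 20 * ((n + 1) * eps1 r0) + eps2 l m r"
    by (rule add_mono[OF prob_stage1_fails prob_stage2_fails[OF hq]])
  finally show ?thesis by (simp add: add.commute)
qed

end

section \<open>Asymptotics\<close>

context
  fixes n :: nat assumes n: "1 < n"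
begin

lemma s_param_bounds:
  "log 16 n / 2 \<le> s_param n" "real (s_param n) < log 16 n / 2 + 1" "real (s_param n) \<le> ln n + 1" "0 < s_param n"
proof -
  have L: "0 < log 16 n" using n by simp
  have "real (s_param n) = of_int \<lceil>log 16 n / 2\<rceil>"
    unfolding s_param_def using L by (simp add: of_nat_nat)
  then show 1: "log 16 n / 2 \<le> s_param n" and 2: "real (s_param n) < log 16 n / 2 + 1" by linarith+
  show "0 < s_param n" using 1 L by linarith
  have "1 \<le> ln (16::real)"
    using exp_le by (subst ln_ge_iff) simp_all
  then have "log 16 n \<le> ln n" using n by (simp add: log_def divide_le_eq mult_left_le_one_le mult_le_cancel_left1)
  moreover have "0 < ln (real n)" using n by simp
  ultimately show "real (s_param n) \<le> ln n + 1" using 2 L by linarith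
qed

lemma pow_eq_powr:
  "(2::real) powr (real m) = 2 ^ m" "(16::real) powr (real m) = 16 ^ m"
  by (simp_all add: powr_realpow)

lemma powr_log16: "(16::real) powr (c * log 16 n) = real n powr c" "(2::real) powr (4 * c * log 16 n) = real n powr c"
proof -
  show 1: "(16::real) powr (c * log 16 n) = real n powr c"
    using n by (simp add: mult.commute[of c] powr_powr[symmetric])
  have "(2::real) powr (4 * c * log 16 n) = (2 powr 4) powr (c * log 16 n)"
    by (simp only: powr_powr mult.assoc)
  also have "(2::real) powr 4 = 16" by simp
  finally show "(2::real) powr (4 * c * log 16 n) = real n powr c" using 1 by simp
qed

text \<open>Rounding up makes s exceed half of log_16 n by less than 1, and the exponent
  \<open>s - 1\<close> absorbs exactly this excess.\<close>

lemma sixteenth_pow_ge: "real n powr (-1/2) \<le> (1/16) ^ (s_param n - 1)"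
proof -
  have "(16::real) ^ (s_param n - 1) = 16 powr (real (s_param n - 1))" by (simp add: powr_realpow)
  also have "\<dots> \<le> 16 powr ((1/2) * log 16 n)"
    by (rule powr_mono) (use s_param_bounds in \<open>simp_all add: of_nat_diff\<close>)
  also have "\<dots> = real n powr (1/2)" by (rule powr_log16)
  finally have "16 ^ (s_param n - 1) \<le> real n powr (1/2)" .
  then have "inverse (real n powr (1/2)) \<le> inverse (16 ^ (s_param n - 1))"
    by (rule le_imp_inverse_le) simp
  then show ?thesis by (simp add: powr_minus power_inverse[symmetric] inverse_eq_divide power_one_over)
qed

lemma two_pow_le: "(2::real) ^ (s_param n - 1) \<le> real n powr (1/8)"
proof -
  have "(2::real) ^ (s_param n - 1) = 2 powr (real (s_param n - 1))" by (simp add: powr_realpow)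
  also have "\<dots> \<le> 2 powr (4 * (1/8) * log 16 n)"
    by (rule powr_mono) (use s_param_bounds in \<open>simp_all add: of_nat_diff\<close>)
  also have "\<dots> = real n powr (1/8)" by (rule powr_log16)
  finally show ?thesis .
qed

text \<open>Here \<open>2 * s + 4\<close> is at most log_16 n + 6; the 6 becomes the factor 64, and
  2 to the power log_16 n is the fourth root of n.\<close>

lemma half_pow_ge: "real n powr (-1/4) / 64 \<le> (1/2) ^ (2 * s_param n + 4)"
proof -
  have "(2::real) ^ (2 * s_param n + 4) = 2 powr (real (2 * s_param n + 4))" by (simp only: pow_eq_powr)
  also have "\<dots> \<le> 2 powr (4 * (1/4) * log 16 n + 6)"
    by (rule powr_mono) (use s_param_bounds in simp_all)
  also have "\<dots> = real n powr (1/4) * 64" unfolding powr_add powr_log16(2) by simp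
  finally have "2 ^ (2 * s_param n + 4) \<le> real n powr (1/4) * 64" .
  then have "inverse (real n powr (1/4) * 64) \<le> inverse (2 ^ (2 * s_param n + 4))"
    by (rule le_imp_inverse_le) simp
  then show ?thesis by (simp add: powr_minus power_one_over inverse_eq_divide)
qed

lemma half_pow_le: "(1/2) ^ (19 * s_param n) \<le> real n powr (-19/8)"
proof -
  have "real n powr (19/8) = 2 powr (4 * (19/8) * log 16 n)" by (rule powr_log16(2)[symmetric])
  also have "\<dots> \<le> 2 powr (real (19 * s_param n))"
    by (rule powr_mono) (use s_param_bounds in simp_all)
  also have "\<dots> = 2 ^ (19 * s_param n)" by (rule pow_eq_powr)
  finally have "inverse (2 ^ (19 * s_param n)) \<le> inverse (real n powr (19/8))"
    by (rule le_imp_inverse_le) (use n in simp)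
  then show ?thesis by (simp add: powr_minus power_one_over inverse_eq_divide)
qed

end

text \<open>\<open>k\<close> is a real lower bound of the exponent and is allowed to be negative, so
  the estimate can be used with \<open>merged\<close> without knowing its sign.\<close>

lemma one_minus_pow_le_exp:
  fixes x y :: real
  assumes "0 \<le> x" "x \<le> y" "y \<le> 1" "k \<le> real m"
  shows "(1 - y) ^ m \<le> exp (- (x * k))"
proof -
  have "(1 - y) ^ m \<le> exp (- y) ^ m"
    by (rule power_mono) (use assms exp_ge_add_one_self[of "- y"] in auto)
  also have "\<dots> = exp (- (y * real m))" by (simp add: exp_of_nat_mult[symmetric] mult.commute)
  also have "\<dots> \<le> exp (- (x * k))"
  proof -
    have "x * k \<le> x * real m" using assms by (intro mult_left_mono) auto
    also have "\<dots> \<le> y * real m" using assms by (intro mult_right_mono) auto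
    finally show ?thesis by simp
  qed
  finally show ?thesis .
qed

text \<open>\<open>leftover n\<close> bounds the number of agents of one class that remain after Stages 1 and 2, and
  \<open>merged n\<close> is a lower bound on the number of merged coalitions.\<close>

definition leftover :: "real \<Rightarrow> real" where
  "leftover y = (y powr (3/5) + 1) + (ln y + 1) * (y powr (1/4) + 1)"

definition merged :: "real \<Rightarrow> real" where
  "merged y = (y / 20 - 1 - leftover y) / (ln y + 1) - 1"

text \<open>The summands stand for Stage 1, a premature end of Stage 2, an agent without enough
  coalitions, and a coalition without objector. In the third, \<open>leftover\<close> is of order
  y^(3/5) while y^(-1/4) times \<open>merged\<close> is of order y^(3/4) / ln y, so the negative
  term wins.\<close>

definition failure_bound :: "real \<Rightarrow> real" where
  "failure_bound y = 20 * ((y + 1) * (y powr (1/8) * exp (- (y powr (1/10) / 2)))) +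
     (20 * (y + 1) ^ 20 * 2 powr (- (y powr (1/4))) +
      (400 * (y + 1)\<^sup>2 * exp (40 * (1 + leftover y) - y powr (-1/4) / 128 * merged y) +
       20 * y\<^sup>2 * y powr (-19/8)))"

lemma failure_bound_tendsto: "(failure_bound \<longlongrightarrow> 0) at_top"
proof -
  have 1: "((\<lambda>y::real. 20 * ((y + 1) * (y powr (1/8) * exp (- (y powr (1/10) / 2))))) \<longlongrightarrow> 0) at_top" by real_asymp
  have 2: "((\<lambda>y::real. 20 * (y + 1) ^ 20 * 2 powr (- (y powr (1/4)))) \<longlongrightarrow> 0) at_top" by real_asymp
  have 3: "((\<lambda>y. 400 * (y + 1)\<^sup>2 * exp (40 * (1 + leftover y) - y powr (-1/4) / 128 * merged y)) \<longlongrightarrow> 0) at_top"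
    unfolding merged_def leftover_def by real_asymp
  have 4: "((\<lambda>y::real. 20 * y\<^sup>2 * y powr (-19/8)) \<longlongrightarrow> 0) at_top" by real_asymp
  have "((\<lambda>y. failure_bound y) \<longlongrightarrow> 0 + (0 + (0 + 0))) at_top"
    unfolding failure_bound_def by (intro tendsto_add 1 2 3 4)
  then show ?thesis by simp
qed

lemma prob_success_explicit:
  fixes n :: nat
  assumes valid: "valid_strat n \<sigma>" and n: "1 < n" and s6: "6 \<le> s_param n"
    and hq: "20 * real (s_param n) * exp (- (real (s_param n) / 12800)) \<le> 1/2"
    and big: "leftover n \<le> real n / 20 - 1"
  shows "1 - failure_bound n \<le> measure (utility_space n) {f \<in> space (utility_space n). outputs_IS n \<sigma> (curry f)}"
proof -
  interpret ashg_run n \<sigma> using valid s6 by unfold_locales auto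
  \<comment> \<open>The success probability \<open>n powr (-1/2)\<close> of a single candidate
    against \<open>n powr (3/5)\<close> candidates leaves the exponent 1/10. For \<open>l\<close>
    any small power of n would do that beats logarithms and keeps \<open>s * l\<close> well below
    \<open>n powr (3/4)\<close>.\<close>
  define r0 where "r0 = nat \<lceil>real n powr (3/5)\<rceil>"
  define l where "l = nat \<lceil>real n powr (1/4)\<rceil>"
  define r where "r = 20 * (1 + 2 * r0 + s * l)"
  \<comment> \<open>The number of rounds that class sizes guarantee: agents outside cliques and the
    at most \<open>l\<close> cliques left in an exhausted class are subtracted before dividing by
    the clique size.\<close>
  define m where "m = (n div 20 - r0 - s * l) div s"
  have ceil: "x \<le> real (nat \<lceil>x\<rceil>)" "real (nat \<lceil>x\<rceil>) \<le> x + 1" if "0 \<le> x" for x :: real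
  proof -
    have "0 \<le> \<lceil>x\<rceil>" using that by simp
    then have "real (nat \<lceil>x\<rceil>) = of_int \<lceil>x\<rceil>" by (rule of_nat_nat)
    then show "x \<le> real (nat \<lceil>x\<rceil>)" "real (nat \<lceil>x\<rceil>) \<le> x + 1" by linarith+
  qed
  have r0: "real n powr (3/5) \<le> r0" "real r0 \<le> real n powr (3/5) + 1"
    unfolding r0_def by (rule ceil; simp)+
  have l: "real n powr (1/4) \<le> l" "real l \<le> real n powr (1/4) + 1"
    unfolding l_def by (rule ceil; simp)+
  have lnn: "0 < ln (real n)" using n by simp
  note s = s_param_bounds[OF n]
  have sl: "real (s * l) \<le> (ln n + 1) * (real n powr (1/4) + 1)"
    unfolding of_nat_mult by (rule mult_mono) (use s(3) l(2) lnn in auto)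
  have left: "real (r0 + s * l) \<le> leftover n" unfolding leftover_def of_nat_add by (rule add_mono[OF r0(2) sl])
  have div: "real n / 20 - 1 \<le> real (n div 20)"
  proof -
    have "n < 20 * (n div 20) + 20" by presburger
    then have "real n < real (20 * (n div 20) + 20)" by (simp only: of_nat_less_iff)
    then show ?thesis by simp
  qed
  have "real (r0 + s * l) \<le> real (n div 20)" using left big div by linarith
  then have fits: "r0 + s * l \<le> n div 20" by (simp only: of_nat_le_iff)
  have "m * s \<le> n div 20 - r0 - s * l" unfolding m_def by (rule div_times_less_eq_dividend)
  then have ms: "m * s + r0 + s * l \<le> n div 20" using fits by linarith
  have rr: "real r \<le> 40 * (1 + leftover n)"
  proof -
    have "real r \<le> 40 * (1 + real (r0 + s * l))" unfolding r_def by simp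
    also have "\<dots> \<le> 40 * (1 + leftover n)" by (intro mult_left_mono add_left_mono left) simp
    finally show ?thesis .
  qed
  have mm: "merged n \<le> real m"
  proof -
    let ?A = "n div 20 - r0 - s * l"
    have "real ?A = real (n div 20) - real (r0 + s * l)" using fits by (simp add: of_nat_diff)
    then have A: "real n / 20 - 1 - leftover n \<le> real ?A"
      by (simp only:) (intro diff_mono div left)
    have "(real n / 20 - 1 - leftover n) / (ln n + 1) \<le> real ?A / real s"
      by (rule frac_le) (use A s(3,4) in auto)
    also have "real ?A / real s \<le> real m + 1"
    proof -
      have "?A < (m + 1) * s" unfolding m_def using s(4) by (simp add: dividend_less_div_times)
      then have "real ?A < real ((m + 1) * s)" by (simp only: of_nat_less_iff)
      from less_imp_le[OF this] show ?thesis
        using s(4) by (simp only: divide_le_eq of_nat_0_less_iff if_True of_nat_mult of_nat_add of_nat_1)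
    qed
    finally show ?thesis unfolding merged_def by linarith
  qed
  have p: "0 \<le> (1/2::real) ^ (2 * s + 4)" "(1/2::real) ^ (2 * s + 4) \<le> 1" "(1/16::real) ^ (s - 1) \<le> 1"
    by (simp_all add: power_le_one)
  have "eps1 r0 \<le> real n powr (1/8) * exp (- (real n powr (1/10) / 2))"
    unfolding eps1_def
  proof (rule mult_mono[OF two_pow_le[OF n]])
    have "(1 - (1/16) ^ (s - 1) / 2) ^ r0 \<le> exp (- ((real n powr (-1/2) / 2) * (real n powr (3/5))))"
      by (rule one_minus_pow_le_exp) (use sixteenth_pow_ge[OF n] r0(1) p in auto)
    also have "(real n powr (-1/2) / 2) * (real n powr (3/5)) = real n powr (1/10) / 2"
      by (simp add: powr_add[symmetric])
    finally show "(1 - (1/16) ^ (s - 1) / 2) ^ r0 \<le> exp (- (real n powr (1/10) / 2))" .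
  qed (use p in auto)
  then have 1: "20 * ((real n + 1) * eps1 r0) \<le> 20 * ((real n + 1) * (real n powr (1/8) * exp (- (real n powr (1/10) / 2))))"
    by (intro mult_left_mono) auto
  have "(1/2::real) ^ l = 2 powr (- real l)" by (simp add: powr_minus powr_realpow power_one_over inverse_eq_divide)
  also have "\<dots> \<le> 2 powr (- (real n powr (1/4)))" using l(1) by simp
  finally have 2: "20 * (real n + 1) ^ 20 * (1/2) ^ l \<le> 20 * (real n + 1) ^ 20 * 2 powr (- (real n powr (1/4)))"
    by (intro mult_left_mono) auto
  have "(2::real) ^ r * (1 - (1/2) ^ (2 * s + 4) / 2) ^ m
      \<le> exp (40 * (1 + leftover n)) * exp (- (real n powr (-1/4) / 128 * merged n))"
  proof (rule mult_mono)
    have "(2::real) ^ r \<le> exp 1 ^ r" by (rule power_mono) (use exp_ge_add_one_self[of 1] in auto)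
    also have "\<dots> = exp (real r)" by (simp add: exp_of_nat_mult[symmetric])
    also have "\<dots> \<le> exp (40 * (1 + leftover n))" using rr by simp
    finally show "(2::real) ^ r \<le> exp (40 * (1 + leftover n))" .
    show "(1 - (1/2) ^ (2 * s + 4) / 2) ^ m \<le> exp (- (real n powr (-1/4) / 128 * merged n))"
      by (rule one_minus_pow_le_exp) (use half_pow_ge[OF n] p mm in auto)
  qed (use p in auto)
  then have "(2::real) ^ r * (1 - (1/2) ^ (2 * s + 4) / 2) ^ m
      \<le> exp (40 * (1 + leftover n) - real n powr (-1/4) / 128 * merged n)"
    by (simp add: exp_add[symmetric])
  then have 3: "400 * (real n + 1)\<^sup>2 * (2 ^ r * (1 - (1/2) ^ (2 * s + 4) / 2) ^ m)
      \<le> 400 * (real n + 1)\<^sup>2 * exp (40 * (1 + leftover n) - real n powr (-1/4) / 128 * merged n)"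
    by (intro mult_left_mono) auto
  have 4: "20 * (real n)\<^sup>2 * (1/2) ^ (19 * s) \<le> 20 * (real n)\<^sup>2 * real n powr (-19/8)"
    by (intro mult_left_mono half_pow_le[OF n]) auto
  have "20 * ((real n + 1) * eps1 r0) + eps2 l m r \<le> failure_bound n"
    unfolding failure_bound_def eps2_def by (intro add_mono 1 2 3 4)
  then show ?thesis
    using prob_success[OF hq ms _ s6, of r] unfolding M_eq r_def by simp
qed

theorem theorem20:
  fixes \<sigma> :: "nat \<Rightarrow> strat"
  assumes "\<forall>n. valid_strat n (\<sigma> n)"
  shows "(\<lambda>n. measure (utility_space n)
            {f \<in> space (utility_space n). outputs_IS n (\<sigma> n) (curry f)}) \<longlonglongrightarrow> 1"
proof (rule tendsto_sandwich)
  have s_top: "filterlim (\<lambda>n. real (s_param n)) at_top sequentially"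
  proof (rule filterlim_at_top_mono)
    show "filterlim (\<lambda>n. log 16 (real n) / 2) at_top sequentially" by real_asymp
    show "\<forall>\<^sub>F n in sequentially. log 16 (real n) / 2 \<le> real (s_param n)"
      using eventually_gt_at_top[of 1] by eventually_elim (rule s_param_bounds)
  qed
  \<comment> \<open>Only the divergence of s is needed here, so the huge constant 12800 merely
    delays the threshold for n.\<close>
  have "((\<lambda>x::real. 20 * x * exp (- (x / 12800))) \<longlongrightarrow> 0) at_top" by real_asymp
  then have "((\<lambda>n. 20 * real (s_param n) * exp (- (real (s_param n) / 12800))) \<longlongrightarrow> 0) sequentially"
    by (rule filterlim_compose[OF _ s_top])
  then have hq: "\<forall>\<^sub>F n in sequentially. 20 * real (s_param n) * exp (- (real (s_param n) / 12800)) < 1/2"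
    by (rule order_tendstoD) simp
  have s6: "\<forall>\<^sub>F n in sequentially. 6 \<le> real (s_param n)"
    using s_top unfolding filterlim_at_top by blast
  have big: "\<forall>\<^sub>F n in sequentially. leftover (real n) \<le> real n / 20 - 1"
    unfolding leftover_def by real_asymp
  show "\<forall>\<^sub>F n in sequentially. 1 - failure_bound (real n)
      \<le> measure (utility_space n) {f \<in> space (utility_space n). outputs_IS n (\<sigma> n) (curry f)}"
    using hq s6 big eventually_gt_at_top[of 1]
  proof eventually_elim
    case (elim n)
    show ?case
      by (rule prob_success_explicit) (use assms elim in auto)
  qed
  have "((\<lambda>n. 1 - failure_bound (real n)) \<longlongrightarrow> 1 - 0) sequentially"
    by (intro tendsto_intros filterlim_compose[OF failure_bound_tendsto filterlim_real_sequentially])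
  then show "(\<lambda>n. 1 - failure_bound (real n)) \<longlonglongrightarrow> 1" by simp
  have "prob_space (utility_space n)" for n
    unfolding utility_space_def by (rule prob_space_PiM) (rule prob_space_unif)
  then show "\<forall>\<^sub>F n in sequentially. measure (utility_space n)
      {f \<in> space (utility_space n). outputs_IS n (\<sigma> n) (curry f)} \<le> 1"
    by (intro always_eventually allI prob_space.prob_le_1)
qed (rule tendsto_const)

end
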